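(* Let $\Gamma$ be a discrete cocompact subgroup of $\mathrm{PSU}(1,1)$ and $\mathfrak{g}$ the space of Killing vector fields on $\mathbb{D}$. For every cocycle $c$ representing a cohomology class $[c]\in H^1(\Gamma;\mathfrak{g})$, there exists a smooth vector field $\psi$ on the open unit disk $\mathbb{D}$ such that $c=\delta\psi$. Moreover, any such $\psi$ admits an $L^2$-extension to $\overline{\mathbb{D}}$ whose restriction $\psi^\sharp$ to the boundary circle $\mathbb{S}^1$ is tangential. There exists a homomorphism $$\varPsi:H^1(\Gamma;\mathfrak{g})\to\mathrm{HQD}(\mathbb{D},\Gamma),\qquad[c]\mapsto\big(\mathcal{L}_{\mathcal{F}(\psi^\sharp)}\mathbf{g}_{\mathbb{D}}\big)^{(2,0)},$$ where $\mathcal{F}$ is the map given by convolution with the Poisson kernel vector field and $\mathcal{F}(\psi^\sharp)$ is a harmonic vector field on the open disk $\mathbb{D}$.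
   Context: $\mathbb{D}=\{|z|<1\}$ carries $\mathbf{g}_{\mathbb{D}}=4(dx^2+dy^2)/(1-|z|^2)^2$. $\mathrm{PSU}(1,1)$ acts on $\mathbb{D}$ by $\gamma(z)=\frac{az+b}{\bar bz+\bar a}$, $|a|^2-|b|^2=1$, as the group of orientation preserving isometries. Vector fields are identified with $\mathbb{C}$-valued functions. $\mathrm{HQD}(\mathbb{D},\Gamma)$ is the vector space of holomorphic quadratic differentials $f\,dz^2$ on $\mathbb{D}$ with $f(\gamma(z))\gamma'(z)^2=f(z)$ for all $\gamma\in\Gamma$. Cohomology: $\Gamma$ acts on vector fields on $\mathbb{D}$ by $(\gamma^*F)(z)=F(\gamma(z))\gamma'(z)^{-1}$. A $1$-cocycle is a map $c:\Gamma\to\mathfrak{g}$ with $c_{\gamma_1\circ\gamma_2}=\gamma_2^*c_{\gamma_1}+c_{\gamma_2}$; the coboundary of a vector field $F$ is $\delta F:\gamma\mapsto\gamma^*F-F$; $H^1(\Gamma;\mathfrak{g})$ is the space of $\mathfrak{g}$-valued cocycles modulo coboundaries of elements of $\mathfrak{g}$. $L^2$-extension: a continuous vector field $X$ on $\mathbb{D}$ has an $L^2$-extension to $\overline{\mathbb{D}}$ if the vector fields $X_\epsilon(z)=X((1-\epsilon)z)$ on $\mathbb{S}^1$ converge as $\epsilon\to0$ in the Hilbert space of $L^2$-vector fields ($\mathbb{C}$-valued functions) on $\mathbb{S}^1$; the limit is the restriction of the extension to $\mathbb{S}^1$. An $L^2$-vector field on $\mathbb{S}^1$ is tangential if it is of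 the form $z\mapsto f(z)\,iz$ with $f$ real-valued. The map $\mathcal{F}$: for a tangential vector field $X(z)=f(z)\,iz$ on $\mathbb{S}^1$, $$\mathcal{F}(X)(z)=(f*\mathbf{K})(z)=\frac1{2\pi}\int_{\mathbb{S}^1}f(w)\,w\,\mathbf{K}(zw^{-1})\,dw,\qquad \mathbf{K}(z)=\frac{i(1-|z|^2)^3}{|1-\bar z|^2(1-\bar z)^2},$$ with $dw$ arc length on $\mathbb{S}^1$. Harmonic vector field: for a smooth map $\phi:U\to \mathbb{D}$ from an open set $U\subseteq \mathbb{D}$, the tension field is $\tau(\phi)=\mathrm{trace}(\nabla d\phi)$, with $\nabla$ induced by the Levi-Civita connections. A smooth vector field $\xi$ on $U$ is harmonic if there is a smooth family of smooth maps $\phi_t:U\to \mathbb{D}$, $t\in[0,\epsilon)$, such that $\phi_0$ is the inclusion, $\frac{d\phi_t}{dt}|_{t=0}=\xi$, and $\frac{d}{dt}|_{t=0}\tau(\phi_t)(x)=0$ for all $x\in U$ (in the standard coordinates of $\mathbb{C}$). $(2,0)$-part: the trace-free part of the Lie derivative $\mathcal{L}_\xi\mathbf{g}_{\mathbb{D}}$ can be written uniquely as the real part of $h\,dz^2$ with $h$ complex-valued, and $(\mathcal{L}_\xi\mathbf{g}_{\mathbb{D}})^{(2,0)}:=h\,dz^2$. *)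

theory Defs
  imports "HOL-Analysis.Analysis" "HOL-Algebra.Coset" "HOL-Algebra.Bij"
begin

abbreviation disc :: "complex set" where
  "disc \<equiv> ball 0 1"


section \<open>Quotient topologies\<close>

definition quotient_topology :: "'a topology \<Rightarrow> ('a \<Rightarrow> 'b) \<Rightarrow> 'b topology" where
  "quotient_topology X p =
     topology (\<lambda>U. U \<subseteq> p ` topspace X \<and> openin X {x \<in> topspace X. p x \<in> U})"

lemma openin_quotient_topology:
  "openin (quotient_topology X p) U \<longleftrightarrow>
     U \<subseteq> p ` topspace X \<and> openin X {x \<in> topspace X. p x \<in> U}"
proof -
  have "istopology (\<lambda>U. U \<subseteq> p ` topspace X \<and> openin X {x \<in> topspace X. p x \<in> U})"
    unfolding istopology_def
  proof (intro conjI allI impI)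
    fix S T
    assume "S \<subseteq> p ` topspace X \<and> openin X {x \<in> topspace X. p x \<in> S}"
      and "T \<subseteq> p ` topspace X \<and> openin X {x \<in> topspace X. p x \<in> T}"
    moreover have "{x \<in> topspace X. p x \<in> S \<inter> T} =
        {x \<in> topspace X. p x \<in> S} \<inter> {x \<in> topspace X. p x \<in> T}"
      by auto
    ultimately show "S \<inter> T \<subseteq> p ` topspace X" "openin X {x \<in> topspace X. p x \<in> S \<inter> T}"
      by auto
  next
    fix \<K>
    assume *: "\<forall>K\<in>\<K>. K \<subseteq> p ` topspace X \<and> openin X {x \<in> topspace X. p x \<in> K}"
    then show "\<Union>\<K> \<subseteq> p ` topspace X"
      by blast
    have "{x \<in> topspace X. p x \<in> \<Union>\<K>} = \<Union>((\<lambda>K. {x \<in> topspace X. p x \<in> K}) ` \<K>)"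
      by auto
    then show "openin X {x \<in> topspace X. p x \<in> \<Union>\<K>}"
      using * by auto
  qed
  then show ?thesis
    by (simp add: quotient_topology_def)
qed

lemma topspace_quotient_topology: "topspace (quotient_topology X p) = p ` topspace X"
proof
  show "topspace (quotient_topology X p) \<subseteq> p ` topspace X"
    by (metis openin_quotient_topology openin_topspace)
  have "{x \<in> topspace X. p x \<in> p ` topspace X} = topspace X"
    by auto
  then show "p ` topspace X \<subseteq> topspace (quotient_topology X p)"
    by (metis openin_quotient_topology openin_subset openin_topspace subset_refl)
qed

lemma quotient_map_quotient_topology: "quotient_map X (quotient_topology X p) p"
  by (simp add: quotient_map_def topspace_quotient_topology openin_quotient_topology)


section \<open>The group of orientation preserving isometries of the disc\<close>

definition SU11 :: "(complex \<times> complex) set" where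
  "SU11 = {(a, b). (cmod a)\<^sup>2 - (cmod b)\<^sup>2 = 1}"

definition moebius :: "complex \<times> complex \<Rightarrow> complex \<Rightarrow> complex" where
  "moebius = (\<lambda>(a, b). \<lambda>z\<in>disc. (a * z + b) / (cnj b * z + cnj a))"

text \<open>Elements of the group are maps that are extensional on the disc, multiplied by
  composition.  The topology is the one of the Lie group, i.e. the quotient topology from
  \<open>SU(1,1)\<close>, which is viewed as a subspace of \<open>\<complex>\<^sup>2\<close>.\<close>

definition PSU11 :: "(complex \<Rightarrow> complex) monoid" where
  "PSU11 = (BijGroup disc)\<lparr>carrier := moebius ` SU11\<rparr>"

definition PSU11_topology :: "(complex \<Rightarrow> complex) topology" where
  "PSU11_topology = quotient_topology (top_of_set SU11) moebius"

definition discrete_in_PSU11 :: "(complex \<Rightarrow> complex) set \<Rightarrow> bool" where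
  "discrete_in_PSU11 \<Gamma> \<longleftrightarrow> subtopology PSU11_topology \<Gamma> = discrete_topology \<Gamma>"

text \<open>The space of orbits of \<open>\<Gamma>\<close> acting by left multiplication on the group.\<close>

definition cocompact_in_PSU11 :: "(complex \<Rightarrow> complex) set \<Rightarrow> bool" where
  "cocompact_in_PSU11 \<Gamma> \<longleftrightarrow>
     compact_space (quotient_topology PSU11_topology (\<lambda>g. \<Gamma> #>\<^bsub>PSU11\<^esub> g))"


section \<open>Smooth maps\<close>

primrec Ck_on :: "nat \<Rightarrow> 'a::real_normed_vector set \<Rightarrow> ('a \<Rightarrow> 'b::real_normed_vector) \<Rightarrow> bool" where
  "Ck_on 0 S f \<longleftrightarrow> continuous_on S f"
| "Ck_on (Suc k) S f \<longleftrightarrow> (\<forall>x\<in>S. f differentiable (at x)) \<and>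
     (\<forall>v. Ck_on k S (\<lambda>x. frechet_derivative f (at x) v))"

text \<open>For open \<open>S\<close> one may take \<open>W = S\<close>.  The general form is needed for families
  parametrised by a half-open interval.\<close>

definition smooth_on :: "'a::real_normed_vector set \<Rightarrow> ('a \<Rightarrow> 'b::real_normed_vector) \<Rightarrow> bool" where
  "smooth_on S f \<longleftrightarrow>
     (\<exists>W g. open W \<and> S \<subseteq> W \<and> (\<forall>k. Ck_on k W g) \<and> (\<forall>x\<in>S. g x = f x))"


section \<open>Geometry of the hyperbolic metric\<close>

text \<open>Tangent vectors are complex numbers; \<open>\<bullet>\<close> is the Euclidean inner product of \<open>\<complex> = \<real>\<^sup>2\<close>.\<close>

definition gD :: "complex \<Rightarrow> complex \<Rightarrow> complex \<Rightarrow> real" where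
  "gD z u v = 4 / (1 - (cmod z)\<^sup>2)\<^sup>2 * (u \<bullet> v)"

text \<open>An orthonormal basis of the tangent space at \<open>z\<close> with respect to the metric.\<close>

definition frame :: "complex \<Rightarrow> complex set" where
  "frame z = (\<lambda>b. ((1 - (cmod z)\<^sup>2) / 2) *\<^sub>R b) ` Basis"

abbreviation ddir :: "('a::real_normed_vector \<Rightarrow> 'b::real_normed_vector) \<Rightarrow> 'a \<Rightarrow> 'a \<Rightarrow> 'b" where
  "ddir f z v \<equiv> frechet_derivative f (at z) v"

text \<open>The value at \<open>z\<close> of \<open>\<nabla>\<^sub>u v\<close> for constant vector fields \<open>u\<close>, \<open>v\<close> (that is, the Christoffel
  symbols of the Levi-Civita connection), given by the Koszul formula.\<close>

definition christoffel :: "complex \<Rightarrow> complex \<Rightarrow> complex \<Rightarrow> complex" where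
  "christoffel z u v =
     (\<Sum>e\<in>frame z. (1/2 * (ddir (\<lambda>w. gD w v e) z u + ddir (\<lambda>w. gD w u e) z v
                              - ddir (\<lambda>w. gD w u v) z e)) *\<^sub>R e)"

text \<open>\<open>(\<nabla>d\<phi>)(u, v) = \<nabla>\<^sub>u (d\<phi> v) - d\<phi> (\<nabla>\<^sub>u v)\<close> for constant vector fields \<open>u\<close>, \<open>v\<close>.\<close>

definition nabla_d :: "(complex \<Rightarrow> complex) \<Rightarrow> complex \<Rightarrow> complex \<Rightarrow> complex \<Rightarrow> complex" where
  "nabla_d \<phi> z u v =
     ddir (\<lambda>w. ddir \<phi> w v) z u + christoffel (\<phi> z) (ddir \<phi> z u) (ddir \<phi> z v)
       - ddir \<phi> z (christoffel z u v)"

definition tension :: "(complex \<Rightarrow> complex) \<Rightarrow> complex \<Rightarrow> complex" where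
  "tension \<phi> z = (\<Sum>e\<in>frame z. nabla_d \<phi> z e e)"

definition harmonic_vector_field :: "complex set \<Rightarrow> (complex \<Rightarrow> complex) \<Rightarrow> bool" where
  "harmonic_vector_field U \<xi> \<longleftrightarrow> smooth_on U \<xi> \<and>
     (\<exists>\<epsilon>>0. \<exists>\<phi> :: real \<Rightarrow> complex \<Rightarrow> complex.
        smooth_on ({0..<\<epsilon>} \<times> U) (\<lambda>(t, x). \<phi> t x) \<and>
        (\<forall>t\<in>{0..<\<epsilon>}. \<phi> t ` U \<subseteq> disc) \<and>
        (\<forall>x\<in>U. \<phi> 0 x = x) \<and>
        (\<forall>x\<in>U. ((\<lambda>t. \<phi> t x) has_vector_derivative \<xi> x) (at 0 within {0..<\<epsilon>})) \<and>
        (\<forall>x\<in>U. ((\<lambda>t. tension (\<phi> t) x) has_vector_derivative 0) (at 0 within {0..<\<epsilon>})))"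

text \<open>\<open>(L\<^sub>\<xi> g)(u, v) = \<xi>(g(u, v)) - g([\<xi>, u], v) - g(u, [\<xi>, v])\<close>; for a constant vector field \<open>u\<close>
  the bracket \<open>[\<xi>, u]\<close> is minus the derivative of \<open>\<xi>\<close> in the direction \<open>u\<close>.\<close>

definition lie_gD :: "(complex \<Rightarrow> complex) \<Rightarrow> complex \<Rightarrow> complex \<Rightarrow> complex \<Rightarrow> real" where
  "lie_gD \<xi> z u v =
     ddir (\<lambda>w. gD w u v) z (\<xi> z) + gD z (ddir \<xi> z u) v + gD z u (ddir \<xi> z v)"

definition lie_gD_tracefree :: "(complex \<Rightarrow> complex) \<Rightarrow> complex \<Rightarrow> complex \<Rightarrow> complex \<Rightarrow> real" where
  "lie_gD_tracefree \<xi> z u v =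
     lie_gD \<xi> z u v - (\<Sum>e\<in>frame z. lie_gD \<xi> z e e) / 2 * gD z u v"

text \<open>Vector fields and quadratic differentials on the disc that are elements of a vector space
  are represented by functions vanishing outside the disc.  A quadratic differential \<open>h dz\<^sup>2\<close>
  is represented by \<open>h\<close>; as a bilinear form it is \<open>(u, v) \<mapsto> h u v\<close>.\<close>

definition lie_gD_20 :: "(complex \<Rightarrow> complex) \<Rightarrow> complex \<Rightarrow> complex" where
  "lie_gD_20 \<xi> z =
     (if z \<in> disc then (THE h. \<forall>u v. lie_gD_tracefree \<xi> z u v = Re (h * u * v)) else 0)"

definition killing :: "(complex \<Rightarrow> complex) set" where
  "killing = {X. smooth_on disc X \<and> (\<forall>z\<in>disc. \<forall>u v. lie_gD X z u v = 0) \<and>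
                 (\<forall>z. z \<notin> disc \<longrightarrow> X z = 0)}"


section \<open>Group cohomology and quadratic differentials\<close>

definition pull :: "(complex \<Rightarrow> complex) \<Rightarrow> (complex \<Rightarrow> complex) \<Rightarrow> complex \<Rightarrow> complex" where
  "pull \<gamma> F z = (if z \<in> disc then F (\<gamma> z) / deriv \<gamma> z else 0)"

text \<open>Maps on \<open>\<Gamma>\<close> are extended by zero to all functions.  The values of \<open>F\<close> outside
  the disc do not matter here.\<close>

definition coboundary ::
  "(complex \<Rightarrow> complex) set \<Rightarrow> (complex \<Rightarrow> complex) \<Rightarrow> (complex \<Rightarrow> complex) \<Rightarrow> complex \<Rightarrow> complex" where
  "coboundary \<Gamma> F \<gamma> z = (if \<gamma> \<in> \<Gamma> \<and> z \<in> disc then pull \<gamma> F z - F z else 0)"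

definition cocycles ::
  "(complex \<Rightarrow> complex) set \<Rightarrow> ((complex \<Rightarrow> complex) \<Rightarrow> complex \<Rightarrow> complex) monoid" where
  "cocycles \<Gamma> =
     \<lparr>carrier = {c. (\<forall>\<gamma>\<in>\<Gamma>. c \<gamma> \<in> killing) \<and> (\<forall>\<gamma>. \<gamma> \<notin> \<Gamma> \<longrightarrow> c \<gamma> = (\<lambda>z. 0)) \<and>
        (\<forall>\<gamma>\<^sub>1\<in>\<Gamma>. \<forall>\<gamma>\<^sub>2\<in>\<Gamma>. c (\<gamma>\<^sub>1 \<otimes>\<^bsub>PSU11\<^esub> \<gamma>\<^sub>2) = (\<lambda>z. pull \<gamma>\<^sub>2 (c \<gamma>\<^sub>1) z + c \<gamma>\<^sub>2 z))},
      mult = (\<lambda>c d \<gamma> z. c \<gamma> z + d \<gamma> z),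
      one = (\<lambda>\<gamma> z. 0)\<rparr>"

definition coboundaries ::
  "(complex \<Rightarrow> complex) set \<Rightarrow> ((complex \<Rightarrow> complex) \<Rightarrow> complex \<Rightarrow> complex) set" where
  "coboundaries \<Gamma> = coboundary \<Gamma> ` killing"

definition H1 ::
  "(complex \<Rightarrow> complex) set \<Rightarrow> ((complex \<Rightarrow> complex) \<Rightarrow> complex \<Rightarrow> complex) set monoid" where
  "H1 \<Gamma> = cocycles \<Gamma> Mod coboundaries \<Gamma>"

definition H1_class ::
  "(complex \<Rightarrow> complex) set \<Rightarrow> ((complex \<Rightarrow> complex) \<Rightarrow> complex \<Rightarrow> complex)
     \<Rightarrow> ((complex \<Rightarrow> complex) \<Rightarrow> complex \<Rightarrow> complex) set" where
  "H1_class \<Gamma> c = coboundaries \<Gamma> #>\<^bsub>cocycles \<Gamma>\<^esub> c"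

definition HQD :: "(complex \<Rightarrow> complex) set \<Rightarrow> (complex \<Rightarrow> complex) monoid" where
  "HQD \<Gamma> =
     \<lparr>carrier = {f. f holomorphic_on disc \<and> (\<forall>z. z \<notin> disc \<longrightarrow> f z = 0) \<and>
        (\<forall>\<gamma>\<in>\<Gamma>. \<forall>z\<in>disc. f (\<gamma> z) * (deriv \<gamma> z)\<^sup>2 = f z)},
      mult = (\<lambda>f g z. f z + g z),
      one = (\<lambda>z. 0)\<rparr>"

text \<open>\<open>H\<^sup>1\<close> is a real vector space (the Killing fields are not closed under multiplication by
  \<open>\<i>\<close>), so the homomorphisms to quadratic differentials are the \<open>\<real>\<close>-linear maps.\<close>

definition H1_HQD_homs ::
  "(complex \<Rightarrow> complex) set
     \<Rightarrow> (((complex \<Rightarrow> complex) \<Rightarrow> complex \<Rightarrow> complex) set \<Rightarrow> complex \<Rightarrow> complex) set" where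
  "H1_HQD_homs \<Gamma> =
     {\<Psi> \<in> hom (H1 \<Gamma>) (HQD \<Gamma>).
        \<forall>r::real. \<forall>c\<in>carrier (cocycles \<Gamma>).
          \<Psi> (H1_class \<Gamma> (\<lambda>\<gamma> z. of_real r * c \<gamma> z)) = (\<lambda>z. of_real r * \<Psi> (H1_class \<Gamma> c) z)}"


section \<open>Vector fields on the circle\<close>

text \<open>The unit circle with arc length.\<close>

definition circle_measure :: "complex measure" where
  "circle_measure =
     distr (restrict_space lborel {0..<2 * pi}) (restrict_space borel (sphere 0 1)) cis"

definition L2_circle :: "(complex \<Rightarrow> complex) \<Rightarrow> bool" where
  "L2_circle Y \<longleftrightarrow> Y \<in> borel_measurable circle_measure \<and>
     integrable circle_measure (\<lambda>w. (cmod (Y w))\<^sup>2)"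

text \<open>\<open>X\<close> has an extension in the sense of square integrable functions to the closed disc,
  with restriction \<open>Y\<close> to the circle; \<open>Y\<close> is determined almost everywhere.\<close>

definition has_L2_extension :: "(complex \<Rightarrow> complex) \<Rightarrow> (complex \<Rightarrow> complex) \<Rightarrow> bool" where
  "has_L2_extension X Y \<longleftrightarrow> continuous_on disc X \<and> L2_circle Y \<and>
     ((\<lambda>\<epsilon>. \<integral>w. (cmod (X (of_real (1 - \<epsilon>) * w) - Y w))\<^sup>2 \<partial>circle_measure) \<longlongrightarrow> 0) (at_right (0::real))"

definition tangential :: "(complex \<Rightarrow> complex) \<Rightarrow> bool" where
  "tangential Y \<longleftrightarrow>
     (\<exists>f :: complex \<Rightarrow> real. AE w in circle_measure. Y w = of_real (f w) * (\<i> * w))"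

definition poisson_field :: "complex \<Rightarrow> complex" where
  "poisson_field z =
     \<i> * of_real ((1 - (cmod z)\<^sup>2) ^ 3) / (of_real ((cmod (1 - cnj z))\<^sup>2) * (1 - cnj z)\<^sup>2)"

text \<open>For a tangential field \<open>X(w) = f(w) \<i>w\<close>, the function \<open>f\<close> is recovered as \<open>Re (X(w) / (\<i>w))\<close>.\<close>

definition poisson_extension :: "(complex \<Rightarrow> complex) \<Rightarrow> complex \<Rightarrow> complex" where
  "poisson_extension X z =
     of_real (1 / (2 * pi)) *
       (\<integral>w. of_real (Re (X w / (\<i> * w))) * w * poisson_field (z * inverse w) \<partial>circle_measure)"

end

theory Submission
  imports Defs "HOL-Complex_Analysis.Complex_Analysis"
begin

text \<open>A cocycle \<open>c\<close> is the coboundary of the weighted average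
  \<open>- (\<Sum>\<gamma>. \<chi> (\<gamma> z) c\<^sub>\<gamma>(z)) / (\<Sum>\<gamma>. \<chi> (\<gamma> z))\<close> for a bump function \<open>\<chi>\<close>; the sums are locally
  finite by discreteness, and the denominator is positive by cocompactness.

  If \<open>c = \<delta>\<psi>\<close>, then \<open>\<psi> = g\<^sup>*\<psi> - c\<^sub>g\<close>, where \<open>g\<^sup>*\<psi>\<close> is \<open>O(1 - |z|\<^sup>2)\<close> at the points \<open>z\<close> that \<open>g\<close> moves
  into a fixed compact set.  Choosing such \<open>g\<close> for the points \<open>(1 - 2\<^sup>-\<^sup>n) w\<close> of a ray, the Killing
  fields \<open>c\<^sub>g\<close> change by \<open>O(2\<^sup>-\<^sup>n)\<close> near \<open>w\<close> from one point to the next.  So \<open>\<psi>(r w)\<close>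
  converges uniformly as \<open>r\<close> tends to \<open>1\<close>; the limit \<open>Y\<close> depends on \<open>c\<close> only, and it is tangential because
  Killing fields are.

  Expanding the Poisson kernel in partial fractions expresses the extension \<open>\<xi>\<close> of \<open>Y\<close> by the
  holomorphic functions \<open>L\<^sub>k(z)\<close>, the means over the circle of \<open>cnj (Y(w) w) / (1 - z cnj w)\<^sup>k\<close>.  Its
  antiholomorphic derivative is \<open>3 (1 - |z|\<^sup>2)\<^sup>2 cnj L\<^sub>4\<close>, which gives harmonicity, and the
  (2,0)-part of the Lie derivative is \<open>24 L\<^sub>4\<close>.  The equivariance of \<open>Y\<close> and the change of variables
  \<open>w \<mapsto> \<gamma>(w)\<close> on the circle show that \<open>L\<^sub>4\<close> is invariant, since \<open>L\<^sub>4\<close> vanishes for Killing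
  fields by Cauchy's theorem; the same vanishing makes the map well defined on cohomology classes.\<close>

section \<open>Calculus of smooth maps\<close>

text \<open>Nothing is known about the growth of \<psi> near the circle, so all control comes from
  the cocycle. An element g that brings a point at distance 2^-n from the circle back into a compact
  set has matrix entries of size up to 2^(n/2), yet on the rest of the ray its denominator is only
  of size 2^(-n/2). The pullback of a Killing field is quadratic in numerator and denominator: hence
  its size 2^-n there, while its variation between r w and w is O(1 - r) uniformly in n, because
  large entries and small denominators cancel. About log (1 / (1 - r)) such variations add up; the
  rate \<open>sqrt (1 - r)\<close> absorbs the logarithm. The order 4 of the moment is forced twice:
  only this term survives when the partial fractions are differentiated in \<open>cnj z\<close>, and
  for this exponent the powers of the denominator at w cancel under the change of variables, leaving
  those at z that make a quadratic differential. Points of the circle lie outside the domain of the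
  extensional maps \<open>moebius p\<close>, so boundary arguments use numerators, denominators and
  polynomial fields instead.\<close>

lemma Ck_on_cong:
  assumes "open S" "\<And>x. x \<in> S \<Longrightarrow> f x = g x" "Ck_on k S f"
  shows "Ck_on k S g"
  using assms(2,3)
proof (induction k arbitrary: f g)
  case 0
  then show ?case by (auto cong: continuous_on_cong)
next
  case (Suc k)
  have der: "(g has_derivative frechet_derivative f (at x)) (at x)" if "x \<in> S" for x
  proof -
    have "(f has_derivative frechet_derivative f (at x)) (at x)"
      using Suc.prems(2) that by (simp add: frechet_derivative_works)
    then show ?thesis
      using assms(1) that Suc.prems(1) by (rule has_derivative_transform_within_open) auto
  qed
  then have eq: "frechet_derivative f (at x) = frechet_derivative g (at x)" if "x \<in> S" for x
    using that by (intro frechet_derivative_at)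
  have "Ck_on k S (\<lambda>x. frechet_derivative g (at x) v)" for v
  proof (rule Suc.IH)
    show "Ck_on k S (\<lambda>x. frechet_derivative f (at x) v)"
      using Suc.prems(2) by simp
  qed (simp add: eq)
  then show ?case
    using der by (auto simp: differentiable_def)
qed

lemma Ck_on_subset: "Ck_on k S f \<Longrightarrow> T \<subseteq> S \<Longrightarrow> Ck_on k T f"
  by (induction k arbitrary: f) (auto intro: continuous_on_subset)

text \<open>Differentiability and the derivative at a point are local notions. This serves
  \<open>averaged\<close>, whose index set can be held fixed only on smaller discs.\<close>

lemma Ck_on_local:
  assumes "\<And>x. x \<in> S \<Longrightarrow> \<exists>U. open U \<and> x \<in> U \<and> Ck_on k U f"
  shows "Ck_on k S f"
  using assms
proof (induction k arbitrary: f)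
  case 0
  have "isCont f x" if "x \<in> S" for x
    using 0[OF that] by (auto simp: continuous_on_eq_continuous_at)
  then show ?case
    by (simp add: continuous_at_imp_continuous_on)
next
  case (Suc k)
  have "f differentiable (at x)" if "x \<in> S" for x
    using Suc.prems[OF that] by auto
  moreover have "Ck_on k S (\<lambda>x. frechet_derivative f (at x) v)" for v
    by (rule Suc.IH) (use Suc.prems in force)
  ultimately show ?case by simp
qed

text \<open>The induction steps of the closure rules below use this form, with an explicit
  derivative in place of \<open>frechet_derivative\<close>.\<close>

lemma Ck_on_SucI:
  assumes "open S" "\<And>x. x \<in> S \<Longrightarrow> (f has_derivative f' x) (at x)"
    and "\<And>v. Ck_on k S (\<lambda>x. f' x v)"
  shows "Ck_on (Suc k) S f"
proof -
  have "frechet_derivative f (at x) = f' x" if "x \<in> S" for x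
    using assms(2)[OF that] by (metis frechet_derivative_at)
  then have "Ck_on k S (\<lambda>x. frechet_derivative f (at x) v)" for v
    by (intro Ck_on_cong[OF assms(1) _ assms(3)[of v]]) simp
  then show ?thesis
    using assms(2) by (auto simp: differentiable_def)
qed

lemma Ck_on_SucD:
  assumes "Ck_on (Suc k) S f" "x \<in> S"
  shows "(f has_derivative frechet_derivative f (at x)) (at x)"
  using assms by (simp add: frechet_derivative_works)

lemma Ck_on_Suc_lower: "Ck_on (Suc k) S f \<Longrightarrow> Ck_on k S f"
proof (induction k arbitrary: f)
  case 0
  then show ?case
    by (auto simp: differentiable_imp_continuous_within continuous_at_imp_continuous_on)
next
  case (Suc k)
  then show ?case by (metis Ck_on.simps(2))
qed

lemma Ck_on_const [simp]: "open S \<Longrightarrow> Ck_on k S (\<lambda>x. c)"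
proof (induction k arbitrary: c)
  case (Suc k)
  show ?case
    by (rule Ck_on_SucI[where f' = "\<lambda>x v. 0"]) (use Suc in auto)
qed simp

lemma Ck_on_linear:
  assumes "bounded_linear L" "open S" "Ck_on k S f"
  shows "Ck_on k S (\<lambda>x. L (f x))"
  using assms(3)
proof (induction k arbitrary: f)
  case 0
  then show ?case
    using bounded_linear.continuous_on[OF assms(1)] by auto
next
  case (Suc k)
  show ?case
  proof (rule Ck_on_SucI[OF assms(2)])
    show "((\<lambda>x. L (f x)) has_derivative (\<lambda>v. L (frechet_derivative f (at x) v))) (at x)"
      if "x \<in> S" for x
      using bounded_linear.has_derivative[OF assms(1) Ck_on_SucD[OF Suc.prems that]] .
    show "Ck_on k S (\<lambda>x. L (frechet_derivative f (at x) v))" for v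
      using Suc by simp
  qed
qed

lemma Ck_on_ident: "open S \<Longrightarrow> Ck_on k S (\<lambda>x. x)"
  by (cases k) (auto intro!: Ck_on_SucI[where f' = "\<lambda>x v. v"])

lemma Ck_on_add:
  assumes "open S" "Ck_on k S f" "Ck_on k S g"
  shows "Ck_on k S (\<lambda>x. f x + g x)"
  using assms(2,3)
proof (induction k arbitrary: f g)
  case 0
  then show ?case by (auto intro: continuous_intros)
next
  case (Suc k)
  show ?case
  proof (rule Ck_on_SucI[OF assms(1)])
    show "((\<lambda>x. f x + g x) has_derivative
        (\<lambda>v. frechet_derivative f (at x) v + frechet_derivative g (at x) v)) (at x)"
      if "x \<in> S" for x
      by (intro has_derivative_add Ck_on_SucD[OF Suc.prems(1) that] Ck_on_SucD[OF Suc.prems(2) that])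
    show "Ck_on k S (\<lambda>x. frechet_derivative f (at x) v + frechet_derivative g (at x) v)" for v
      using Suc by simp
  qed
qed

lemma Ck_on_bilinear:
  assumes "bounded_bilinear B" "open S" "Ck_on k S f" "Ck_on k S g"
  shows "Ck_on k S (\<lambda>x. B (f x) (g x))"
  using assms(3,4)
proof (induction k arbitrary: f g)
  case 0
  then show ?case
    using bounded_bilinear.continuous_on[OF assms(1)] by auto
next
  case (Suc k)
  show ?case
  proof (rule Ck_on_SucI[OF assms(2)])
    show "((\<lambda>x. B (f x) (g x)) has_derivative
        (\<lambda>v. B (f x) (frechet_derivative g (at x) v) + B (frechet_derivative f (at x) v) (g x)))
        (at x)" if "x \<in> S" for x
      by (intro bounded_bilinear.FDERIV[OF assms(1)] Ck_on_SucD[OF Suc.prems(1) that]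
          Ck_on_SucD[OF Suc.prems(2) that])
    show "Ck_on k S (\<lambda>x. B (f x) (frechet_derivative g (at x) v)
        + B (frechet_derivative f (at x) v) (g x))" for v
      using Suc Ck_on_Suc_lower[OF Suc.prems(1)] Ck_on_Suc_lower[OF Suc.prems(2)]
      by (auto intro!: Ck_on_add assms(2))
  qed
qed

lemmas Ck_on_mult = Ck_on_bilinear[OF bounded_bilinear_mult]
lemmas Ck_on_of_real = Ck_on_linear[OF bounded_linear_of_real]
lemmas Ck_on_cnj = Ck_on_linear[OF bounded_linear_cnj]

lemma Ck_on_uminus: "open S \<Longrightarrow> Ck_on k S f \<Longrightarrow> Ck_on k S (\<lambda>x. - f x)"
  by (rule Ck_on_linear[OF bounded_linear_minus[OF bounded_linear_ident]])

lemma Ck_on_diff: "open S \<Longrightarrow> Ck_on k S f \<Longrightarrow> Ck_on k S g \<Longrightarrow> Ck_on k S (\<lambda>x. f x - g x)"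
  using Ck_on_add[of S k f "\<lambda>x. - g x"] Ck_on_uminus by force

lemma Ck_on_power:
  fixes f :: "'a::real_normed_vector \<Rightarrow> 'b::real_normed_algebra_1"
  shows "open S \<Longrightarrow> Ck_on k S f \<Longrightarrow> Ck_on k S (\<lambda>x. f x ^ n)"
  by (induction n) (auto intro: Ck_on_mult)

lemma Ck_on_sum:
  "open S \<Longrightarrow> (\<And>i. i \<in> I \<Longrightarrow> Ck_on k S (f i)) \<Longrightarrow> Ck_on k S (\<lambda>x. \<Sum>i\<in>I. f i x)"
  by (induction I rule: infinite_finite_induct) (auto intro: Ck_on_add)

lemma Ck_on_norm_power2:
  fixes f :: "'a::real_normed_vector \<Rightarrow> complex"
  assumes "open S" "Ck_on k S f"
  shows "Ck_on k S (\<lambda>x. (cmod (f x))\<^sup>2)"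
  using Ck_on_bilinear[OF bounded_bilinear_inner assms assms(2)] by (simp add: dot_square_norm)

text \<open>The family \<open>G\<close> is closed under differentiation, so that the chain rule can be iterated.\<close>

lemma Ck_on_compose_family:
  fixes f :: "'a::real_normed_vector \<Rightarrow> 'b::real_normed_field"
  assumes "open S" "\<And>x. x \<in> S \<Longrightarrow> f x \<in> T" "Ck_on k S f"
    and "\<And>g. g \<in> G \<Longrightarrow> \<exists>h\<in>G. \<forall>y\<in>T. (g has_field_derivative h y) (at y)" "g \<in> G"
  shows "Ck_on k S (\<lambda>x. g (f x))"
  using assms(3,5)
proof (induction k arbitrary: g)
  case 0
  then obtain h where "\<forall>y\<in>T. (g has_field_derivative h y) (at y)"
    using assms(4) by blast
  then have "continuous_on T g"
    by (meson DERIV_isCont continuous_at_imp_continuous_on)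
  then show ?case
    using 0 assms(2) by (auto intro: continuous_on_compose2)
next
  case (Suc k)
  obtain h where h: "h \<in> G" "\<And>y. y \<in> T \<Longrightarrow> (g has_field_derivative h y) (at y)"
    using assms(4)[OF Suc.prems(2)] by blast
  show ?case
  proof (rule Ck_on_SucI[OF assms(1)])
    show "((\<lambda>x. g (f x)) has_derivative (\<lambda>v. h (f x) * frechet_derivative f (at x) v)) (at x)"
      if "x \<in> S" for x
      using has_derivative_compose[OF Ck_on_SucD[OF Suc.prems(1) that]
          h(2)[OF assms(2)[OF that], unfolded has_field_derivative_def]] .
    show "Ck_on k S (\<lambda>x. h (f x) * frechet_derivative f (at x) v)" for v
      using Suc.IH[OF Ck_on_Suc_lower[OF Suc.prems(1)] h(1)] Suc.prems(1)
      by (auto intro!: Ck_on_mult assms(1))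
  qed
qed

lemma Ck_on_holomorphic_compose:
  fixes f :: "'a::real_normed_vector \<Rightarrow> complex"
  assumes "open S" "open T" "\<And>x. x \<in> S \<Longrightarrow> f x \<in> T" "Ck_on k S f" "g holomorphic_on T"
  shows "Ck_on k S (\<lambda>x. g (f x))"
proof (rule Ck_on_compose_family[where G = "{g. g holomorphic_on T}" and T = T and g = g and f = f])
  show "\<exists>h\<in>{g. g holomorphic_on T}. \<forall>y\<in>T. (g has_field_derivative h y) (at y)"
    if "g \<in> {g. g holomorphic_on T}" for g
    using that assms(2) by (intro bexI[of _ "deriv g"])
      (auto intro: holomorphic_derivI holomorphic_deriv)
qed (use assms in auto)

lemma Ck_on_inverse:
  fixes f :: "'a::real_normed_vector \<Rightarrow> complex"
  assumes "open S" "\<And>x. x \<in> S \<Longrightarrow> f x \<noteq> 0" "Ck_on k S f"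
  shows "Ck_on k S (\<lambda>x. inverse (f x))"
  by (rule Ck_on_holomorphic_compose[where T = "- {0}" and g = inverse and f = f]) (use assms in \<open>auto intro!: holomorphic_intros\<close>)

lemma Ck_on_divide:
  fixes f :: "'a::real_normed_vector \<Rightarrow> complex"
  shows "open S \<Longrightarrow> (\<And>x. x \<in> S \<Longrightarrow> g x \<noteq> 0) \<Longrightarrow> Ck_on k S f \<Longrightarrow> Ck_on k S g \<Longrightarrow>
    Ck_on k S (\<lambda>x. f x / g x)"
  by (simp add: divide_inverse Ck_on_mult Ck_on_inverse)

lemmas Ck_on_intros = Ck_on_const Ck_on_ident Ck_on_add Ck_on_mult Ck_on_of_real Ck_on_cnj
  Ck_on_uminus Ck_on_diff Ck_on_power Ck_on_sum Ck_on_norm_power2 Ck_on_divide Ck_on_inverse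

lemma smooth_on_open:
  assumes "open S"
  shows "smooth_on S f \<longleftrightarrow> (\<forall>k. Ck_on k S f)"
proof
  assume "smooth_on S f"
  then obtain W g where Wg: "open W" "S \<subseteq> W" "\<And>k. Ck_on k W g" "\<And>x. x \<in> S \<Longrightarrow> g x = f x"
    unfolding smooth_on_def by blast
  show "\<forall>k. Ck_on k S f"
  proof
    show "Ck_on k S f" for k
      by (rule Ck_on_cong[OF assms Wg(4) Ck_on_subset[OF Wg(3,2)]])
  qed
qed (use assms in \<open>auto simp: smooth_on_def\<close>)

lemma smooth_on_disc: "smooth_on disc f \<longleftrightarrow> (\<forall>k. Ck_on k disc f)"
  by (rule smooth_on_open) simp

lemma smooth_on_disc_continuous: "smooth_on disc f \<Longrightarrow> continuous_on disc f"
  unfolding smooth_on_disc by (metis Ck_on.simps(1))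

lemma smooth_on_disc_derivative:
  "smooth_on disc f \<Longrightarrow> z \<in> disc \<Longrightarrow> (f has_derivative frechet_derivative f (at z)) (at z)"
  unfolding smooth_on_disc by (metis Ck_on_SucD)

subsection \<open>A smooth bump function\<close>

text \<open>The flat function exp (-1/x) is the case p = 1. Polynomials in 1/x are carried along so
  that the family is closed under differentiation, as \<open>Ck_on_compose_family\<close>
  requires.\<close>

definition flat_exp :: "real poly \<Rightarrow> real \<Rightarrow> real" where
  "flat_exp p x = (if x > 0 then poly p (1 / x) * exp (- (1 / x)) else 0)"

lemma poly_div_exp_tendsto_0: "((\<lambda>y. poly p y / exp y) \<longlongrightarrow> (0::real)) at_top"
proof -
  have "((\<lambda>y. \<Sum>i\<le>degree p. coeff p i * (y ^ i / exp y)) \<longlongrightarrow> (\<Sum>i\<le>degree p. coeff p i * 0)) at_top"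
    by (intro tendsto_intros tendsto_power_div_exp_0)
  then show ?thesis
    by (simp add: poly_altdef sum_divide_distrib)
qed

lemma flat_exp_has_derivative:
  "(flat_exp p has_field_derivative flat_exp (monom 1 2 * (p - pderiv p)) x) (at x)"
proof -
  consider "x < 0" | "x > 0" | "x = 0" by linarith
  then show ?thesis
  proof cases
    case 1
    have "((\<lambda>x. 0) has_field_derivative 0) (at x)"
      by simp
    then have "(flat_exp p has_field_derivative 0) (at x)"
      by (rule has_field_derivative_transform_within_open[of _ _ _ "{..<0}"])
        (use 1 in \<open>auto simp: flat_exp_def\<close>)
    then show ?thesis
      using 1 by (simp add: flat_exp_def)
  next
    case 2
    have "((\<lambda>x. poly p (1 / x) * exp (- (1 / x))) has_field_derivative
        flat_exp (monom 1 2 * (p - pderiv p)) x) (at x)"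
      using 2 by (auto intro!: derivative_eq_intros DERIV_chain'[of "\<lambda>x. 1 / x", OF _ poly_DERIV]
          simp: flat_exp_def poly_monom field_simps power2_eq_square)
    then show ?thesis
      by (rule has_field_derivative_transform_within_open[of _ _ _ "{0<..}"])
        (use 2 in \<open>auto simp: flat_exp_def\<close>)
  next
    case 3
    \<comment> \<open>With y = 1/x the difference quotient at 0 is y p(y) / exp y, and
      \<open>pCons 0 p\<close> is the polynomial y p(y).\<close>
    have "((\<lambda>y. poly (pCons 0 p) y / exp y) \<longlongrightarrow> 0) at_top"
      by (rule poly_div_exp_tendsto_0)
    from filterlim_compose[OF this filterlim_inverse_at_top_right]
    have "((\<lambda>x. flat_exp p x / x) \<longlongrightarrow> 0) (at_right 0)"
      by (rule Lim_transform_eventually)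
        (auto simp: eventually_at_filter flat_exp_def field_simps exp_minus)
    moreover have "((\<lambda>x. flat_exp p x / x) \<longlongrightarrow> 0) (at_left 0)"
      by (rule Lim_transform_eventually[OF tendsto_const])
        (auto simp: eventually_at_filter flat_exp_def)
    ultimately have "((\<lambda>x. flat_exp p x / x) \<longlongrightarrow> 0) (at 0)"
      by (rule filterlim_split_at_real[rotated])
    then show ?thesis
      using 3 by (simp add: has_field_derivative_iff flat_exp_def)
  qed
qed

lemma Ck_on_flat_exp:
  assumes "open S" "Ck_on k S f"
  shows "Ck_on k S (\<lambda>x. flat_exp p (f x))"
proof (rule Ck_on_compose_family[where G = "range flat_exp" and T = UNIV and g = "flat_exp p" and f = f])
  show "\<exists>h\<in>range flat_exp. \<forall>y\<in>UNIV. (g has_field_derivative h y) (at y)"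
    if "g \<in> range flat_exp" for g
    using that flat_exp_has_derivative by blast
qed (use assms in auto)

section \<open>Moebius transformations of the disc\<close>

text \<open>Unlike \<open>moebius p\<close>, which is extensional on the disc, numerator and
  denominator make sense on the circle as well.\<close>

definition mnum :: "complex \<times> complex \<Rightarrow> complex \<Rightarrow> complex" where
  "mnum p z = fst p * z + snd p"

definition mden :: "complex \<times> complex \<Rightarrow> complex \<Rightarrow> complex" where
  "mden p z = cnj (snd p) * z + cnj (fst p)"

text \<open>A pair (a, b) stands for the matrix with rows (a, b) and (\<open>cnj b\<close>,
  \<open>cnj a\<close>); this is the first row of the matrix product.\<close>

definition su_mult :: "complex \<times> complex \<Rightarrow> complex \<times> complex \<Rightarrow> complex \<times> complex" where
  "su_mult p q = (fst p * fst q + snd p * cnj (snd q), fst p * snd q + snd p * cnj (fst q))"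

definition su_inv :: "complex \<times> complex \<Rightarrow> complex \<times> complex" where
  "su_inv p = (cnj (fst p), - snd p)"

lemma SU11_iff: "p \<in> SU11 \<longleftrightarrow> (cmod (fst p))\<^sup>2 - (cmod (snd p))\<^sup>2 = 1"
  by (cases p) (simp add: SU11_def)

lemma SU11_iff_cnj: "p \<in> SU11 \<longleftrightarrow> fst p * cnj (fst p) - snd p * cnj (snd p) = 1"
proof -
  have "fst p * cnj (fst p) - snd p * cnj (snd p) = of_real ((cmod (fst p))\<^sup>2 - (cmod (snd p))\<^sup>2)"
    by (simp add: complex_norm_square [symmetric] del: of_real_power)
  then show ?thesis
    by (simp only: SU11_iff of_real_eq_1_iff)
qed

lemma SU11_norm_less: "p \<in> SU11 \<Longrightarrow> cmod (snd p) < cmod (fst p)"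
  unfolding SU11_iff by (rule power2_less_imp_less) auto

lemma su_mult_SU11: "p \<in> SU11 \<Longrightarrow> q \<in> SU11 \<Longrightarrow> su_mult p q \<in> SU11"
  unfolding SU11_iff_cnj su_mult_def by (simp, algebra)

lemma su_inv_SU11: "p \<in> SU11 \<Longrightarrow> su_inv p \<in> SU11"
  unfolding SU11_iff su_inv_def by simp

lemma one_SU11: "(1, 0) \<in> SU11"
  by (simp add: SU11_iff)

lemma su_mult_inv: "p \<in> SU11 \<Longrightarrow> su_mult (su_inv p) p = (1, 0)" "p \<in> SU11 \<Longrightarrow> su_mult p (su_inv p) = (1, 0)"
  unfolding SU11_iff_cnj su_mult_def su_inv_def by (auto simp: algebra_simps)

lemma mden_nonzero:
  assumes "p \<in> SU11" "cmod z \<le> 1"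
  shows "mden p z \<noteq> 0"
proof
  assume "mden p z = 0"
  then have "cmod (snd p) * cmod z = cmod (fst p)"
    unfolding mden_def by (metis add_eq_0_iff complex_mod_cnj norm_minus_cancel norm_mult)
  moreover have "cmod (snd p) * cmod z \<le> cmod (snd p)"
    using assms(2) mult_left_le by fastforce
  ultimately show False
    using SU11_norm_less[OF assms(1)] by simp
qed

text \<open>The matrix sends the vector (z, 1) to (\<open>mnum p z\<close>, \<open>mden p z\<close>)
  and preserves the Hermitian form of signature (1, 1). The polarised form is needed in
  \<open>moment_moebius\<close>, where z is inside and w on the circle.\<close>

lemma mden_mnum_identity:
  assumes "p \<in> SU11"
  shows "mden p z * cnj (mden p w) - mnum p z * cnj (mnum p w) = 1 - z * cnj w"
  using assms unfolding SU11_iff_cnj mden_def mnum_def by (simp, algebra)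

lemma mden_mnum_norm:
  assumes "p \<in> SU11"
  shows "(cmod (mden p z))\<^sup>2 - (cmod (mnum p z))\<^sup>2 = 1 - (cmod z)\<^sup>2"
proof -
  have "complex_of_real ((cmod (mden p z))\<^sup>2 - (cmod (mnum p z))\<^sup>2) = of_real (1 - (cmod z)\<^sup>2)"
    using mden_mnum_identity[OF assms, of z z] by (simp add: complex_norm_square del: of_real_power)
  then show ?thesis
    by (simp only: of_real_eq_iff)
qed

lemma one_minus_moebius_norm:
  assumes "p \<in> SU11" "cmod z \<le> 1"
  shows "1 - (cmod (mnum p z / mden p z))\<^sup>2 = (1 - (cmod z)\<^sup>2) / (cmod (mden p z))\<^sup>2"
  using mden_mnum_norm[OF assms(1), of z] mden_nonzero[OF assms]
  by (simp add: norm_divide power_divide field_simps)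

lemma moebius_apply: "z \<in> disc \<Longrightarrow> moebius p z = mnum p z / mden p z"
  by (simp add: moebius_def mnum_def mden_def split: prod.split)

lemma moebius_extensional: "moebius p \<in> extensional disc"
  by (simp add: moebius_def split: prod.split)

lemma one_minus_moebius:
  assumes "p \<in> SU11" "z \<in> disc"
  shows "1 - (cmod (moebius p z))\<^sup>2 = (1 - (cmod z)\<^sup>2) / (cmod (mden p z))\<^sup>2"
  using one_minus_moebius_norm[of p z] assms by (simp add: moebius_apply)

lemma disc_iff: "z \<in> disc \<longleftrightarrow> (cmod z)\<^sup>2 < 1"
  by (simp add: abs_square_less_1)

lemma moebius_disc:
  assumes "p \<in> SU11" "z \<in> disc"
  shows "moebius p z \<in> disc"
proof -
  have "0 < (1 - (cmod z)\<^sup>2) / (cmod (mden p z))\<^sup>2"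
    using assms mden_nonzero[of p z] by (intro divide_pos_pos) (auto simp: disc_iff[symmetric] abs_square_less_1)
  then show ?thesis
    using one_minus_moebius[OF assms] by (simp only: disc_iff)
qed

text \<open>Multiply the vector (z, 1) by the two matrices in turn. This makes \<open>mden\<close> a
  factor of automorphy, so that pulling back is a right action.\<close>

lemma mden_su_mult:
  assumes "q \<in> SU11" "cmod z \<le> 1"
  shows "mden (su_mult p q) z = mden p (mnum q z / mden q z) * mden q z"
    "mnum (su_mult p q) z = mnum p (mnum q z / mden q z) * mden q z"
proof -
  have "mden p (mnum q z / mden q z) * mden q z = cnj (snd p) * mnum q z + cnj (fst p) * mden q z"
    "mnum p (mnum q z / mden q z) * mden q z = fst p * mnum q z + snd p * mden q z"
    using mden_nonzero[OF assms] by (simp_all add: mden_def[of p] mnum_def[of p] field_simps)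
  then show "mden (su_mult p q) z = mden p (mnum q z / mden q z) * mden q z"
    "mnum (su_mult p q) z = mnum p (mnum q z / mden q z) * mden q z"
    by (simp_all add: mden_def mnum_def su_mult_def algebra_simps)
qed

lemma moebius_su_mult:
  assumes "p \<in> SU11" "q \<in> SU11"
  shows "moebius (su_mult p q) = compose disc (moebius p) (moebius q)"
proof
  fix z
  show "moebius (su_mult p q) z = compose disc (moebius p) (moebius q) z"
  proof (cases "z \<in> disc")
    case True
    then have "mnum q z / mden q z \<in> disc"
      using moebius_disc[OF assms(2) True] by (simp add: moebius_apply)
    moreover have "mden q z \<noteq> 0"
      using True assms by (intro mden_nonzero) auto
    moreover have "cmod z \<le> 1"
      using True by simp
    ultimately show ?thesis
      using True assms(2) by (simp add: compose_def moebius_apply mden_su_mult del: mem_ball_0 mem_ball)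
  qed (simp add: compose_def moebius_def split: prod.split)
qed

lemma moebius_one: "moebius (1, 0) = (\<lambda>z\<in>disc. z)"
  by (simp add: moebius_def)

lemma moebius_inv:
  assumes "p \<in> SU11" "z \<in> disc"
  shows "moebius (su_inv p) (moebius p z) = z" "moebius p (moebius (su_inv p) z) = z"
proof -
  have "compose disc (moebius (su_inv p)) (moebius p) z = z"
    "compose disc (moebius p) (moebius (su_inv p)) z = z"
    using assms by (simp_all add: moebius_su_mult[symmetric] su_inv_SU11 su_mult_inv moebius_one)
  then show "moebius (su_inv p) (moebius p z) = z" "moebius p (moebius (su_inv p) z) = z"
    using assms(2) by (simp_all add: compose_def)
qed

lemma moebius_Bij: "p \<in> SU11 \<Longrightarrow> moebius p \<in> Bij disc"
  unfolding Bij_def using moebius_extensional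
  by (auto intro!: bij_betw_byWitness[where f' = "moebius (su_inv p)"]
      simp: moebius_inv moebius_disc su_inv_SU11 simp del: mem_ball_0 mem_ball)

lemma carrier_PSU11: "carrier PSU11 = moebius ` SU11"
  by (simp add: PSU11_def)

lemma one_PSU11: "\<one>\<^bsub>PSU11\<^esub> = moebius (1, 0)"
  by (simp add: PSU11_def BijGroup_def moebius_one)

lemma mult_PSU11:
  "p \<in> SU11 \<Longrightarrow> q \<in> SU11 \<Longrightarrow> moebius p \<otimes>\<^bsub>PSU11\<^esub> moebius q = moebius (su_mult p q)"
  by (simp add: PSU11_def BijGroup_def moebius_Bij moebius_su_mult)

lemma su_mult_assoc: "su_mult (su_mult p q) r = su_mult p (su_mult q r)"
  by (simp add: su_mult_def algebra_simps)

lemma su_mult_one: "su_mult (1, 0) p = p" "su_mult p (1, 0) = p"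
  by (simp_all add: su_mult_def)

lemma group_PSU11: "group PSU11"
proof (rule groupI)
  fix x y assume "x \<in> carrier PSU11" "y \<in> carrier PSU11"
  then obtain p q where pq: "x = moebius p" "p \<in> SU11" "y = moebius q" "q \<in> SU11"
    unfolding carrier_PSU11 by blast
  then show "x \<otimes>\<^bsub>PSU11\<^esub> y \<in> carrier PSU11"
    unfolding carrier_PSU11 by (metis mult_PSU11 su_mult_SU11 imageI)
  fix z assume "z \<in> carrier PSU11"
  then obtain r where "z = moebius r" "r \<in> SU11"
    unfolding carrier_PSU11 by blast
  with pq show "x \<otimes>\<^bsub>PSU11\<^esub> y \<otimes>\<^bsub>PSU11\<^esub> z = x \<otimes>\<^bsub>PSU11\<^esub> (y \<otimes>\<^bsub>PSU11\<^esub> z)"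
    by (simp add: mult_PSU11 su_mult_SU11 su_mult_assoc)
next
  show "\<one>\<^bsub>PSU11\<^esub> \<in> carrier PSU11"
    unfolding one_PSU11 carrier_PSU11 using one_SU11 by blast
next
  fix x assume "x \<in> carrier PSU11"
  then obtain p where p: "x = moebius p" "p \<in> SU11"
    unfolding carrier_PSU11 by blast
  then show "\<one>\<^bsub>PSU11\<^esub> \<otimes>\<^bsub>PSU11\<^esub> x = x"
    by (simp add: one_PSU11 mult_PSU11 one_SU11 su_mult_one)
  have "moebius (su_inv p) \<in> carrier PSU11" "moebius (su_inv p) \<otimes>\<^bsub>PSU11\<^esub> x = \<one>\<^bsub>PSU11\<^esub>"
    unfolding carrier_PSU11 using p
    by (simp_all add: su_inv_SU11 mult_PSU11 su_mult_inv one_PSU11)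
  then show "\<exists>y\<in>carrier PSU11. y \<otimes>\<^bsub>PSU11\<^esub> x = \<one>\<^bsub>PSU11\<^esub>"
    by blast
qed

lemma inv_PSU11: "p \<in> SU11 \<Longrightarrow> inv\<^bsub>PSU11\<^esub> (moebius p) = moebius (su_inv p)"
  using group.inv_equality[OF group_PSU11, of "moebius (su_inv p)" "moebius p"]
  by (simp add: mult_PSU11 su_inv_SU11 su_mult_inv one_PSU11 carrier_PSU11)

lemma moebius_has_field_derivative:
  assumes "p \<in> SU11" "z \<in> disc"
  shows "(moebius p has_field_derivative 1 / (mden p z)\<^sup>2) (at z)"
proof -
  have nz: "mden p z \<noteq> 0"
    using assms by (intro mden_nonzero) auto
  have *: "fst p * mden p z - mnum p z * cnj (snd p) = 1"
    using assms(1) unfolding SU11_iff_cnj mden_def mnum_def by (simp add: algebra_simps)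
  have "((\<lambda>z. mnum p z / mden p z) has_field_derivative
      (fst p * mden p z - mnum p z * cnj (snd p)) / (mden p z * mden p z)) (at z)"
    using nz unfolding mnum_def mden_def
    by (intro DERIV_divide) (auto intro!: derivative_eq_intros)
  then have "((\<lambda>z. mnum p z / mden p z) has_field_derivative 1 / (mden p z)\<^sup>2) (at z)"
    unfolding * by (simp add: power2_eq_square)
  then show ?thesis
    by (rule has_field_derivative_transform_within_open[of _ _ _ disc])
      (use assms(2) in \<open>auto simp: moebius_apply\<close>)
qed

lemma deriv_moebius: "p \<in> SU11 \<Longrightarrow> z \<in> disc \<Longrightarrow> deriv (moebius p) z = 1 / (mden p z)\<^sup>2"
  by (intro DERIV_imp_deriv moebius_has_field_derivative)

lemma pull_moebius:
  "p \<in> SU11 \<Longrightarrow> z \<in> disc \<Longrightarrow> pull (moebius p) F z = F (moebius p z) * (mden p z)\<^sup>2"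
  by (simp add: pull_def deriv_moebius)

lemma pull_su_mult:
  assumes "p \<in> SU11" "q \<in> SU11"
  shows "pull (moebius (su_mult p q)) F z = pull (moebius q) (pull (moebius p) F) z"
proof (cases "z \<in> disc")
  case True
  have "moebius (su_mult p q) z = moebius p (moebius q z)"
    using True by (simp add: moebius_su_mult[OF assms] compose_def)
  moreover have "mden (su_mult p q) z = mden p (moebius q z) * mden q z"
    using True by (simp add: moebius_apply mden_su_mult[OF assms(2)])
  ultimately show ?thesis
    using True assms moebius_disc[OF assms(2) True]
    by (simp add: pull_moebius su_mult_SU11 power_mult_distrib del: mem_ball_0 mem_ball)
qed (simp add: pull_def)

lemma Ck_on_moebius:
  assumes "p \<in> SU11"
  shows "Ck_on k disc (moebius p)"
proof (rule Ck_on_holomorphic_compose[of disc disc "\<lambda>z. z" k "moebius p"])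
  show "moebius p holomorphic_on disc"
    unfolding holomorphic_on_open[OF open_ball]
    using moebius_has_field_derivative[OF assms] by blast
qed (auto simp: Ck_on_ident)

text \<open>With matrices, the difference is p^-1 (q - p). Each of its two entries is a sum of two
  products bounded by M times the distance, which gives the factor 4.\<close>

lemma su_mult_inv_dist:
  assumes "p \<in> SU11" "q \<in> SU11" "cmod (fst p) \<le> M"
  shows "dist (su_mult (su_inv p) q) (1, 0) \<le> 4 * M * dist p q"
proof -
  have b: "cmod (snd p) \<le> M"
    using SU11_norm_less[OF assms(1)] assms(3) by simp
  have M: "M \<ge> 0" using b norm_ge_zero order_trans by blast
  define d where "d = dist p q"
  have d: "cmod (fst q - fst p) \<le> d" "cmod (snd q - snd p) \<le> d"
    using dist_fst_le[of p q] dist_snd_le[of p q] by (simp_all add: d_def dist_norm norm_minus_commute)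
  have p1: "fst p * cnj (fst p) - snd p * cnj (snd p) = 1"
    using assms(1) by (simp add: SU11_iff_cnj)
  have e1: "fst (su_mult (su_inv p) q) - 1
      = cnj (fst p) * (fst q - fst p) - snd p * cnj (snd q - snd p)"
    unfolding su_mult_def su_inv_def p1[symmetric] by (simp add: algebra_simps)
  have e2: "snd (su_mult (su_inv p) q) = cnj (fst p) * (snd q - snd p) - snd p * cnj (fst q - fst p)"
    unfolding su_mult_def su_inv_def by (simp add: algebra_simps)
  have "cmod (fst (su_mult (su_inv p) q) - 1) \<le> M * d + M * d"
    unfolding e1 by (rule norm_triangle_le_diff, rule add_mono;
      simp only: norm_mult complex_mod_cnj; intro mult_mono assms(3) b d M norm_ge_zero)
  moreover have "cmod (snd (su_mult (su_inv p) q)) \<le> M * d + M * d"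
    unfolding e2 by (rule norm_triangle_le_diff, rule add_mono;
      simp only: norm_mult complex_mod_cnj; intro mult_mono assms(3) b d M norm_ge_zero)
  moreover have "dist (su_mult (su_inv p) q) (1, 0) \<le>
      cmod (fst (su_mult (su_inv p) q) - 1) + cmod (snd (su_mult (su_inv p) q))"
    using sqrt_sum_squares_le_sum_abs[of "cmod (fst (su_mult (su_inv p) q) - 1)"
        "cmod (snd (su_mult (su_inv p) q))"]
    by (simp add: dist_prod_def dist_norm)
  ultimately show ?thesis unfolding d_def by linarith
qed

section \<open>Discrete cocompact groups\<close>

declare split_paired_All [simp del] split_paired_Ex [simp del]

text \<open>Discreteness enters the sequel as \<open>finite_bounded\<close>, cocompactness as the
  radius \<open>R\<close> of a disc that every orbit meets. Matrices are quantified existentially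
  because p and -p give the same map.\<close>

locale disc_group =
  fixes \<Gamma> :: "(complex \<Rightarrow> complex) set" and R :: real
  assumes elem: "\<And>g. g \<in> \<Gamma> \<Longrightarrow> \<exists>p\<in>SU11. g = moebius p"
    and one_mem: "moebius (1, 0) \<in> \<Gamma>"
    and mult_mem: "\<And>p q. p \<in> SU11 \<Longrightarrow> q \<in> SU11 \<Longrightarrow> moebius p \<in> \<Gamma> \<Longrightarrow> moebius q \<in> \<Gamma> \<Longrightarrow>
          moebius (su_mult p q) \<in> \<Gamma>"
    and inv_mem: "\<And>p. p \<in> SU11 \<Longrightarrow> moebius p \<in> \<Gamma> \<Longrightarrow> moebius (su_inv p) \<in> \<Gamma>"
    and finite_bounded: "\<And>M. finite {g \<in> \<Gamma>. \<exists>p\<in>SU11. g = moebius p \<and> cmod (fst p) \<le> M}"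
    and R: "0 \<le> R" "R < 1"
    and cover: "\<And>z. z \<in> disc \<Longrightarrow> \<exists>g\<in>\<Gamma>. cmod (g z) \<le> R"

section \<open>Finiteness from discreteness and a covering radius from cocompactness\<close>

lemma topspace_PSU11: "topspace PSU11_topology = moebius ` SU11"
  by (simp add: PSU11_topology_def topspace_quotient_topology)

text \<open>An open set of the quotient that isolates the identity of \<Gamma> pulls back to an open
  set of matrices around (1, 0), which contains a ball.\<close>

lemma discrete_near_one:
  assumes "discrete_in_PSU11 \<Gamma>" "moebius (1, 0) \<in> \<Gamma>" 
  obtains e where "e > 0"
    "\<And>p. p \<in> SU11 \<Longrightarrow> dist p (1, 0) < e \<Longrightarrow> moebius p \<in> \<Gamma> \<Longrightarrow> moebius p = moebius (1, 0)"
proof -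
  have "openin (subtopology PSU11_topology \<Gamma>) {moebius (1, 0)}"
    using assms unfolding discrete_in_PSU11_def by simp
  then obtain V where V: "openin PSU11_topology V" "{moebius (1, 0)} = V \<inter> \<Gamma>"
    unfolding openin_subtopology by blast
  define P where "P = {x \<in> SU11. moebius x \<in> V}"
  have "openin (top_of_set SU11) P"
    using V(1) by (simp add: PSU11_topology_def openin_quotient_topology P_def)
  then obtain T where T: "open T" "P = SU11 \<inter> T"
    unfolding openin_open by blast
  have "(1, 0) \<in> T"
    using V(2) T(2) one_SU11 unfolding P_def by blast
  then obtain e where "e > 0" "ball (1, 0) e \<subseteq> T"
    using T(1) open_contains_ball by blast
  show ?thesis
  proof (rule that[OF \<open>e > 0\<close>])
    fix p assume p: "p \<in> SU11" "dist p (1, 0) < e" "moebius p \<in> \<Gamma>"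
    then have "p \<in> P"
      using \<open>ball (1, 0) e \<subseteq> T\<close> T(2) by (auto simp: dist_commute)
    then show "moebius p = moebius (1, 0)"
      using V(2) p(3) unfolding P_def by blast
  qed
qed

lemma bounded_infinite_close_points:
  fixes A :: "'a::heine_borel set"
  assumes "infinite A" "bounded A" "e > 0"
  obtains x y where "x \<in> A" "y \<in> A" "x \<noteq> y" "dist x y < e"
proof -
  obtain l where "l islimpt A"
    using bounded_infinite_imp_islimpt[OF _ assms(2)] assms(1) by blast
  then have inf: "infinite (A \<inter> ball l (e / 2))"
    using assms(3) by (simp add: islimpt_eq_infinite_ball)
  obtain x where x: "x \<in> A \<inter> ball l (e / 2)"
    using infinite_imp_nonempty[OF inf] by blast
  have "A \<inter> ball l (e / 2) - {x} \<noteq> {}"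
    using infinite_remove[OF inf, of x] infinite_imp_nonempty by metis
  then obtain y where y: "y \<in> A \<inter> ball l (e / 2) - {x}"
    by blast
  have "dist x y < e"
    using x y dist_triangle_half_r[of l x e y] by auto
  then show ?thesis
    using that x y by blast
qed

text \<open>A bounded infinite set of matrices contains two that are close to each other, and their
  quotient is close to the identity.\<close>

lemma finite_bounded_discrete:
  assumes disc: "discrete_in_PSU11 \<Gamma>" and one: "moebius (1, 0) \<in> \<Gamma>"
    and mult: "\<And>p q. p \<in> SU11 \<Longrightarrow> q \<in> SU11 \<Longrightarrow> moebius p \<in> \<Gamma> \<Longrightarrow> moebius q \<in> \<Gamma> \<Longrightarrow>
          moebius (su_mult (su_inv p) q) \<in> \<Gamma>"
  shows "finite {g \<in> \<Gamma>. \<exists>p\<in>SU11. g = moebius p \<and> cmod (fst p) \<le> M}" (is "finite ?S")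
proof (rule ccontr)
  assume inf: "infinite ?S"
  obtain f where f: "\<And>g. g \<in> ?S \<Longrightarrow> f g \<in> SU11 \<and> g = moebius (f g) \<and> cmod (fst (f g)) \<le> M"
    using bchoice[of ?S "\<lambda>g p. p \<in> SU11 \<and> g = moebius p \<and> cmod (fst p) \<le> M"] by auto
  have "inj_on f ?S"
  proof (rule inj_onI)
    fix g h assume "g \<in> ?S" "h \<in> ?S" "f g = f h"
    then show "g = h" using f[of g] f[of h] by argo
  qed
  then have inf2: "infinite (f ` ?S)"
    using inf finite_imageD by blast
  have bd: "bounded (f ` ?S)"
  proof -
    have "norm x \<le> M + M" if x: "x \<in> f ` ?S" for x
    proof -
      obtain g where g: "g \<in> ?S" "x = f g" using x by blast
      note fg = f[OF g(1)]
      have "cmod (snd (f g)) \<le> M"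
        using fg SU11_norm_less[of "f g"] by simp
      moreover have "norm x \<le> cmod (fst x) + cmod (snd x)"
        using norm_Pair_le[of "fst x" "snd x"] by simp
      ultimately show ?thesis using g(2) fg by simp
    qed
    then show ?thesis
      unfolding bounded_iff by blast
  qed
  obtain e where e: "e > 0"
    "\<And>p. p \<in> SU11 \<Longrightarrow> dist p (1, 0) < e \<Longrightarrow> moebius p \<in> \<Gamma> \<Longrightarrow> moebius p = moebius (1, 0)"
    using discrete_near_one[OF disc one] by blast
  \<comment> \<open>Chosen so that the Lipschitz factor 4 M of \<open>su_mult_inv_dist\<close> keeps
    the quotient within e of the identity; the summand 1 covers M = 0.\<close>
  define d where "d = e / (4 * \<bar>M\<bar> + 1)"
  have "d > 0" using e(1) by (simp add: d_def)
  then obtain x y where xy: "x \<in> f ` ?S" "y \<in> f ` ?S" "x \<noteq> y" "dist x y < d"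
    using bounded_infinite_close_points[OF inf2 bd] by blast
  obtain g h where gh: "g \<in> ?S" "h \<in> ?S" "x = f g" "y = f h"
    using xy by blast
  note X = f[OF gh(1), folded gh(3)] and Y = f[OF gh(2), folded gh(4)]
  have xyG: "moebius x \<in> \<Gamma>" "moebius y \<in> \<Gamma>"
    using gh(1,2) X Y by auto
  have "dist (su_mult (su_inv x) y) (1, 0) \<le> 4 * M * dist x y"
    using su_mult_inv_dist X Y by blast
  also have "\<dots> \<le> 4 * \<bar>M\<bar> * dist x y"
    by (intro mult_right_mono) auto
  also have "\<dots> \<le> 4 * \<bar>M\<bar> * d"
    using xy(4) by (intro mult_left_mono) auto
  also have "\<dots> < e"
    using e(1) by (simp add: d_def field_simps)
  finally have "moebius (su_mult (su_inv x) y) = moebius (1, 0)"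
    using e(2) mult[OF _ _ xyG] X Y by (simp add: su_mult_SU11 su_inv_SU11)
  then have "moebius (su_mult x (su_mult (su_inv x) y)) = moebius (su_mult x (1, 0))"
    using X Y by (simp add: moebius_su_mult su_mult_SU11 su_inv_SU11 one_SU11)
  then have "moebius y = moebius x"
    using X by (simp add: su_mult_assoc[symmetric] su_mult_inv su_mult_one)
  then show False
    using X Y gh xy(3) by metis
qed

lemma moebius_zero: "moebius p 0 = snd p / cnj (fst p)"
  by (simp add: moebius_apply mnum_def mden_def)

lemma disc_transitive:
  assumes "z \<in> disc"
  obtains p where "p \<in> SU11" "moebius p 0 = z"
proof
  define s where "s = sqrt (1 - (cmod z)\<^sup>2)"
  have s: "s > 0" "s\<^sup>2 = 1 - (cmod z)\<^sup>2"
    using assms by (auto simp: s_def abs_square_less_1 abs_square_le_1)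
  show "(of_real (1 / s), z / of_real s) \<in> SU11"
    unfolding SU11_iff fst_conv snd_conv norm_of_real norm_divide power_divide power2_abs
    using s(1) s(2)[symmetric] by (simp add: field_simps)
  show "moebius (of_real (1 / s), z / of_real s) 0 = z"
    using s by (simp add: moebius_zero)
qed

text \<open>The coset of g records the orbit of g(0). Cosets with an element moving 0 to modulus
  below r form an open set; these sets exhaust the quotient as r tends to 1, so compactness stops at
  some radius below 1. Transitivity on the disc translates this into a statement on points.\<close>

lemma cocompact_cover:
  assumes cc: "cocompact_in_PSU11 \<Gamma>" and sub: "\<Gamma> \<subseteq> moebius ` SU11" and one: "moebius (1, 0) \<in> \<Gamma>"
  obtains R where "0 \<le> R" "R < 1" "\<And>z. z \<in> disc \<Longrightarrow> \<exists>g\<in>\<Gamma>. cmod (g z) \<le> R"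
proof -
  define X where "X = quotient_topology PSU11_topology (\<lambda>g. \<Gamma> #>\<^bsub>PSU11\<^esub> g)"
  define U where "U r = {C \<in> topspace X. \<exists>x\<in>C. cmod (x 0) < r}" for r :: real
  have tops: "topspace X = (\<lambda>p. \<Gamma> #>\<^bsub>PSU11\<^esub> moebius p) ` SU11"
    by (simp add: X_def topspace_quotient_topology topspace_PSU11 image_image)
  have mem: "x \<in> \<Gamma> #>\<^bsub>PSU11\<^esub> moebius p \<longleftrightarrow>
      (\<exists>q\<in>SU11. moebius q \<in> \<Gamma> \<and> x = moebius (su_mult q p))" if p: "p \<in> SU11" for x p
  proof
    assume "x \<in> \<Gamma> #>\<^bsub>PSU11\<^esub> moebius p"
    then obtain h where h: "h \<in> \<Gamma>" "x = h \<otimes>\<^bsub>PSU11\<^esub> moebius p"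
      unfolding r_coset_def by blast
    then obtain q where "q \<in> SU11" "h = moebius q" using sub by blast
    then show "\<exists>q\<in>SU11. moebius q \<in> \<Gamma> \<and> x = moebius (su_mult q p)"
      using h mult_PSU11[OF _ p] by blast
  next
    assume "\<exists>q\<in>SU11. moebius q \<in> \<Gamma> \<and> x = moebius (su_mult q p)"
    then obtain q where "q \<in> SU11" "moebius q \<in> \<Gamma>" "x = moebius q \<otimes>\<^bsub>PSU11\<^esub> moebius p"
      using mult_PSU11[OF _ p] by metis
    then show "x \<in> \<Gamma> #>\<^bsub>PSU11\<^esub> moebius p"
      unfolding r_coset_def by blast
  qed
  have opn: "openin X (U r)" for r
  proof -
    \<comment> \<open>The image of 0 is \<open>snd\<close> divided by the conjugate of
      \<open>fst\<close>; clearing this denominator exhibits the preimage as a union of sets cut out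
      by strict inequalities between continuous functions.\<close>
    have "{p \<in> SU11. \<exists>x\<in>\<Gamma> #>\<^bsub>PSU11\<^esub> moebius p. cmod (x 0) < r} =
      SU11 \<inter> (\<Union>q\<in>{q \<in> SU11. moebius q \<in> \<Gamma>}.
         {p. cmod (snd (su_mult q p)) < r * cmod (fst (su_mult q p))})" (is "?L = ?R")
    proof -
      have "(\<exists>x\<in>\<Gamma> #>\<^bsub>PSU11\<^esub> moebius p. cmod (x 0) < r) \<longleftrightarrow>
        (\<exists>q\<in>SU11. moebius q \<in> \<Gamma> \<and> cmod (snd (su_mult q p)) < r * cmod (fst (su_mult q p)))"
        if p: "p \<in> SU11" for p
      proof -
        have "cmod (moebius (su_mult q p) 0) < r \<longleftrightarrow>
            cmod (snd (su_mult q p)) < r * cmod (fst (su_mult q p))" if "q \<in> SU11" for q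
        proof -
          have "0 < cmod (fst (su_mult q p))"
            using SU11_norm_less[OF su_mult_SU11[OF that p]] norm_ge_zero order.strict_trans1 by blast
          then show ?thesis
            by (simp add: moebius_zero norm_divide pos_divide_less_eq)
        qed
        moreover have "(\<exists>x\<in>\<Gamma> #>\<^bsub>PSU11\<^esub> moebius p. cmod (x 0) < r) \<longleftrightarrow>
            (\<exists>q\<in>SU11. moebius q \<in> \<Gamma> \<and> cmod (moebius (su_mult q p) 0) < r)"
          unfolding Bex_def mem[OF p] by (auto simp del: split_paired_Ex)
        ultimately show ?thesis
          by (metis (no_types, lifting))
      qed
      then show ?thesis
        by (auto simp del: split_paired_Ex split_paired_All)
    qed
    moreover have "open (\<Union>q\<in>{q \<in> SU11. moebius q \<in> \<Gamma>}.
         {p. cmod (snd (su_mult q p)) < r * cmod (fst (su_mult q p))})"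
      unfolding su_mult_def fst_conv snd_conv
      by (intro open_UN ballI open_Collect_less continuous_intros)
    moreover have "{p \<in> SU11. \<Gamma> #>\<^bsub>PSU11\<^esub> moebius p \<in> U r} = ?L"
    proof (rule Collect_cong)
      fix p
      have "p \<in> SU11 \<Longrightarrow> \<Gamma> #>\<^bsub>PSU11\<^esub> moebius p \<in> topspace X"
        unfolding tops by (rule imageI)
      then show "(p \<in> SU11 \<and> \<Gamma> #>\<^bsub>PSU11\<^esub> moebius p \<in> U r) =
          (p \<in> SU11 \<and> (\<exists>x\<in>\<Gamma> #>\<^bsub>PSU11\<^esub> moebius p. cmod (x 0) < r))"
        unfolding U_def mem_Collect_eq by argo
    qed
    ultimately have "openin (top_of_set SU11) {p \<in> SU11. \<Gamma> #>\<^bsub>PSU11\<^esub> moebius p \<in> U r}"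
      by (simp only: openin_open_Int)
    moreover have "{x \<in> SU11. moebius x \<in> moebius ` SU11 \<and> \<Gamma> #>\<^bsub>PSU11\<^esub> moebius x \<in> U r}
        = {p \<in> SU11. \<Gamma> #>\<^bsub>PSU11\<^esub> moebius p \<in> U r}"
      by blast
    moreover have "U r \<subseteq> topspace X"
      by (auto simp: U_def)
    ultimately show ?thesis
      unfolding X_def openin_quotient_topology topspace_quotient_topology topspace_PSU11
      by (simp add: PSU11_topology_def openin_quotient_topology topspace_quotient_topology)
  qed
  have "topspace X \<subseteq> \<Union>(U ` {0<..<1})"
  proof
    fix C assume C: "C \<in> topspace X"
    then obtain p where p: "p \<in> SU11" "C = \<Gamma> #>\<^bsub>PSU11\<^esub> moebius p"
      unfolding tops by blast
    have "moebius p \<in> C"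
      unfolding p(2) mem[OF p(1)] using one one_SU11 su_mult_one(1) by metis
    moreover have "cmod (moebius p 0) < 1"
      using moebius_disc[OF p(1), of 0] by simp
    then obtain r where "cmod (moebius p 0) < r" "r < 1"
      using dense by blast
    moreover have "0 < r"
      using \<open>cmod (moebius p 0) < r\<close> norm_ge_zero order.strict_trans1 by blast
    ultimately show "C \<in> \<Union>(U ` {0<..<1})"
      using C unfolding U_def by fastforce
  qed
  moreover have "compactin X (topspace X)"
    using cc unfolding cocompact_in_PSU11_def X_def compact_space_def by simp
  ultimately obtain F where F: "finite F" "F \<subseteq> U ` {0<..<1}" "topspace X \<subseteq> \<Union>F"
    unfolding compactin_def using opn by (metis (no_types, lifting) imageE)
  then obtain I where I: "finite I" "I \<subseteq> {0<..<1}" "F = U ` I"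
    by (meson finite_subset_image)
  \<comment> \<open>Inserting 0 makes the maximum meaningful for every finite \<open>I\<close> and
    gives 0 \<le> R.\<close>
  define R where "R = Max (insert 0 I)"
  have "0 \<le> R" "R < 1"
    using I by (auto simp: R_def)
  moreover have "\<exists>g\<in>\<Gamma>. cmod (g z) \<le> R" if z: "z \<in> disc" for z
  proof -
    obtain p where p: "p \<in> SU11" "moebius p 0 = z"
      using disc_transitive[OF z] by blast
    have "\<Gamma> #>\<^bsub>PSU11\<^esub> moebius p \<in> topspace X"
      unfolding tops using p(1) by blast
    then obtain r where r: "r \<in> I" "\<Gamma> #>\<^bsub>PSU11\<^esub> moebius p \<in> U r"
      using F(3) I(3) by blast
    then obtain q where q: "q \<in> SU11" "moebius q \<in> \<Gamma>" "cmod (moebius (su_mult q p) 0) < r"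
      unfolding U_def using mem[OF p(1)] by auto
    have "r \<le> R"
      unfolding R_def using r(1) I(1) by (intro Max_ge) auto
    moreover have "moebius (su_mult q p) 0 = moebius q z"
      using p q(1) by (simp add: moebius_su_mult compose_def)
    ultimately show ?thesis
      using q by force
  qed
  ultimately show ?thesis
    using that by blast
qed

theorem disc_groupI:
  assumes sg: "subgroup \<Gamma> PSU11" and "discrete_in_PSU11 \<Gamma>" "cocompact_in_PSU11 \<Gamma>"
  obtains R where "disc_group \<Gamma> R"
proof -
  have sub: "\<Gamma> \<subseteq> moebius ` SU11"
    using subgroup.subset[OF sg] by (simp add: carrier_PSU11)
  have one: "moebius (1, 0) \<in> \<Gamma>"
    using subgroup.one_closed[OF sg] by (simp add: one_PSU11)
  have inv: "moebius (su_inv p) \<in> \<Gamma>" if "p \<in> SU11" "moebius p \<in> \<Gamma>" for p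
    using subgroup.m_inv_closed[OF sg that(2)] by (simp add: inv_PSU11 that(1))
  have mult: "moebius (su_mult p q) \<in> \<Gamma>"
    if "p \<in> SU11" "q \<in> SU11" "moebius p \<in> \<Gamma>" "moebius q \<in> \<Gamma>" for p q
    using subgroup.m_closed[OF sg that(3,4)] by (simp add: mult_PSU11 that)
  obtain R where R: "0 \<le> R" "R < 1" "\<And>z. z \<in> disc \<Longrightarrow> \<exists>g\<in>\<Gamma>. cmod (g z) \<le> R"
    using cocompact_cover[OF assms(3) sub one] by blast
  have "disc_group \<Gamma> R"
  proof
    show "finite {g \<in> \<Gamma>. \<exists>p\<in>SU11. g = moebius p \<and> cmod (fst p) \<le> M}" for M
      by (rule finite_bounded_discrete[OF assms(2) one]) (use inv mult su_inv_SU11 in blast)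
    show "\<exists>p\<in>SU11. g = moebius p" if "g \<in> \<Gamma>" for g
      using that sub by blast
  qed (use one inv mult R in blast)+
  then show ?thesis
    using that by blast
qed

lemma mden_norm_ge:
  assumes "p \<in> SU11" "cmod z \<le> 1"
  shows "cmod (fst p) * (1 - cmod z) \<le> cmod (mden p z)"
proof -
  have "cmod (fst p) - cmod (snd p) * cmod z \<le> cmod (mden p z)"
    using norm_diff_ineq[of "cnj (fst p)" "cnj (snd p) * z"]
    by (simp add: mden_def norm_mult add.commute)
  moreover have "cmod (snd p) * cmod z \<le> cmod (fst p) * cmod z"
    using SU11_norm_less[OF assms(1)] by (intro mult_right_mono) auto
  ultimately show ?thesis by (simp add: algebra_simps)
qed

text \<open>Combine the lower bound on the denominator with the formula for 1 - |g z|^2. An element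
  moving some point of a compact subdisc into another compact subdisc therefore has bounded
  entries.\<close>

lemma fst_norm_bound:
  assumes "p \<in> SU11" "z \<in> disc"
  shows "(cmod (fst p))\<^sup>2 * (1 - cmod z)\<^sup>2 * (1 - (cmod (moebius p z))\<^sup>2) \<le> 1 - (cmod z)\<^sup>2"
proof -
  have z: "cmod z < 1" using assms(2) by simp
  have "(cmod (fst p) * (1 - cmod z))\<^sup>2 \<le> (cmod (mden p z))\<^sup>2"
    using mden_norm_ge[OF assms(1)] z by (intro power_mono) auto
  moreover have "0 < 1 - (cmod (moebius p z))\<^sup>2"
    using moebius_disc[OF assms] by (simp only: disc_iff)
  ultimately have "(cmod (fst p) * (1 - cmod z))\<^sup>2 * (1 - (cmod (moebius p z))\<^sup>2)
      \<le> (cmod (mden p z))\<^sup>2 * (1 - (cmod (moebius p z))\<^sup>2)"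
    by (intro mult_right_mono) auto
  also have "\<dots> = 1 - (cmod z)\<^sup>2"
    using one_minus_moebius[OF assms] mden_nonzero[OF assms(1), of z] z by simp
  finally show ?thesis by (simp add: power_mult_distrib)
qed

context disc_group
begin

lemma finite_return:
  assumes "r < 1" "\<rho> < 1" "0 \<le> \<rho>" 
  shows "finite {g \<in> \<Gamma>. \<exists>z. cmod z \<le> r \<and> cmod (g z) \<le> \<rho>}"
proof -
  \<comment> \<open>This solves the inequality of \<open>fst_norm_bound\<close> for the entry, with
    its right-hand side estimated by 1.\<close>
  define M where "M = sqrt (1 / ((1 - r)\<^sup>2 * (1 - \<rho>\<^sup>2)))"
  have "{g \<in> \<Gamma>. \<exists>z. cmod z \<le> r \<and> cmod (g z) \<le> \<rho>}
      \<subseteq> {g \<in> \<Gamma>. \<exists>p\<in>SU11. g = moebius p \<and> cmod (fst p) \<le> M}"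
  proof
    fix g assume "g \<in> {g \<in> \<Gamma>. \<exists>z. cmod z \<le> r \<and> cmod (g z) \<le> \<rho>}"
    then obtain z where g: "g \<in> \<Gamma>" "cmod z \<le> r" "cmod (g z) \<le> \<rho>"
      by blast
    obtain p where p: "p \<in> SU11" "g = moebius p" using elem[OF g(1)] by blast
    have z: "z \<in> disc" using g(2) assms(1) by simp
    have pos: "0 < (1 - r)\<^sup>2 * (1 - \<rho>\<^sup>2)"
      using assms by (intro mult_pos_pos) (auto simp: abs_square_less_1)
    have "(cmod (fst p))\<^sup>2 * ((1 - r)\<^sup>2 * (1 - \<rho>\<^sup>2)) \<le>
        (cmod (fst p))\<^sup>2 * ((1 - cmod z)\<^sup>2 * (1 - (cmod (moebius p z))\<^sup>2))"
    proof (intro mult_left_mono mult_mono)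
      show "(1 - r)\<^sup>2 \<le> (1 - cmod z)\<^sup>2"
        using g(2) assms(1) by (intro power_mono) auto
      show "1 - \<rho>\<^sup>2 \<le> 1 - (cmod (moebius p z))\<^sup>2"
        using g(3) p(2) by (simp add: power_mono)
      show "0 \<le> 1 - \<rho>\<^sup>2" using assms by (simp add: abs_square_le_1)
    qed auto
    also have "\<dots> \<le> 1"
      using fst_norm_bound[OF p(1) z] by (simp add: mult.assoc) (smt (verit) zero_le_power2)
    finally have "(cmod (fst p))\<^sup>2 \<le> 1 / ((1 - r)\<^sup>2 * (1 - \<rho>\<^sup>2))"
      using pos by (simp add: pos_le_divide_eq)
    then have "cmod (fst p) \<le> M"
      unfolding M_def by (rule real_le_rsqrt)
    then show "g \<in> {g \<in> \<Gamma>. \<exists>p\<in>SU11. g = moebius p \<and> cmod (fst p) \<le> M}"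
      using g(1) p by blast
  qed
  then show ?thesis
    using finite_bounded finite_subset by blast
qed

end

section \<open>Lie derivatives of the metric and Killing fields\<close>

text \<open>The Wirtinger derivatives: the coefficients of u and \<open>cnj u\<close> in the real
  derivative, see \<open>has_derivative_wirt\<close>.\<close>

definition wirt :: "(complex \<Rightarrow> complex) \<Rightarrow> complex \<Rightarrow> complex" where
  "wirt f z = (ddir f z 1 - \<i> * ddir f z \<i>) / 2"

definition wirt_bar :: "(complex \<Rightarrow> complex) \<Rightarrow> complex \<Rightarrow> complex" where
  "wirt_bar f z = (ddir f z 1 + \<i> * ddir f z \<i>) / 2"

lemma linear_complex_split:
  fixes L :: "complex \<Rightarrow> complex"
  assumes "linear L"
  shows "L u = (L 1 - \<i> * L \<i>) / 2 * u + (L 1 + \<i> * L \<i>) / 2 * cnj u"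
proof -
  have "u = Re u *\<^sub>R 1 + Im u *\<^sub>R \<i>"
    by (simp add: complex_eq_iff)
  then have "L u = L (Re u *\<^sub>R 1 + Im u *\<^sub>R \<i>)"
    by simp
  also have "\<dots> = Re u *\<^sub>R L 1 + Im u *\<^sub>R L \<i>"
    by (simp only: linear_add[OF assms] linear_scale[OF assms])
  also have "\<dots> = (L 1 - \<i> * L \<i>) / 2 * u + (L 1 + \<i> * L \<i>) / 2 * cnj u"
    by (simp add: complex_eq_iff) (simp add: field_simps)
  finally show ?thesis .
qed

lemma has_derivative_wirt:
  assumes "f differentiable (at z)"
  shows "(f has_derivative (\<lambda>u. wirt f z * u + wirt_bar f z * cnj u)) (at z)"
proof -
  have "(f has_derivative ddir f z) (at z)"
    using assms by (simp add: frechet_derivative_works)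
  moreover from this have "linear (ddir f z)"
    by (rule has_derivative_linear)
  then have "ddir f z = (\<lambda>u. wirt f z * u + wirt_bar f z * cnj u)"
    unfolding wirt_def wirt_bar_def using linear_complex_split by blast
  ultimately show ?thesis by simp
qed

lemma ddir_eq: "(f has_derivative L) (at z) \<Longrightarrow> ddir f z = L"
  by (metis frechet_derivative_at)

lemma ddir_gD:
  assumes "z \<in> disc"
  shows "ddir (\<lambda>w. gD w u v) z = (\<lambda>x. 16 * (z \<bullet> x) / (1 - (cmod z)\<^sup>2) ^ 3 * (u \<bullet> v))"
proof (rule ddir_eq)
  have s: "1 - z \<bullet> z \<noteq> 0"
    using assms unfolding disc_iff by (simp add: dot_square_norm)
  have eq: "(\<lambda>w. gD w u v) = (\<lambda>w. 4 / (1 - w \<bullet> w)\<^sup>2 * (u \<bullet> v))"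
    by (simp add: gD_def dot_square_norm)
  show "((\<lambda>w. gD w u v) has_derivative
      (\<lambda>x. 16 * (z \<bullet> x) / (1 - (cmod z)\<^sup>2) ^ 3 * (u \<bullet> v))) (at z)"
    unfolding eq dot_square_norm[symmetric] using s
    by (auto intro!: derivative_eq_intros simp: inner_commute fun_eq_iff
        divide_simps power2_eq_square power3_eq_cube)
qed

lemma lie_gD_eq:
  assumes "z \<in> disc"
  shows "lie_gD \<xi> z u v = 16 * (z \<bullet> \<xi> z) / (1 - (cmod z)\<^sup>2) ^ 3 * (u \<bullet> v)
    + 4 / (1 - (cmod z)\<^sup>2)\<^sup>2 * (ddir \<xi> z u \<bullet> v + u \<bullet> ddir \<xi> z v)"
  unfolding lie_gD_def ddir_gD[OF assms] by (simp add: gD_def algebra_simps add_divide_distrib)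

lemma sum_frame:
  assumes "z \<in> disc"
  shows "(\<Sum>e\<in>frame z. f e) = f (of_real ((1 - (cmod z)\<^sup>2) / 2)) + f (of_real ((1 - (cmod z)\<^sup>2) / 2) * \<i>)"
proof -
  have s: "(1 - (cmod z)\<^sup>2) / 2 \<noteq> 0"
    using assms unfolding disc_iff by simp
  have "frame z = {of_real ((1 - (cmod z)\<^sup>2) / 2), of_real ((1 - (cmod z)\<^sup>2) / 2) * \<i>}"
    by (simp add: frame_def Basis_complex_def scaleR_conv_of_real)
  moreover have "complex_of_real ((1 - (cmod z)\<^sup>2) / 2) \<noteq> of_real ((1 - (cmod z)\<^sup>2) / 2) * \<i>"
    using s by (simp add: complex_eq_iff)
  ultimately show ?thesis by simp
qed

text \<open>The derivative of the metric and the complex linear part p contribute multiples of the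
  metric. The antilinear part contributes 4 / s^2 times 2 Re (\<open>cnj q\<close> u v), where s = 1
  - |z|^2; this form is trace-free.\<close>

lemma lie_gD_tracefree_eq:
  assumes "z \<in> disc" and der: "(\<xi> has_derivative (\<lambda>u. p * u + q * cnj u)) (at z)"
  shows "lie_gD_tracefree \<xi> z u v = Re (8 * cnj q / of_real ((1 - (cmod z)\<^sup>2)\<^sup>2) * u * v)"
proof -
  define s where "s = 1 - (cmod z)\<^sup>2"
  have s: "s \<noteq> 0"
    using assms(1) unfolding disc_iff s_def by simp
  have "lie_gD_tracefree \<xi> z u v = 4 / s\<^sup>2 * (2 * Re (cnj q * u * v))"
    unfolding lie_gD_tracefree_def sum_frame[OF assms(1)] lie_gD_eq[OF assms(1)] ddir_eq[OF der]
      gD_def s_def[symmetric]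
    using s by (simp add: inner_complex_def field_simps power2_eq_square power3_eq_cube)
  also have "\<dots> = Re (of_real (8 / s\<^sup>2) * (cnj q * u * v))"
    by (simp only: Re_complex_of_real Im_complex_of_real times_complex.sel)
  also have "of_real (8 / s\<^sup>2) * (cnj q * u * v) = 8 * cnj q / of_real (s\<^sup>2) * u * v"
    by simp
  finally show ?thesis by (simp only: s_def)
qed

lemma Re_mult_eq_imp_eq:
  assumes "\<And>u v. Re (h * u * v) = Re (k * u * v)"
  shows "h = k"
  using assms[of 1 1] assms[of 1 \<i>] by (simp add: complex_eq_iff)

lemma lie_gD_20_eq:
  assumes "z \<in> disc" and der: "(\<xi> has_derivative (\<lambda>u. p * u + q * cnj u)) (at z)"
  shows "lie_gD_20 \<xi> z = 8 * cnj q / of_real ((1 - (cmod z)\<^sup>2)\<^sup>2)"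
proof -
  have "(THE h. \<forall>u v. lie_gD_tracefree \<xi> z u v = Re (h * u * v))
      = 8 * cnj q / of_real ((1 - (cmod z)\<^sup>2)\<^sup>2)"
  proof (rule the_equality)
    show "\<forall>u v. lie_gD_tracefree \<xi> z u v = Re (8 * cnj q / of_real ((1 - (cmod z)\<^sup>2)\<^sup>2) * u * v)"
      using lie_gD_tracefree_eq[OF assms] by blast
    fix h assume "\<forall>u v. lie_gD_tracefree \<xi> z u v = Re (h * u * v)"
    then show "h = 8 * cnj q / of_real ((1 - (cmod z)\<^sup>2)\<^sup>2)"
      using lie_gD_tracefree_eq[OF assms] by (intro Re_mult_eq_imp_eq) metis
  qed
  then show ?thesis
    using assms(1) by (simp add: lie_gD_20_def del: mem_ball_0 mem_ball)
qed

text \<open>The polynomial vector fields \<open>A + i B z - cnj A z\<^sup>2\<close> are the elements of the Lie algebra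
  of \<open>SU(1,1)\<close>.\<close>

definition kfield :: "complex \<Rightarrow> real \<Rightarrow> complex \<Rightarrow> complex" where
  "kfield A B z = A + \<i> * of_real B * z - cnj A * z\<^sup>2"

lemma kfield_has_field_derivative:
  "(kfield A B has_field_derivative \<i> * of_real B - 2 * cnj A * z) (at z)"
  unfolding kfield_def by (auto intro!: derivative_eq_intros)

lemma lie_gD_kfield:
  assumes "z \<in> disc"
  shows "lie_gD (kfield A B) z u v = 0"
proof -
  define s where "s = 1 - (cmod z)\<^sup>2"
  have s: "s \<noteq> 0"
    using assms unfolding disc_iff s_def by simp
  have d: "ddir (kfield A B) z = (\<lambda>u. (\<i> * of_real B - 2 * cnj A * z) * u)"
    using kfield_has_field_derivative by (intro ddir_eq) (simp add: has_field_derivative_def)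
  have "z \<bullet> kfield A B z = s * (z \<bullet> A)"
    unfolding s_def kfield_def inner_complex_def cmod_power2 by (simp add: power2_eq_square algebra_simps)
  moreover have "ddir (kfield A B) z u \<bullet> v + u \<bullet> ddir (kfield A B) z v = - 4 * (z \<bullet> A) * (u \<bullet> v)"
    unfolding d inner_complex_def by (simp add: algebra_simps)
  ultimately have "lie_gD (kfield A B) z u v =
      16 * (s * (z \<bullet> A)) / s ^ 3 * (u \<bullet> v) + 4 / s\<^sup>2 * (- 4 * (z \<bullet> A) * (u \<bullet> v))"
    by (simp only: lie_gD_eq[OF assms] s_def)
  then show ?thesis
    using s by (simp add: field_simps power2_eq_square power3_eq_cube)
qed

text \<open>Uniqueness of the Wirtinger coefficients of a real linear map; v = 1 and v = i separate
  them.\<close>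

lemma real_part_zero_imp_zero:
  assumes "\<And>v::complex. a * v + b * cnj v = 0"
  shows "a = 0" "b = 0"
  using assms[of 1] assms[of \<i>] by (auto simp: algebra_simps add_eq_0_iff)

text \<open>The hypothesis is the trace of the Killing equation for a holomorphic field.
  Differentiating it twice in z eliminates all terms but the third derivative, so the field is a
  quadratic polynomial.\<close>

lemma conformal_killing_imp_kfield:
  assumes hol: "X holomorphic_on disc"
    and eq: "\<And>z. z \<in> disc \<Longrightarrow> (1 - (cmod z)\<^sup>2) * Re (deriv X z) + 2 * Re (cnj z * X z) = 0"
  obtains A B where "\<And>z. z \<in> disc \<Longrightarrow> X z = kfield A B z"
proof -
  define X1 where "X1 = deriv X"
  define X2 where "X2 = deriv X1"
  define X3 where "X3 = deriv X2"
  have hols: "X1 holomorphic_on disc" "X2 holomorphic_on disc"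
    unfolding X1_def X2_def using hol by (auto intro!: holomorphic_deriv)
  have d0: "(X has_field_derivative X1 z) (at z)"
    and d1: "(X1 has_field_derivative X2 z) (at z)"
    and d2: "(X2 has_field_derivative X3 z) (at z)" if "z \<in> disc" for z
    using that hol hols unfolding X1_def X2_def X3_def
    by (auto intro!: holomorphic_derivI[of _ disc])
  have zero_der: "L v = 0"
    if "(F has_derivative L) (at z)" "z \<in> disc" "\<And>z. z \<in> disc \<Longrightarrow> F z = 0"
    for F :: "complex \<Rightarrow> complex" and L z v
  proof -
    have "(F has_derivative (\<lambda>v. 0)) (at z)"
      by (rule has_derivative_transform_within_open[OF has_derivative_const[of 0] open_ball that(2)])
        (simp add: that(3))
    then show ?thesis
      using has_derivative_unique that(1) by metis
  qed
  text \<open>Differentiating the equation gives \<open>E1 = 0\<close>, and once more \<open>X''' = 0\<close>.\<close>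
  define E where "E z = (1 - z * cnj z) * (X1 z + cnj (X1 z)) + 2 * (cnj z * X z) + 2 * (z * cnj (X z))" for z
  define E1 where "E1 z = (1 - z * cnj z) * X2 z + cnj z * (X1 z - cnj (X1 z)) + 2 * cnj (X z)" for z
  have E0: "E z = 0" if "z \<in> disc" for z
  proof -
    have "E z = of_real (2 * ((1 - (cmod z)\<^sup>2) * Re (X1 z) + 2 * Re (cnj z * X z)))"
      unfolding E_def cmod_power2 by (simp add: complex_eq_iff power2_eq_square algebra_simps)
    also have "\<dots> = 0"
      unfolding X1_def eq[OF that] by simp
    finally show ?thesis .
  qed
  have E1: "E1 z = 0" if z: "z \<in> disc" for z
  proof -
    note D = d0[OF z, unfolded has_field_derivative_def] d1[OF z, unfolded has_field_derivative_def]
    have "(E has_derivative (\<lambda>v. E1 z * v + cnj (E1 z) * cnj v)) (at z)"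
      unfolding E_def E1_def
      by (auto intro!: derivative_eq_intros D simp: fun_eq_iff algebra_simps)
    from zero_der[OF this z E0] show ?thesis
      by (rule real_part_zero_imp_zero)
  qed
  have X3: "X3 z = 0" if z: "z \<in> disc" for z
  proof -
    note D = d0[OF z, unfolded has_field_derivative_def] d1[OF z, unfolded has_field_derivative_def]
      d2[OF z, unfolded has_field_derivative_def]
    have "(E1 has_derivative (\<lambda>v. ((1 - z * cnj z) * X3 z) * v
        + (X1 z + cnj (X1 z) - z * X2 z - cnj z * cnj (X2 z)) * cnj v)) (at z)"
      unfolding E1_def
      by (auto intro!: derivative_eq_intros D simp: fun_eq_iff algebra_simps)
    from zero_der[OF this z E1] have "(1 - z * cnj z) * X3 z = 0"
      by (rule real_part_zero_imp_zero)
    moreover have "1 - z * cnj z \<noteq> 0"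
    proof
      assume "1 - z * cnj z = 0"
      then have "complex_of_real ((cmod z)\<^sup>2) = of_real 1"
        by (simp add: complex_norm_square[symmetric] del: of_real_power)
      then show False
        using z unfolding disc_iff of_real_eq_iff by simp
    qed
    ultimately show ?thesis by simp
  qed
  have const: "\<exists>c. \<forall>z\<in>disc. f z = c"
    if "\<And>z. z \<in> disc \<Longrightarrow> (f has_field_derivative 0) (at z)" for f :: "complex \<Rightarrow> complex"
    using has_field_derivative_zero_constant[of disc f] has_field_derivative_at_within[OF that] by auto
  obtain c2 where c2: "\<And>z. z \<in> disc \<Longrightarrow> X2 z = c2"
    using const[of X2] d2 X3 by metis
  have "((\<lambda>z. X1 z - c2 * z) has_field_derivative 0) (at z)" if "z \<in> disc" for z
    using c2[OF that] by (auto intro!: derivative_eq_intros d1 that)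
  from const[OF this] obtain c1 where "\<And>z. z \<in> disc \<Longrightarrow> X1 z - c2 * z = c1"
    by blast
  then have c1: "X1 z = c1 + c2 * z" if "z \<in> disc" for z
    using that by (metis diff_add_cancel)
  have "((\<lambda>z. X z - c1 * z - c2 * z\<^sup>2 / 2) has_field_derivative 0) (at z)" if "z \<in> disc" for z
    using c1[OF that] by (auto intro!: derivative_eq_intros d0 that)
  from const[OF this] obtain c0 where c0': "\<And>z. z \<in> disc \<Longrightarrow> X z - c1 * z - c2 * z\<^sup>2 / 2 = c0"
    by blast
  then have c0: "X z = c0 + c1 * z + c2 * z\<^sup>2 / 2" if "z \<in> disc" for z
    using c0'[OF that] by (simp add: algebra_simps)
  \<comment> \<open>At 0 the differentiated equation reads X''(0) + 2 cnj X(0) = 0 and the original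
    one Re X'(0) = 0: the relations between the coefficients of \<open>kfield\<close>.\<close>
  have "c2 + 2 * cnj c0 = 0"
    using E1[of 0] c2[of 0] c0[of 0] by (simp add: E1_def)
  then have c2': "c2 = - 2 * cnj c0"
    by (simp add: add_eq_0_iff)
  have "Re c1 = 0"
    using eq[of 0] c1[of 0] by (simp add: X1_def)
  then have "c1 = \<i> * of_real (Im c1)"
    by (simp add: complex_eq_iff)
  then have "X z = kfield c0 (Im c1) z" if "z \<in> disc" for z
    unfolding c0[OF that] kfield_def c2' by simp
  then show ?thesis using that by blast
qed

text \<open>Elements of \<open>killing\<close> vanish outside the disc; the plain polynomial
  \<open>kfield\<close> is kept for boundary values.\<close>

definition kfield_disc :: "complex \<Rightarrow> real \<Rightarrow> complex \<Rightarrow> complex" where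
  "kfield_disc A B z = (if z \<in> disc then kfield A B z else 0)"

lemma Ck_on_kfield: "open S \<Longrightarrow> Ck_on k S (kfield A B)"
  unfolding kfield_def by (intro Ck_on_intros) auto

text \<open>The trace-free part of the Killing equation says that the antilinear part of the
  derivative vanishes, so the field is holomorphic; the trace gives the scalar equation solved in
  \<open>conformal_killing_imp_kfield\<close>.\<close>

lemma killing_iff: "X \<in> killing \<longleftrightarrow> (\<exists>A B. X = kfield_disc A B)"
proof
  assume "X \<in> killing"
  then have sm: "smooth_on disc X" and lie: "\<And>z u v. z \<in> disc \<Longrightarrow> lie_gD X z u v = 0"
    and out: "\<And>z. z \<notin> disc \<Longrightarrow> X z = 0"
    unfolding killing_def by blast+
  have fd: "(X has_field_derivative wirt X z) (at z)"
    and re: "(1 - (cmod z)\<^sup>2) * Re (wirt X z) + 2 * Re (cnj z * X z) = 0" if z: "z \<in> disc" for z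
  proof -
    define s where "s = 1 - (cmod z)\<^sup>2"
    have s: "s \<noteq> 0"
      using z unfolding disc_iff s_def by simp
    have D: "(X has_derivative (\<lambda>u. wirt X z * u + wirt_bar X z * cnj u)) (at z)"
      using smooth_on_disc_derivative[OF sm z] by (intro has_derivative_wirt) (auto simp: differentiable_def)
    have "lie_gD_tracefree X z u v = 0" for u v
      unfolding lie_gD_tracefree_def by (simp add: lie[OF z])
    then have "Re (8 * cnj (wirt_bar X z) / of_real (s\<^sup>2) * u * v) = Re (0 * u * v)" for u v
      using lie_gD_tracefree_eq[OF z D, of u v] unfolding s_def by simp
    then have "8 * cnj (wirt_bar X z) / of_real (s\<^sup>2) = 0"
      by (rule Re_mult_eq_imp_eq)
    then have q0: "wirt_bar X z = 0"
      using s by simp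
    show "(X has_field_derivative wirt X z) (at z)"
      using D unfolding q0 by (simp add: has_field_derivative_def)
    have "16 * (z \<bullet> X z) / s ^ 3 + 4 / s\<^sup>2 * (2 * Re (wirt X z)) = 0"
      using lie[OF z, of 1 1] unfolding lie_gD_eq[OF z] ddir_eq[OF D] q0 s_def by simp
    then have "s * Re (wirt X z) + 2 * (z \<bullet> X z) = 0"
      using s by (simp add: field_simps power2_eq_square power3_eq_cube add_divide_distrib[symmetric])
    then show "(1 - (cmod z)\<^sup>2) * Re (wirt X z) + 2 * Re (cnj z * X z) = 0"
      by (simp add: s_def inner_complex_def)
  qed
  have "X holomorphic_on disc"
    unfolding holomorphic_on_open[OF open_ball] using fd by blast
  moreover have "(1 - (cmod z)\<^sup>2) * Re (deriv X z) + 2 * Re (cnj z * X z) = 0" if "z \<in> disc" for z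
    using re[OF that] DERIV_imp_deriv[OF fd[OF that]] by simp
  ultimately obtain A B where "\<And>z. z \<in> disc \<Longrightarrow> X z = kfield A B z"
    using conformal_killing_imp_kfield by blast
  then have "X = kfield_disc A B"
    using out by (auto simp: kfield_disc_def fun_eq_iff)
  then show "\<exists>A B. X = kfield_disc A B" by blast
next
  assume "\<exists>A B. X = kfield_disc A B"
  then obtain A B where X: "X = kfield_disc A B" by blast
  have eq: "X z = kfield A B z" if "z \<in> disc" for z
    using that by (simp add: X kfield_disc_def)
  have "smooth_on disc X"
    unfolding smooth_on_disc
  proof
    show "Ck_on k disc X" for k
      by (rule Ck_on_cong[OF open_ball _ Ck_on_kfield[OF open_ball, of k 0 1 A B]]) (simp add: eq)
  qed
  moreover have "lie_gD X z u v = 0" if z: "z \<in> disc" for z u v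
  proof -
    have "(X has_field_derivative \<i> * of_real B - 2 * cnj A * z) (at z)"
      by (rule has_field_derivative_transform_within_open[OF kfield_has_field_derivative open_ball z])
        (simp add: eq)
    then have "ddir X z = ddir (kfield A B) z"
      using kfield_has_field_derivative[of A B z] unfolding has_field_derivative_def
      by (simp only: ddir_eq)
    then have "lie_gD X z u v = lie_gD (kfield A B) z u v"
      unfolding lie_gD_def by (simp only: eq[OF z])
    then show ?thesis
      using lie_gD_kfield[OF z] by simp
  qed
  moreover have "X z = 0" if "z \<notin> disc" for z
    using that unfolding X kfield_disc_def by argo
  ultimately show "X \<in> killing"
    unfolding killing_def by blast
qed

section \<open>Pullbacks and linear combinations of Killing fields\<close>

text \<open>The pullback of \<open>kfield A B\<close> with denominators cleared: a quadratic
  polynomial in z that can be evaluated on the circle.\<close>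

definition kpull :: "complex \<times> complex \<Rightarrow> complex \<Rightarrow> real \<Rightarrow> complex \<Rightarrow> complex" where
  "kpull p A B z = A * (mden p z)\<^sup>2 + \<i> * of_real B * (mnum p z * mden p z) - cnj A * (mnum p z)\<^sup>2"

lemma kpull_eq: "mden p z \<noteq> 0 \<Longrightarrow> kfield A B (mnum p z / mden p z) * (mden p z)\<^sup>2 = kpull p A B z"
  by (simp add: kfield_def kpull_def field_simps power2_eq_square)

lemma pull_kfield:
  assumes "p \<in> SU11" "z \<in> disc"
  shows "pull (moebius p) (kfield_disc A B) z = kpull p A B z"
  using kpull_eq[OF mden_nonzero[OF assms(1)], of z] assms(2) moebius_disc[OF assms]
  by (simp add: pull_moebius[OF assms] moebius_apply kfield_disc_def less_imp_le)

lemma kpull_kfield: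
  "\<exists>A' B'. kpull p A B = kfield A' B'"
proof -
  define a b where "a = fst p" and "b = snd p"
  \<comment> \<open>The constant and linear coefficients of the expanded polynomial.
    \<open>B'\<close> is real because the terms with A enter as a number minus its
    conjugate.\<close>
  define A' where "A' = A * (cnj a)\<^sup>2 + \<i> * of_real B * (b * cnj a) - cnj A * b\<^sup>2"
  define B' where "B' = B * ((cmod a)\<^sup>2 + (cmod b)\<^sup>2) + 4 * Im (A * cnj a * cnj b)"
  have B': "\<i> * of_real B' = \<i> * of_real B * (a * cnj a + b * cnj b) + 2 * (A * cnj a * cnj b - cnj A * a * b)"
    unfolding B'_def cmod_power2 by (simp add: complex_eq_iff algebra_simps power2_eq_square)
  have "kpull p A B z = kfield A' B' z" for z
    unfolding kfield_def B' unfolding kpull_def mden_def mnum_def A'_def a_def[symmetric] b_def[symmetric]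
    by (simp add: algebra_simps power2_eq_square)
  then show ?thesis by blast
qed

lemma pull_killing:
  assumes "p \<in> SU11" "X \<in> killing"
  shows "pull (moebius p) X \<in> killing"
proof -
  obtain A B where X: "X = kfield_disc A B"
    using assms(2) unfolding killing_iff by blast
  obtain A' B' where "kpull p A B = kfield A' B'"
    using kpull_kfield by blast
  then have "pull (moebius p) X = kfield_disc A' B'"
    unfolding X using pull_kfield[OF assms(1)] by (auto simp: kfield_disc_def pull_def fun_eq_iff)
  then show ?thesis
    unfolding killing_iff by blast
qed

lemma killing_add: "X \<in> killing \<Longrightarrow> Y \<in> killing \<Longrightarrow> (\<lambda>z. X z + Y z) \<in> killing"
proof -
  assume "X \<in> killing" "Y \<in> killing"
  then obtain A B C D where "X = kfield_disc A B" "Y = kfield_disc C D"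
    unfolding killing_iff by blast
  then have "(\<lambda>z. X z + Y z) = kfield_disc (A + C) (B + D)"
    by (auto simp: fun_eq_iff kfield_disc_def kfield_def algebra_simps)
  then show ?thesis unfolding killing_iff by blast
qed

lemma killing_scale: "X \<in> killing \<Longrightarrow> (\<lambda>z. of_real r * X z) \<in> killing"
proof -
  assume "X \<in> killing"
  then obtain A B where "X = kfield_disc A B"
    unfolding killing_iff by blast
  then have "(\<lambda>z. of_real r * X z) = kfield_disc (of_real r * A) (r * B)"
    by (auto simp: fun_eq_iff kfield_disc_def kfield_def algebra_simps)
  then show ?thesis unfolding killing_iff by blast
qed

lemma killing_zero: "(\<lambda>z. 0) \<in> killing"
proof -
  have "(\<lambda>z. 0) = kfield_disc 0 0"
    by (auto simp: fun_eq_iff kfield_disc_def kfield_def)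
  then show ?thesis unfolding killing_iff by blast
qed

section \<open>Cocycles are coboundaries of smooth vector fields\<close>

context disc_group
begin

lemma compose_mem: "g \<in> \<Gamma> \<Longrightarrow> h \<in> \<Gamma> \<Longrightarrow> compose disc g h \<in> \<Gamma>"
  using elem mult_mem by (metis moebius_su_mult)

lemma maps_disc: "g \<in> \<Gamma> \<Longrightarrow> z \<in> disc \<Longrightarrow> g z \<in> disc"
  using elem moebius_disc by metis

lemma cocycle_compose:
  assumes "c \<in> carrier (cocycles \<Gamma>)" "g \<in> \<Gamma>" "h \<in> \<Gamma>"
  shows "c (compose disc g h) z = pull h (c g) z + c h z"
proof -
  obtain p q where "p \<in> SU11" "g = moebius p" "q \<in> SU11" "h = moebius q"
    using elem assms by metis
  then have "g \<otimes>\<^bsub>PSU11\<^esub> h = compose disc g h"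
    by (simp add: mult_PSU11 moebius_su_mult)
  moreover have "c (g \<otimes>\<^bsub>PSU11\<^esub> h) = (\<lambda>z. pull h (c g) z + c h z)"
    using assms unfolding cocycles_def by simp
  ultimately show ?thesis by simp
qed

lemma cocycle_killing: "c \<in> carrier (cocycles \<Gamma>) \<Longrightarrow> g \<in> \<Gamma> \<Longrightarrow> c g \<in> killing"
  by (simp add: cocycles_def)

lemma cocycle_outside:
  "c \<in> carrier (cocycles \<Gamma>) \<Longrightarrow> g \<notin> \<Gamma> \<or> z \<notin> disc \<Longrightarrow> c g z = 0"
  by (auto simp: cocycles_def killing_def)

lemma coboundary_iff:
  assumes "c \<in> carrier (cocycles \<Gamma>)"
  shows "c = coboundary \<Gamma> \<psi> \<longleftrightarrow> (\<forall>g\<in>\<Gamma>. \<forall>z\<in>disc. pull g \<psi> z = \<psi> z + c g z)"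
proof
  assume "\<forall>g\<in>\<Gamma>. \<forall>z\<in>disc. pull g \<psi> z = \<psi> z + c g z"
  then show "c = coboundary \<Gamma> \<psi>"
    using cocycle_outside[OF assms] unfolding coboundary_def fun_eq_iff by auto
qed (simp add: coboundary_def)

section \<open>The weighted average of a cocycle\<close>

text \<open>The radius (1 + R) / 2 lies strictly between \<open>R\<close> and 1: the function is
  positive on the disc that every orbit meets, and its support is compact in the open disc. Using
  |z|^2 keeps it smooth at 0.\<close>

definition cutoff :: "complex \<Rightarrow> real" where
  "cutoff z = flat_exp [:1:] (((1 + R) / 2)\<^sup>2 - (cmod z)\<^sup>2)"

definition near :: "complex \<Rightarrow> (complex \<Rightarrow> complex) set" where
  "near z = {g \<in> \<Gamma>. cmod (g z) < (1 + R) / 2}"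

lemma cutoff_pos_iff: "0 < cutoff z \<longleftrightarrow> cmod z < (1 + R) / 2"
  using R abs_le_square_iff[of "(1 + R) / 2" "cmod z"] by (auto simp: cutoff_def flat_exp_def not_le[symmetric])

lemma cutoff_eq_0: "\<not> cmod z < (1 + R) / 2 \<Longrightarrow> cutoff z = 0"
  using cutoff_pos_iff[of z] by (auto simp: cutoff_def flat_exp_def split: if_splits)

text \<open>A finite index set that serves all points of the disc of radius r at once, whereas
  \<open>near z\<close> varies with z; the additional elements have weight 0.\<close>

definition near_on :: "real \<Rightarrow> (complex \<Rightarrow> complex) set" where
  "near_on r = {g \<in> \<Gamma>. \<exists>z. cmod z \<le> r \<and> cmod (g z) \<le> (1 + R) / 2}"

lemma finite_near_on: "r < 1 \<Longrightarrow> finite (near_on r)"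
  unfolding near_on_def using R by (intro finite_return) auto

lemma near_subset: "cmod z \<le> r \<Longrightarrow> near z \<subseteq> near_on r"
  unfolding near_def near_on_def by (auto intro: less_imp_le)

lemma finite_near: "z \<in> disc \<Longrightarrow> finite (near z)"
  using finite_subset[OF near_subset[of z "cmod z"] finite_near_on] by simp

lemma sum_near_eq:
  fixes f :: "(complex \<Rightarrow> complex) \<Rightarrow> complex"
  assumes "cmod z \<le> r" "r < 1"
  shows "(\<Sum>g\<in>near z. of_real (cutoff (g z)) * f g) = (\<Sum>g\<in>near_on r. of_real (cutoff (g z)) * f g)"
  by (rule sum.mono_neutral_left[OF finite_near_on near_subset])
    (use assms cutoff_eq_0 in \<open>auto simp: near_def near_on_def\<close>)

text \<open>The factor 1 in the denominator makes it an instance of \<open>sum_near_eq\<close>, like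
  the numerator.\<close>

definition averaged :: "((complex \<Rightarrow> complex) \<Rightarrow> complex \<Rightarrow> complex) \<Rightarrow> complex \<Rightarrow> complex" where
  "averaged c z = - (\<Sum>g\<in>near z. of_real (cutoff (g z)) * c g z) / (\<Sum>g\<in>near z. of_real (cutoff (g z)) * 1)"

lemma sum_cutoff_nonzero:
  assumes z: "z \<in> disc"
  shows "(\<Sum>g\<in>near z. complex_of_real (cutoff (g z)) * 1) \<noteq> 0"
proof -
  obtain g where g: "g \<in> \<Gamma>" "cmod (g z) \<le> R"
    using cover[OF z] by blast
  have "g \<in> near z"
    using g R unfolding near_def by auto
  then have "0 < (\<Sum>g\<in>near z. cutoff (g z))"
    using finite_near[OF z] by (intro sum_pos) (auto simp: cutoff_pos_iff near_def)
  then have "of_real (\<Sum>g\<in>near z. cutoff (g z)) \<noteq> (0::complex)"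
    by (simp only: of_real_eq_0_iff)
  then show ?thesis by simp
qed

lemma Ck_on_cutoff:
  assumes "g \<in> \<Gamma>"
  shows "Ck_on k disc (\<lambda>z. complex_of_real (cutoff (g z)))"
proof -
  obtain p where "p \<in> SU11" "g = moebius p"
    using elem[OF assms] by blast
  then have "Ck_on k disc g"
    by (simp add: Ck_on_moebius)
  then show ?thesis
    unfolding cutoff_def by (intro Ck_on_of_real Ck_on_flat_exp Ck_on_diff Ck_on_const Ck_on_norm_power2) auto
qed

lemma Ck_on_killing: "X \<in> killing \<Longrightarrow> Ck_on k disc X"
  by (simp add: killing_def smooth_on_disc)

lemma smooth_averaged:
  assumes c: "c \<in> carrier (cocycles \<Gamma>)"
  shows "smooth_on disc (averaged c)"
  unfolding smooth_on_disc
proof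
  fix k
  show "Ck_on k disc (averaged c)"
  proof (rule Ck_on_local)
    fix x :: complex assume "x \<in> disc"
    then obtain r where r: "cmod x < r" "r < 1"
      using dense by auto
    have sub: "ball 0 r \<subseteq> disc" using r by auto
    have el: "g \<in> \<Gamma>" if "g \<in> near_on r" for g
      using that unfolding near_on_def by blast
    have eq: "averaged c z = - (\<Sum>g\<in>near_on r. of_real (cutoff (g z)) * c g z)
        / (\<Sum>g\<in>near_on r. of_real (cutoff (g z)) * 1)" if "z \<in> ball 0 r" for z
      unfolding averaged_def using sum_near_eq[of z r "\<lambda>g. c g z"] sum_near_eq[of z r "\<lambda>g. 1"] that r
      by simp
    have nz: "(\<Sum>g\<in>near_on r. complex_of_real (cutoff (g z)) * 1) \<noteq> 0" if "z \<in> ball 0 r" for z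
      using sum_cutoff_nonzero[of z] sum_near_eq[of z r "\<lambda>g. 1"] that r by simp
    have "Ck_on k (ball 0 r) (\<lambda>z. - (\<Sum>g\<in>near_on r. of_real (cutoff (g z)) * c g z)
        / (\<Sum>g\<in>near_on r. of_real (cutoff (g z)) * 1))"
      by (intro Ck_on_divide Ck_on_uminus Ck_on_sum Ck_on_mult Ck_on_subset[OF _ sub]
          Ck_on_cutoff Ck_on_killing cocycle_killing[OF c] el nz Ck_on_const open_ball)
    then have "Ck_on k (ball 0 r) (averaged c)"
      by (rule Ck_on_cong[OF open_ball, rotated]) (simp only: eq)
    then show "\<exists>U. open U \<and> x \<in> U \<and> Ck_on k U (averaged c)"
      using r by (intro exI[of _ "ball 0 r"]) auto
  qed
qed

text \<open>Right translation by h is a bijection from \<open>near (h z)\<close> to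
  \<open>near z\<close>, inverted by right translation by the inverse of h.\<close>

lemma sum_near_compose:
  assumes h: "h \<in> \<Gamma>" and z: "z \<in> disc"
  shows "(\<Sum>g\<in>near (h z). F (compose disc g h)) = (\<Sum>g\<in>near z. F g)"
proof -
  obtain q where q: "q \<in> SU11" "h = moebius q"
    using elem[OF h] by blast
  define k where "k = moebius (su_inv q)"
  have k: "k \<in> \<Gamma>"
    unfolding k_def using inv_mem q h by blast
  have 1: "compose disc (compose disc g h) k = g" "compose disc (compose disc g k) h = g"
    if g: "g \<in> \<Gamma>" for g
  proof -
    obtain p where "p \<in> SU11" "g = moebius p"
      using elem[OF g] by blast
    then show "compose disc (compose disc g h) k = g" "compose disc (compose disc g k) h = g"
      unfolding k_def q(2) using q(1)
      by (simp_all add: moebius_su_mult[symmetric] su_mult_SU11 su_inv_SU11 su_mult_assoc su_mult_inv su_mult_one)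
  qed
  have hz: "h z \<in> disc" using maps_disc[OF h z] .
  have kh: "k (h z) = z"
    unfolding k_def q(2) using moebius_inv[OF q(1) z] by simp
  show ?thesis
  proof (rule sum.reindex_bij_witness[where j = "\<lambda>g. compose disc g h" and i = "\<lambda>g. compose disc g k"])
    show "compose disc (compose disc g h) k = g" "compose disc g h \<in> near z" if "g \<in> near (h z)" for g
      using that 1 z compose_mem[OF _ h] unfolding near_def by (auto simp: compose_def)
    show "compose disc (compose disc g k) h = g" "compose disc g k \<in> near (h z)" if "g \<in> near z" for g
      using that 1 hz kh compose_mem[OF _ k] unfolding near_def by (auto simp: compose_def)
  qed simp
qed

text \<open>The cocycle relation writes the pullback of c_g by h as c_gh - c_h. Averaging over g,
  the first term reproduces the average at z after reindexing, and the second is constant in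
  g.\<close>

lemma coboundary_averaged:
  assumes c: "c \<in> carrier (cocycles \<Gamma>)"
  shows "c = coboundary \<Gamma> (averaged c)"
  unfolding coboundary_iff[OF c]
proof (intro ballI)
  fix h z assume h: "h \<in> \<Gamma>" and z: "z \<in> disc"
  have hz: "h z \<in> disc" using maps_disc[OF h z] .
  define D where "D = (\<Sum>g\<in>near z. complex_of_real (cutoff (g z)) * 1)"
  have D: "D \<noteq> 0" using sum_cutoff_nonzero[OF z] by (simp add: D_def)
  have D2: "(\<Sum>g\<in>near (h z). complex_of_real (cutoff (g (h z))) * 1) = D"
    using sum_near_compose[OF h z, of "\<lambda>g. complex_of_real (cutoff (g z)) * 1"] z
    by (simp add: D_def compose_def)
  have "(\<Sum>g\<in>near (h z). of_real (cutoff (g (h z))) * c g (h z)) / deriv h z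
      = (\<Sum>g\<in>near (h z). of_real (cutoff (compose disc g h z)) * (c (compose disc g h) z - c h z))"
    unfolding sum_divide_distrib
  proof (rule sum.cong)
    fix g assume "g \<in> near (h z)"
    then have "g \<in> \<Gamma>" by (simp add: near_def)
    then have "c (compose disc g h) z - c h z = c g (h z) / deriv h z"
      using cocycle_compose[OF c _ h] z by (simp add: pull_def)
    then show "of_real (cutoff (g (h z))) * c g (h z) / deriv h z =
        of_real (cutoff (compose disc g h z)) * (c (compose disc g h) z - c h z)"
      using z by (simp add: compose_def)
  qed simp
  also have "\<dots> = (\<Sum>g\<in>near z. of_real (cutoff (g z)) * (c g z - c h z))"
    by (rule sum_near_compose[OF h z])
  also have "\<dots> = (\<Sum>g\<in>near z. of_real (cutoff (g z)) * c g z) - D * c h z"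
    by (simp add: D_def algebra_simps sum_subtractf sum_distrib_left)
  finally have "- ((\<Sum>g\<in>near (h z). of_real (cutoff (g (h z))) * c g (h z)) / deriv h z) / D
      = - ((\<Sum>g\<in>near z. of_real (cutoff (g z)) * c g z) - D * c h z) / D"
    by (simp only:)
  then have "averaged c (h z) / deriv h z
      = - ((\<Sum>g\<in>near z. of_real (cutoff (g z)) * c g z) - D * c h z) / D"
    unfolding averaged_def D2 by (simp add: divide_divide_eq_left mult.commute)
  also have "\<dots> = averaged c z + c h z"
    unfolding averaged_def D_def[symmetric] using D by (simp add: field_simps)
  finally show "pull h (averaged c) z = averaged c z + c h z"
    using z by (simp add: pull_def)
qed

end

section \<open>Boundary values\<close>

text \<open>If p brings r0 w back into the disc of radius R, its entries are O(1 / sqrt (1 - r0)),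
  but numerator and denominator stay O(sqrt (1 - r0)) on the whole segment from r0 w to w.\<close>

lemma ray_bounds:
  assumes p: "p \<in> SU11" and w: "cmod w = 1" and r0: "0 \<le> r0" "r0 < 1"
    and R: "cmod (moebius p (of_real r0 * w)) \<le> R" "R < 1" and r: "r0 \<le> r" "r \<le> 1"
  defines "\<kappa> \<equiv> 1 / (1 - R)"
  shows "cmod (fst p) * sqrt (1 - r0) \<le> \<kappa>"
    and "cmod (mden p (of_real r * w)) \<le> 3 * \<kappa> * sqrt (1 - r0)"
    and "cmod (mnum p (of_real r * w)) \<le> 3 * \<kappa> * sqrt (1 - r0)"
proof -
  define z0 where "z0 = of_real r0 * w"
  define y where "y = moebius p z0"
  define T where "T = sqrt (1 - r0)"
  have T: "T\<^sup>2 = 1 - r0" "T \<ge> 0" using r0 by (auto simp: T_def)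
  have n0: "cmod z0 = r0" using w r0 by (simp add: z0_def norm_mult)
  have z0: "z0 \<in> disc" using n0 r0 by simp
  have y: "y \<in> disc" "cmod y \<le> R" using moebius_disc[OF p z0] R by (auto simp: y_def z0_def)
  \<comment> \<open>The bound is applied to the inverse matrix, whose first entry has the same
    modulus and which moves \<open>y\<close> to \<open>z0\<close>.\<close>
  have "(cmod (fst p))\<^sup>2 * (1 - cmod y)\<^sup>2 * (1 - (cmod z0)\<^sup>2) \<le> 1 - (cmod y)\<^sup>2"
    using fst_norm_bound[OF su_inv_SU11[OF p] y(1)] moebius_inv(1)[OF p z0]
    by (simp add: y_def su_inv_def)
  also have "\<dots> \<le> 1" by simp
  finally have 1: "(cmod (fst p))\<^sup>2 * (1 - cmod y)\<^sup>2 * (1 - r0\<^sup>2) \<le> 1"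
    by (simp add: n0)
  have "(cmod (fst p) * T * (1 - R))\<^sup>2 = (cmod (fst p))\<^sup>2 * (1 - R)\<^sup>2 * (1 - r0)"
    by (simp add: power_mult_distrib T(1))
  also have "\<dots> \<le> (cmod (fst p))\<^sup>2 * (1 - cmod y)\<^sup>2 * (1 - r0\<^sup>2)"
  proof (intro mult_mono)
    show "(1 - R)\<^sup>2 \<le> (1 - cmod y)\<^sup>2" using y R by (intro power_mono) auto
    show "1 - r0 \<le> 1 - r0\<^sup>2" using r0 by (simp add: power2_eq_square mult_left_le)
  qed (use r0 in auto)
  also have "\<dots> \<le> 1\<^sup>2" using 1 by simp
  finally have "cmod (fst p) * T * (1 - R) \<le> 1"
    by (rule power2_le_imp_le) simp
  then show aT: "cmod (fst p) * sqrt (1 - r0) \<le> \<kappa>"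
    using R(2) by (simp add: \<kappa>_def T_def field_simps)
  have "(cmod (mden p z0))\<^sup>2 * (1 - (cmod y)\<^sup>2) = 1 - r0\<^sup>2"
    using one_minus_moebius[OF p z0] mden_nonzero[OF p, of z0] n0 r0 by (simp add: y_def)
  also have "\<dots> = (1 + r0) * (1 - r0)"
    by (simp add: power2_eq_square algebra_simps)
  also have "\<dots> \<le> 2 * (1 - r0)"
    using r0 by (intro mult_right_mono) auto
  finally have 2: "(cmod (mden p z0))\<^sup>2 * (1 - (cmod y)\<^sup>2) \<le> 2 * (1 - r0)" .
  have "(cmod (mden p z0) * (1 - R))\<^sup>2 = (cmod (mden p z0))\<^sup>2 * (1 - R)\<^sup>2"
    by (simp add: power_mult_distrib)
  also have "\<dots> \<le> (cmod (mden p z0))\<^sup>2 * (1 - (cmod y)\<^sup>2)"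
  proof (intro mult_left_mono)
    have "(cmod y)\<^sup>2 \<le> cmod y" using y(1) by (simp add: power2_eq_square mult_left_le)
    moreover have "(1 - R)\<^sup>2 \<le> 1 - R"
      using R(2) order_trans[OF norm_ge_zero y(2)] by (simp add: power2_eq_square mult_left_le)
    ultimately show "(1 - R)\<^sup>2 \<le> 1 - (cmod y)\<^sup>2" using y(2) by simp
  qed simp
  also have "\<dots> \<le> (2 * T)\<^sup>2"
    using 2 r0 by (simp add: power_mult_distrib T)
  finally have "cmod (mden p z0) * (1 - R) \<le> 2 * T"
    by (rule power2_le_imp_le) (simp add: T)
  then have 3: "cmod (mden p z0) \<le> 2 * \<kappa> * T"
    using R(2) by (simp add: \<kappa>_def field_simps)
  \<comment> \<open>Passing from \<open>z0\<close> to r w changes the denominator by at most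
    |\<open>snd p\<close>| T^2 \<le> \<kappa> T, which turns the constant 2 into 3.\<close>
  have "mden p (of_real r * w) = mden p z0 + cnj (snd p) * (of_real (r - r0) * w)"
    by (simp add: mden_def z0_def algebra_simps)
  then have "cmod (mden p (of_real r * w)) \<le> cmod (mden p z0) + cmod (snd p) * (r - r0)"
    using norm_triangle_ineq[of "mden p z0" "cnj (snd p) * (of_real (r - r0) * w)"] r w
    by (simp add: norm_mult del: of_real_diff)
  moreover have "cmod (snd p) * (r - r0) \<le> cmod (fst p) * T\<^sup>2"
    using SU11_norm_less[OF p] r by (intro mult_mono) (auto simp: T)
  moreover have "cmod (fst p) * T\<^sup>2 \<le> \<kappa> * T"
    using mult_right_mono[OF aT T(2)] by (simp add: T_def[symmetric] power2_eq_square)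
  ultimately show d: "cmod (mden p (of_real r * w)) \<le> 3 * \<kappa> * sqrt (1 - r0)"
    using 3 by (simp add: T_def[symmetric] algebra_simps)
  have "cmod (of_real r * w) \<le> 1"
    using r r0 w by (simp add: norm_mult)
  then have "(cmod (mnum p (of_real r * w)))\<^sup>2 \<le> (cmod (mden p (of_real r * w)))\<^sup>2"
    using mden_mnum_norm[OF p, of "of_real r * w"] power_le_one[OF norm_ge_zero, of "of_real r * w" 2] by linarith
  then have "cmod (mnum p (of_real r * w)) \<le> cmod (mden p (of_real r * w))"
    by (rule power2_le_imp_le) simp
  then show "cmod (mnum p (of_real r * w)) \<le> 3 * \<kappa> * sqrt (1 - r0)"
    using d by simp
qed

text \<open>Three terms of size M, each with a product of two factors 3 \<kappa> T: this gives 27.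
  In the difference each product contributes twice 3 \<kappa> T |\<open>fst p\<close>| (1 - r),
  where |\<open>fst p\<close>| T \<le> \<kappa>: this gives 18, and a bound independent of
  r0.\<close>

lemma kpull_ray_bounds:
  assumes p: "p \<in> SU11" and w: "cmod w = 1" and r0: "0 \<le> r0" "r0 < 1"
    and R: "cmod (moebius p (of_real r0 * w)) \<le> R" "R < 1" and r: "r0 \<le> r" "r \<le> 1"
    and M: "cmod A \<le> M" "\<bar>B\<bar> \<le> M"
  defines "\<kappa> \<equiv> 1 / (1 - R)"
  shows "cmod (kpull p A B (of_real r * w)) \<le> 27 * M * \<kappa>\<^sup>2 * (1 - r0)"
    and "cmod (kpull p A B (of_real r * w) - kpull p A B w) \<le> 18 * M * \<kappa>\<^sup>2 * (1 - r)"
proof -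
  define T where "T = sqrt (1 - r0)"
  have T: "T\<^sup>2 = 1 - r0" "T \<ge> 0" using r0 by (auto simp: T_def)
  have \<kappa>: "\<kappa> > 0" using R(2) by (simp add: \<kappa>_def)
  have M0: "M \<ge> 0" using M(1) norm_ge_zero order_trans by blast
  define z where "z = of_real r * w"
  note rb = ray_bounds[OF p w r0 R, folded \<kappa>_def T_def]
  have aT: "cmod (fst p) * T \<le> \<kappa>" using rb(1) r by blast
  have dz: "cmod (mden p z) \<le> 3 * \<kappa> * T" "cmod (mnum p z) \<le> 3 * \<kappa> * T"
    unfolding z_def using rb(2,3)[OF r] by auto
  have dw: "cmod (mden p w) \<le> 3 * \<kappa> * T" "cmod (mnum p w) \<le> 3 * \<kappa> * T"
    using rb(2,3)[of 1] r0 by auto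
  have quad: "cmod (A * x + \<i> * of_real B * y - cnj A * v) \<le> 3 * M * K"
    if "cmod x \<le> K" "cmod y \<le> K" "cmod v \<le> K" for x y v K
  proof -
    have K: "K \<ge> 0" using that(1) norm_ge_zero order_trans by blast
    have "cmod (A * x) \<le> M * K" "cmod (\<i> * of_real B * y) \<le> M * K" "cmod (cnj A * v) \<le> M * K"
      using that M K M0 by (auto simp: norm_mult intro!: mult_mono)
    moreover have "cmod (A * x + \<i> * of_real B * y - cnj A * v)
        \<le> cmod (A * x) + cmod (\<i> * of_real B * y) + cmod (cnj A * v)"
      by (meson norm_triangle_ineq norm_triangle_le_diff add_right_mono order_trans)
    ultimately show ?thesis by simp
  qed
  have prod: "cmod (x * y) \<le> 9 * \<kappa>\<^sup>2 * (1 - r0)"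
    if "cmod x \<le> 3 * \<kappa> * T" "cmod y \<le> 3 * \<kappa> * T" for x y
  proof -
    have "cmod x * cmod y \<le> (3 * \<kappa> * T) * (3 * \<kappa> * T)"
      using that \<kappa> T by (intro mult_mono) auto
    also have "\<dots> = 9 * \<kappa>\<^sup>2 * T\<^sup>2" by (simp add: power2_eq_square)
    finally show ?thesis by (simp add: T norm_mult)
  qed
  have "cmod (kpull p A B z) \<le> 3 * M * (9 * \<kappa>\<^sup>2 * (1 - r0))"
    unfolding kpull_def unfolding power2_eq_square[of "mden p z"] power2_eq_square[of "mnum p z"]
    by (intro quad prod dz)
  then show "cmod (kpull p A B (of_real r * w)) \<le> 27 * M * \<kappa>\<^sup>2 * (1 - r0)"
    by (simp add: z_def mult_ac)
  have zw: "cmod (z - w) = 1 - r"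
  proof -
    have "z - w = of_real (r - 1) * w" by (simp add: z_def algebra_simps)
    then show ?thesis using w r by (simp add: norm_mult del: of_real_diff)
  qed
  have diff: "cmod (mden p z - mden p w) \<le> cmod (fst p) * (1 - r)"
    "cmod (mnum p z - mnum p w) \<le> cmod (fst p) * (1 - r)"
  proof -
    have "mden p z - mden p w = cnj (snd p) * (z - w)" "mnum p z - mnum p w = fst p * (z - w)"
      by (simp_all add: mden_def mnum_def algebra_simps)
    then show "cmod (mden p z - mden p w) \<le> cmod (fst p) * (1 - r)"
      "cmod (mnum p z - mnum p w) \<le> cmod (fst p) * (1 - r)"
      using SU11_norm_less[OF p] r by (auto simp: norm_mult zw intro!: mult_right_mono)
  qed
  have half: "cmod x * cmod y \<le> 3 * \<kappa>\<^sup>2 * (1 - r)"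
    if "cmod x \<le> 3 * \<kappa> * T" "cmod y \<le> cmod (fst p) * (1 - r)" for x y
  proof -
    have "cmod x * cmod y \<le> (3 * \<kappa> * T) * (cmod (fst p) * (1 - r))"
      using that \<kappa> T by (intro mult_mono) auto
    also have "\<dots> = 3 * \<kappa> * (1 - r) * (cmod (fst p) * T)" by simp
    also have "\<dots> \<le> 3 * \<kappa> * (1 - r) * \<kappa>"
      using aT \<kappa> r by (intro mult_left_mono) auto
    finally show ?thesis by (simp add: power2_eq_square mult_ac)
  qed
  have pdiff: "cmod (x * y - x' * y') \<le> 6 * \<kappa>\<^sup>2 * (1 - r)"
    if "cmod x \<le> 3 * \<kappa> * T" "cmod y' \<le> 3 * \<kappa> * T" "cmod (x - x') \<le> cmod (fst p) * (1 - r)"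
      "cmod (y - y') \<le> cmod (fst p) * (1 - r)" for x y x' y'
  proof -
    have "x * y - x' * y' = x * (y - y') + y' * (x - x')" by (simp add: algebra_simps)
    then have "cmod (x * y - x' * y') \<le> cmod x * cmod (y - y') + cmod y' * cmod (x - x')"
      by (metis norm_mult norm_triangle_ineq)
    then show ?thesis using half[of x "y - y'"] half[of y' "x - x'"] that by simp
  qed
  have "kpull p A B z - kpull p A B w = A * (mden p z * mden p z - mden p w * mden p w)
      + \<i> * of_real B * (mnum p z * mden p z - mnum p w * mden p w)
      - cnj A * (mnum p z * mnum p z - mnum p w * mnum p w)"
    by (simp add: kpull_def algebra_simps power2_eq_square)
  also have "cmod \<dots> \<le> 3 * M * (6 * \<kappa>\<^sup>2 * (1 - r))"
    by (intro quad pdiff dz dw diff)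
  finally show "cmod (kpull p A B (of_real r * w) - kpull p A B w) \<le> 18 * M * \<kappa>\<^sup>2 * (1 - r)"
    by (simp add: z_def mult_ac)
qed

text \<open>On the circle \<open>cnj w * kfield A B w\<close> is i B plus a number minus its
  conjugate.\<close>

lemma kfield_tangent: "cmod w = 1 \<Longrightarrow> Re (cnj w * kfield A B w) = 0"
proof -
  assume "cmod w = 1"
  then have "cnj w * w = 1"
    by (metis complex_norm_square mult.commute of_real_1 one_power2)
  moreover have "cnj w * kfield A B w = cnj w * A + \<i> * of_real B * (cnj w * w) - cnj A * (cnj w * w) * w"
    by (simp add: kfield_def algebra_simps power2_eq_square)
  ultimately show ?thesis by simp
qed

lemma dyadic_between:
  fixes x :: real
  assumes "0 < x" "x \<le> 1"
  obtains n where "(1/2) ^ Suc n \<le> x" "x \<le> (1/2) ^ n"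
proof -
  obtain k where "(1/2) ^ k < x"
    using real_arch_pow_inv[of x "1/2"] assms by auto
  then have ex: "\<exists>k. (1/2) ^ k \<le> x" using less_imp_le by blast
  define m where "m = (LEAST k. (1/2::real) ^ k \<le> x)"
  have m: "(1/2) ^ m \<le> x" unfolding m_def using ex by (rule LeastI_ex)
  show ?thesis
  proof (cases m)
    case 0
    then show ?thesis using m assms that[of 0] by simp
  next
    case (Suc n)
    then have "\<not> (1/2) ^ n \<le> x"
      using not_less_Least[of n "\<lambda>k. (1/2::real) ^ k \<le> x"] by (simp add: m_def)
    then show ?thesis using m Suc that[of n] by simp
  qed
qed

text \<open>For 1 - r about 2^-n this turns n (1 - r), the accumulated error of n steps, into O(sqrt
  (1 - r)).\<close>

lemma nat_le_sqrt_pow2: "real n \<le> 2 * sqrt (2 ^ n)"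
proof -
  have "(real n)\<^sup>2 \<le> 4 * 2 ^ n"
  proof (induction n rule: less_induct)
    case (less n)
    show ?case
    \<comment> \<open>The inequality (m + 1)^2 \<le> 2 m^2 holds from m = 3 on, so the cases up to 3
      are checked directly.\<close>
    proof (cases "n \<le> 3")
      case True
      then have "n = 0 \<or> n = 1 \<or> n = 2 \<or> n = 3" by auto
      then show ?thesis by auto
    next
      case False
      then obtain m where m: "n = Suc m" "m \<ge> 3" by (cases n) auto
      have "3 \<le> real m" using m(2) by simp
      have "3 * real m \<le> real m * real m" using m(2) by (intro mult_right_mono) auto
      then have "(real (Suc m))\<^sup>2 \<le> 2 * (real m)\<^sup>2" 
        using \<open>3 \<le> real m\<close> unfolding power2_eq_square of_nat_Suc ring_distribs by linarith
      also have "\<dots> \<le> 2 * (4 * 2 ^ m)" using less.IH[of m] m by simp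
      finally show ?thesis using m by simp
    qed
  qed
  also have "4 * 2 ^ n = (2 * sqrt (2 ^ n))\<^sup>2" by (simp add: power_mult_distrib)
  finally show ?thesis by (rule power2_le_imp_le) simp
qed

context disc_group
begin

lemma cocycle_coefficients:
  assumes "c \<in> carrier (cocycles \<Gamma>)"
  obtains \<alpha> \<beta> where "\<And>g. g \<in> \<Gamma> \<Longrightarrow> c g = kfield_disc (\<alpha> g) (\<beta> g)"
proof -
  have "\<forall>g\<in>\<Gamma>. \<exists>A B. c g = kfield_disc A B"
    using cocycle_killing[OF assms] unfolding killing_iff by blast
  then show ?thesis
    using that by metis
qed

lemma cocycle_one:
  assumes "c \<in> carrier (cocycles \<Gamma>)" "z \<in> disc"
  shows "c (moebius (1, 0)) z = 0"
proof -
  have "compose disc (moebius (1, 0)) (moebius (1, 0)) = moebius (1, 0)"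
    by (simp add: moebius_su_mult[symmetric] one_SU11 su_mult_one)
  moreover have "pull (moebius (1, 0)) (c (moebius (1, 0))) z = c (moebius (1, 0)) z"
    using assms(2) by (simp add: pull_moebius one_SU11 moebius_apply mden_def mnum_def)
  ultimately show ?thesis
    using cocycle_compose[OF assms(1) one_mem one_mem, of z] by simp
qed

text \<open>From \<open>ray_bounds\<close> the squared denominator is at most 9 (1 - r0) / (1 -
  R)^2, and 1 - r0 \<le> 2 (1 - r^2) on the segment considered: 18 is 9 times 2.\<close>

definition step_radius :: real where
  "step_radius = sqrt (1 - (1 - R)\<^sup>2 / 18)"

lemma step_radius: "0 \<le> step_radius" "step_radius < 1"
proof -
  have "(1 - R)\<^sup>2 \<le> 1" using R by (simp add: power_le_one)
  then show "0 \<le> step_radius" by (simp add: step_radius_def)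
  have "1 - (1 - R)\<^sup>2 / 18 < 1" using R by simp
  then show "step_radius < 1" unfolding step_radius_def by simp
qed

text \<open>An element that brings back r0 w also keeps in a compact disc the points up to half the
  remaining distance to the circle, in particular the next point of the dyadic sequence.\<close>

lemma moebius_step_radius:
  assumes p: "p \<in> SU11" and w: "cmod w = 1" and r0: "0 \<le> r0" "r0 < 1"
    and R': "cmod (moebius p (of_real r0 * w)) \<le> R" and r: "r0 \<le> r" "1 - r0 \<le> 2 * (1 - r)"
  shows "cmod (moebius p (of_real r * w)) \<le> step_radius"
proof -
  define z where "z = of_real r * w"
  have r1: "r < 1" using r r0 by simp
  have n: "cmod z = r" using w r r0 by (simp add: z_def norm_mult)
  have z: "z \<in> disc" using n r1 by simp
  define D where "D = (cmod (mden p z))\<^sup>2"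
  have D: "D > 0" unfolding D_def using mden_nonzero[OF p, of z] n r1 by simp
  have "cmod (mden p z) \<le> 3 * (1 / (1 - R)) * sqrt (1 - r0)"
    unfolding z_def using ray_bounds(2)[OF p w r0 R' R(2) r(1)] r1 by simp
  then have "D \<le> (3 * (1 / (1 - R)) * sqrt (1 - r0))\<^sup>2"
    unfolding D_def by (intro power_mono) auto
  also have "\<dots> = 9 / (1 - R)\<^sup>2 * (1 - r0)"
    using r0 by (simp add: power_mult_distrib power_divide)
  also have "\<dots> \<le> 9 / (1 - R)\<^sup>2 * (2 * (1 - r\<^sup>2))"
  proof (intro mult_left_mono)
    have "r\<^sup>2 \<le> r" using r r0 r1 by (simp add: power2_eq_square mult_left_le)
    then show "1 - r0 \<le> 2 * (1 - r\<^sup>2)" using r unfolding right_diff_distrib by linarith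
  qed simp
  finally have "D * ((1 - R)\<^sup>2 / 18) \<le> 1 - r\<^sup>2"
    using R by (simp add: field_simps)
  then have "(1 - R)\<^sup>2 / 18 \<le> (1 - r\<^sup>2) / D"
    using D by (simp add: field_simps)
  also have "\<dots> = 1 - (cmod (moebius p z))\<^sup>2"
    using one_minus_moebius[OF p z] by (simp add: D_def n)
  finally have "(cmod (moebius p z))\<^sup>2 \<le> 1 - (1 - R)\<^sup>2 / 18" by simp
  then show ?thesis
    unfolding step_radius_def z_def by (rule real_le_rsqrt)
qed

text \<open>The quotients of consecutive elements along a ray all lie in the finite set
  \<open>S\<close>, so one bound serves all rays and all steps.\<close>

lemma coefficients_bounded:
  obtains M where "M \<ge> 0"
    "\<And>g z. g \<in> \<Gamma> \<Longrightarrow> cmod z \<le> step_radius \<Longrightarrow> cmod (g z) \<le> R \<Longrightarrow> cmod (\<alpha> g) \<le> M \<and> \<bar>\<beta> g\<bar> \<le> M"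
proof -
  define S where "S = {g \<in> \<Gamma>. \<exists>z. cmod z \<le> step_radius \<and> cmod (g z) \<le> R}"
  have fin: "finite S"
    unfolding S_def using step_radius R by (intro finite_return) auto
  define M where "M = (\<Sum>g\<in>S. cmod (\<alpha> g) + \<bar>\<beta> g\<bar>)"
  have "cmod (\<alpha> g) + \<bar>\<beta> g\<bar> \<le> M" if "g \<in> S" for g
    unfolding M_def by (rule member_le_sum[OF that _ fin]) auto
  then have "cmod (\<alpha> g) \<le> M \<and> \<bar>\<beta> g\<bar> \<le> M" if "g \<in> S" for g
    using that by (smt (verit) norm_ge_zero)
  moreover have "M \<ge> 0" unfolding M_def by (intro sum_nonneg) auto
  ultimately show ?thesis
    using that unfolding S_def by blast
qed

text \<open>The group elements \<open>g n\<close> bring back the points \<open>(1 - 2\<^sup>-\<^sup>n) w\<close> of a ray; consecutive ones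
  differ by an element of a fixed finite set.  Hence \<open>- c (g n)\<close> approximates \<open>\<psi>\<close> near the
  \<open>n\<close>th point and its increments decrease geometrically.\<close>

lemma ray_expansion:
  assumes c: "c \<in> carrier (cocycles \<Gamma>)"
    and \<alpha>: "\<And>g. g \<in> \<Gamma> \<Longrightarrow> c g = kfield_disc (\<alpha> g) (\<beta> g)"
    and M: "\<And>g z. g \<in> \<Gamma> \<Longrightarrow> cmod z \<le> step_radius \<Longrightarrow> cmod (g z) \<le> R \<Longrightarrow> cmod (\<alpha> g) \<le> M \<and> \<bar>\<beta> g\<bar> \<le> M"
    and w: "cmod w = 1"
  obtains p X where "\<And>n. p n \<in> SU11" "\<And>n. moebius (p n) \<in> \<Gamma>"
    "\<And>n. cmod (moebius (p n) (of_real (1 - (1/2) ^ n) * w)) \<le> R"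
    "\<And>n. \<exists>A B. X n = kfield A B"
    "\<And>n r. 1 - (1/2) ^ n \<le> r \<Longrightarrow> r \<le> 1 \<Longrightarrow> cmod (X n (of_real r * w)) \<le> 27 * M / (1 - R)\<^sup>2 * (1/2) ^ n"
    "\<And>n r. 1 - (1/2) ^ n \<le> r \<Longrightarrow> r \<le> 1 \<Longrightarrow> cmod (X n (of_real r * w) - X n w) \<le> 18 * M / (1 - R)\<^sup>2 * (1 - r)"
    "\<And>n z. z \<in> disc \<Longrightarrow> c (moebius (p n)) z = (\<Sum>k<n. X k z)"
proof -
  define t where "t n = (1/2::real) ^ n" for n :: nat
  have t: "0 < t n" "t n \<le> 1" "t (Suc n) = t n / 2" for n
    by (auto simp: t_def power_le_one)
  \<comment> \<open>For n = 0 the point is 0 and the identity is chosen: its cocycle value vanishes,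
    so the telescoping sum starts empty.\<close>
  have "\<exists>q. q \<in> SU11 \<and> moebius q \<in> \<Gamma> \<and> cmod (moebius q (of_real (1 - t n) * w)) \<le> R \<and> (n = 0 \<longrightarrow> q = (1, 0))" for n
  proof (cases n)
    case 0
    then show ?thesis
      using one_SU11 one_mem R by (intro exI[of _ "(1, 0)"]) (simp add: t_def moebius_zero)
  next
    case (Suc m)
    have "cmod (of_real (1 - t n) * w) < 1"
      using t[of n] w by (simp add: norm_mult del: of_real_diff)
    then obtain g where "g \<in> \<Gamma>" "cmod (g (of_real (1 - t n) * w)) \<le> R"
      using cover by (metis mem_ball_0)
    then show ?thesis
      using elem Suc by blast
  qed
  then obtain p where p: "\<And>n. p n \<in> SU11" "\<And>n. moebius (p n) \<in> \<Gamma>"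
    "\<And>n. cmod (moebius (p n) (of_real (1 - t n) * w)) \<le> R" "p 0 = (1, 0)"
    by metis
  define q where "q n = su_mult (p (Suc n)) (su_inv (p n))" for n
  have q: "q n \<in> SU11" "moebius (q n) \<in> \<Gamma>" "su_mult (q n) (p n) = p (Suc n)" for n
    unfolding q_def using p inv_mem mult_mem
    by (auto simp: su_mult_SU11 su_inv_SU11 su_mult_assoc su_mult_inv su_mult_one)
  have coef: "cmod (\<alpha> (moebius (q n))) \<le> M \<and> \<bar>\<beta> (moebius (q n))\<bar> \<le> M" for n
  proof (rule M[OF q(2)])
    \<comment> \<open>The next point of the ray: \<open>p n\<close> leaves it within
      \<open>step_radius\<close>, \<open>p (Suc n)\<close> moves it within \<open>R\<close>, and
      \<open>q n\<close> maps the first image to the second.\<close>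
    let ?z = "of_real (1 - t (Suc n)) * w"
    have z: "?z \<in> disc"
      using t[of "Suc n"] w by (simp add: norm_mult del: of_real_diff)
    show "cmod (moebius (p n) ?z) \<le> step_radius"
      by (rule moebius_step_radius[OF p(1) w _ _ p(3)]) (use t[of n] in auto)
    have "moebius (q n) (moebius (p n) ?z) = moebius (p (Suc n)) ?z"
      using moebius_su_mult[OF q(1) p(1), of n n] z unfolding q(3) by (simp add: compose_def)
    then show "cmod (moebius (q n) (moebius (p n) ?z)) \<le> R"
      using p(3)[of "Suc n"] by simp
  qed
  define X where "X n = kpull (p n) (\<alpha> (moebius (q n))) (\<beta> (moebius (q n)))" for n
  show ?thesis
  proof (rule that[OF p(1,2)])
    show "cmod (moebius (p n) (of_real (1 - (1/2) ^ n) * w)) \<le> R" for n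
      using p(3)[of n] by (simp add: t_def)
    show "\<exists>A B. X n = kfield A B" for n
      unfolding X_def by (rule kpull_kfield)
    fix n and r :: real assume r: "1 - (1/2) ^ n \<le> r" "r \<le> 1"
    have r': "1 - t n \<le> r" using r by (simp add: t_def)
    note kb = kpull_ray_bounds[OF p(1)[of n] w _ _ p(3)[of n] R(2) r' r(2) conjunct1[OF coef[of n]]
        conjunct2[OF coef[of n]]]
    show "cmod (X n (of_real r * w)) \<le> 27 * M / (1 - R)\<^sup>2 * (1/2) ^ n"
      using kb(1) t[of n] r coef[of n] by (simp add: X_def t_def power_divide)
    show "cmod (X n (of_real r * w) - X n w) \<le> 18 * M / (1 - R)\<^sup>2 * (1 - r)"
      using kb(2) t[of n] r coef[of n] by (simp add: X_def t_def power_divide)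
  next
    show "c (moebius (p n)) z = (\<Sum>k<n. X k z)" if z: "z \<in> disc" for n z
    proof (induction n)
      case 0
      then show ?case using cocycle_one[OF c z] p(4) by simp
    next
      case (Suc n)
      have "c (moebius (p (Suc n))) z = pull (moebius (p n)) (c (moebius (q n))) z + c (moebius (p n)) z"
        using cocycle_compose[OF c q(2) p(2), of n n z]
        unfolding moebius_su_mult[OF q(1) p(1), symmetric] q(3) .
      then show ?case
        using Suc \<alpha>[OF q(2), of n] pull_kfield[OF p(1) z] by (simp add: X_def)
    qed
  qed
qed

text \<open>The pullback is \<open>F\<close> at the image point times the squared denominator; only
  a bound on the fixed compact disc enters, and the denominator supplies the decay.\<close>

lemma pull_ray_bound:
  assumes p: "p \<in> SU11" and w: "cmod w = 1" and r0: "0 \<le> r0" "r0 < 1"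
    and R': "cmod (moebius p (of_real r0 * w)) \<le> R" and r: "r0 \<le> r" "1 - r0 \<le> 2 * (1 - r)"
    and K: "\<And>z. cmod z \<le> step_radius \<Longrightarrow> cmod (F z) \<le> K"
  shows "cmod (pull (moebius p) F (of_real r * w)) \<le> 9 * K / (1 - R)\<^sup>2 * (1 - r0)"
proof -
  define z where "z = of_real r * w"
  have r1: "r < 1" using r r0 by simp
  have z: "z \<in> disc" using w r r0 r1 by (simp add: z_def norm_mult)
  have "cmod (mden p z) \<le> 3 * (1 / (1 - R)) * sqrt (1 - r0)"
    unfolding z_def using ray_bounds(2)[OF p w r0 R' R(2) r(1)] r1 by simp
  then have "(cmod (mden p z))\<^sup>2 \<le> (3 * (1 / (1 - R)) * sqrt (1 - r0))\<^sup>2"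
    by (intro power_mono) auto
  also have "\<dots> = 9 / (1 - R)\<^sup>2 * (1 - r0)"
    using r0 by (simp add: power_mult_distrib power_divide)
  finally have d: "(cmod (mden p z))\<^sup>2 \<le> 9 / (1 - R)\<^sup>2 * (1 - r0)" .
  have F: "cmod (F (moebius p z)) \<le> K"
    using K moebius_step_radius[OF p w r0 R' r] by (simp add: z_def)
  have "cmod (pull (moebius p) F z) = cmod (F (moebius p z)) * (cmod (mden p z))\<^sup>2"
    by (simp add: pull_moebius[OF p z] norm_mult norm_power)
  also have "\<dots> \<le> K * (9 / (1 - R)\<^sup>2 * (1 - r0))"
    using d F by (intro mult_mono) (auto intro: order_trans[OF norm_ge_zero])
  finally show ?thesis by (simp add: z_def mult_ac)
qed

theorem boundary_field_exists:
  assumes c: "c \<in> carrier (cocycles \<Gamma>)"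
  obtains Y where "\<And>w. cmod w = 1 \<Longrightarrow> Re (cnj w * Y w) = 0"
    "\<And>\<psi>. continuous_on disc \<psi> \<Longrightarrow> c = coboundary \<Gamma> \<psi> \<Longrightarrow>
       \<exists>C. \<forall>w r. cmod w = 1 \<and> 0 \<le> r \<and> r < 1 \<longrightarrow> cmod (\<psi> (of_real r * w) - Y w) \<le> C * sqrt (1 - r)"
proof -
  obtain \<alpha> \<beta> where \<alpha>: "\<And>g. g \<in> \<Gamma> \<Longrightarrow> c g = kfield_disc (\<alpha> g) (\<beta> g)"
    using cocycle_coefficients[OF c] by metis
  obtain M where M0: "M \<ge> 0" and M: "\<And>g z. g \<in> \<Gamma> \<Longrightarrow> cmod z \<le> step_radius \<Longrightarrow> cmod (g z) \<le> R \<Longrightarrow>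
      cmod (\<alpha> g) \<le> M \<and> \<bar>\<beta> g\<bar> \<le> M"
    using coefficients_bounded[of \<alpha> \<beta>] by metis
  define C0 where "C0 = M / (1 - R)\<^sup>2"
  have C0: "C0 \<ge> 0" using M0 by (simp add: C0_def)
  \<comment> \<open>The value \<open>y\<close> is chosen before \<psi> and K: it is a limit built
    from c alone, so one boundary field serves all \<psi>, and K enters only the constant, which
    does not depend on w.\<close>
  have main: "\<exists>y. Re (cnj w * y) = 0 \<and>
      (\<forall>\<psi> K r. c = coboundary \<Gamma> \<psi> \<and> (\<forall>z. cmod z \<le> step_radius \<longrightarrow> cmod (\<psi> z) \<le> K) \<and> 0 \<le> r \<and> r < 1 \<longrightarrow>
        cmod (\<psi> (of_real r * w) - y) \<le> (18 * K / (1 - R)\<^sup>2 + 180 * C0) * sqrt (1 - r))"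
    if w: "cmod w = 1" for w
  proof (rule ray_expansion[OF c \<alpha> M w])
    fix p X
    assume p: "\<And>n. p n \<in> SU11" "\<And>n. moebius (p n) \<in> \<Gamma>"
      "\<And>n. cmod (moebius (p n) (of_real (1 - (1/2) ^ n) * w)) \<le> R"
      and X: "\<And>n. \<exists>A B. X n = kfield A B"
      "\<And>n r. 1 - (1/2) ^ n \<le> r \<Longrightarrow> r \<le> 1 \<Longrightarrow> cmod (X n (of_real r * w)) \<le> 27 * M / (1 - R)\<^sup>2 * (1/2) ^ n"
      "\<And>n r. 1 - (1/2) ^ n \<le> r \<Longrightarrow> r \<le> 1 \<Longrightarrow> cmod (X n (of_real r * w) - X n w) \<le> 18 * M / (1 - R)\<^sup>2 * (1 - r)"
      "\<And>n z. z \<in> disc \<Longrightarrow> c (moebius (p n)) z = (\<Sum>k<n. X k z)"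
    have Xw: "cmod (X n w) \<le> 27 * C0 * (1/2) ^ n" for n
      using X(2)[of n 1] by (simp add: C0_def)
    have gs: "summable (\<lambda>n. 27 * C0 * (1/2) ^ n)"
      by (intro summable_mult summable_geometric) simp
    have sm: "summable (\<lambda>n. X n w)"
      using gs Xw by (rule summable_comparison_test'[where N = 0])
    define y where "y = - (\<Sum>n. X n w)"
    have "Re (cnj w * X n w) = 0" for n
      using X(1)[of n] kfield_tangent[OF w] by metis
    then have "(\<lambda>n. Re (cnj w * X n w)) sums 0"
      by simp
    moreover have "(\<lambda>n. Re (cnj w * X n w)) sums Re (cnj w * (\<Sum>n. X n w))"
      by (intro bounded_linear.sums[OF bounded_linear_Re] sums_mult summable_sums sm)
    ultimately have "Re (cnj w * (\<Sum>n. X n w)) = 0"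
      using sums_unique2 by blast
    then have tang: "Re (cnj w * y) = 0"
      by (simp add: y_def)
    have "cmod (\<psi> (of_real r * w) - y) \<le> (18 * K / (1 - R)\<^sup>2 + 180 * C0) * sqrt (1 - r)"
      if \<psi>: "c = coboundary \<Gamma> \<psi>" and K: "\<And>z. cmod z \<le> step_radius \<Longrightarrow> cmod (\<psi> z) \<le> K"
        and r: "0 \<le> r" "r < 1" for \<psi> K r
    proof -
      \<comment> \<open>The point r w lies between the nth and the next point of the ray, where the
        pullback by \<open>p n\<close> is controlled.\<close>
      obtain n where n: "(1/2) ^ Suc n \<le> 1 - r" "1 - r \<le> (1/2) ^ n"
        using dyadic_between[of "1 - r"] r by auto
      define t where "t = (1/2::real) ^ n"
      have t: "0 < t" "t \<le> 1" "t \<le> 2 * (1 - r)" "1 - r \<le> t"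
        using n by (auto simp: t_def power_le_one)
      define z where "z = of_real r * w"
      have z: "z \<in> disc" using r w by (simp add: z_def norm_mult)
      have K0: "K \<ge> 0"
        using K[of 0] step_radius(1) norm_ge_zero order_trans by (metis norm_zero)
      have "pull (moebius (p n)) \<psi> z = \<psi> z + (\<Sum>k<n. X k z)"
        using \<psi>[unfolded coboundary_iff[OF c]] p(2) z X(4)[OF z, of n] by metis
      moreover have "cmod (pull (moebius (p n)) \<psi> z) \<le> 9 * K / (1 - R)\<^sup>2 * t"
        using pull_ray_bound[OF p(1) w _ _ p(3), of n r \<psi> K] K t by (simp add: z_def t_def)
      ultimately have 1: "cmod (\<psi> z + (\<Sum>k<n. X k z)) \<le> 9 * K / (1 - R)\<^sup>2 * t"
        by simp
      have 2: "cmod (\<Sum>k<n. X k w - X k z) \<le> real n * (18 * C0 * (1 - r))"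
      proof -
        have "cmod (X k w - X k z) \<le> 18 * C0 * (1 - r)" if "k < n" for k
        proof -
          have "t \<le> (1/2) ^ k"
            unfolding t_def using that by (intro power_decreasing) auto
          then show ?thesis
            using X(3)[of k r] t r by (simp add: z_def C0_def norm_minus_commute)
        qed
        then have "cmod (\<Sum>k<n. X k w - X k z) \<le> (\<Sum>k<n. 18 * C0 * (1 - r))"
          by (intro sum_norm_le) auto
        then show ?thesis by simp
      qed
      have "(\<Sum>k. X k w) = (\<Sum>k. X (k + n) w) + (\<Sum>k<n. X k w)"
        by (rule suminf_split_initial_segment[OF sm])
      \<comment> \<open>Three errors: the pullback of \<psi> by \<open>p n\<close>, the transport of
        the first n increments from z to w, and the tail of the series at w.\<close>
      then have e: "\<psi> z - y = (\<psi> z + (\<Sum>k<n. X k z)) + (\<Sum>k<n. X k w - X k z) + (\<Sum>k. X (k + n) w)"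
        by (simp add: y_def sum_subtractf)
      have 3: "cmod (\<Sum>k. X (k + n) w) \<le> 54 * C0 * t"
      proof -
        have gs': "(\<lambda>k. 27 * C0 * t * (1/2) ^ k) sums (27 * C0 * t * (1 / (1 - 1/2)))"
          by (intro sums_mult geometric_sums) simp
        have b: "cmod (X (k + n) w) \<le> 27 * C0 * t * (1/2) ^ k" for k
          using Xw[of "k + n"] by (simp add: t_def power_add mult_ac)
        have "cmod (\<Sum>k. X (k + n) w) \<le> (\<Sum>k. 27 * C0 * t * (1/2) ^ k)"
          by (rule norm_suminf_le[OF b sums_summable[OF gs']])
        also have "\<dots> = 54 * C0 * t" using sums_unique[OF gs'] by simp
        finally show ?thesis .
      qed
      define S where "S = sqrt (1 - r)"
      have S: "0 \<le> S" "S \<le> 1" "S * S = 1 - r" using r by (auto simp: S_def)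
      have "S * S \<le> S" by (rule mult_left_le[OF S(2,1)])
      then have tS: "t \<le> 2 * S" using t unfolding S(3)[symmetric] by linarith
      have nS: "real n * (1 - r) \<le> 2 * S"
      proof -
        have "sqrt (2 ^ n) * S = sqrt (2 ^ n * (1 - r))"
          by (simp add: S_def real_sqrt_mult)
        also have "\<dots> \<le> sqrt (2 ^ n * t)"
          using t by (intro real_sqrt_le_mono mult_left_mono) auto
        also have "\<dots> = 1" by (simp add: t_def power_one_over)
        finally have "real n * S \<le> 2"
          using mult_right_mono[OF nat_le_sqrt_pow2[of n] S(1)] by simp
        then have "real n * S * S \<le> 2 * S" using S(1) by (rule mult_right_mono)
        then show ?thesis using S(3) by (simp add: mult.assoc)
      qed
      have "cmod (\<psi> z - y) \<le> 9 * K / (1 - R)\<^sup>2 * t + real n * (18 * C0 * (1 - r)) + 54 * C0 * t"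
        unfolding e by (rule norm_triangle_le, rule add_mono, rule norm_triangle_le, rule add_mono)
          (fact 1 2 3)+
      also have "\<dots> = 9 * K / (1 - R)\<^sup>2 * t + 18 * C0 * (real n * (1 - r)) + 54 * C0 * t"
        by simp
      \<comment> \<open>The terms in \<open>C0\<close> add up to 36 + 108 = 144, which the stated
        constant 180 covers.\<close>
      also have "\<dots> \<le> 9 * K / (1 - R)\<^sup>2 * (2 * S) + 18 * C0 * (2 * S) + 54 * C0 * (2 * S)"
        using C0 K0 tS nS by (intro add_mono mult_left_mono) auto
      also have "\<dots> \<le> (18 * K / (1 - R)\<^sup>2 + 180 * C0) * S"
        using C0 S by (simp add: algebra_simps)
      finally show ?thesis by (simp add: S_def z_def)
    qed
    then show ?thesis using tang by blast
  qed
  define good where "good w y \<longleftrightarrow> Re (cnj w * y) = 0 \<and>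
      (\<forall>\<psi> K r. c = coboundary \<Gamma> \<psi> \<and> (\<forall>z. cmod z \<le> step_radius \<longrightarrow> cmod (\<psi> z) \<le> K) \<and> 0 \<le> r \<and> r < 1 \<longrightarrow>
        cmod (\<psi> (of_real r * w) - y) \<le> (18 * K / (1 - R)\<^sup>2 + 180 * C0) * sqrt (1 - r))" for w y
  define Y where "Y w = (SOME y. good w y)" for w
  have Y: "good w (Y w)" if "cmod w = 1" for w
  proof -
    have "\<exists>y. good w y" using main[OF that] unfolding good_def .
    then show ?thesis unfolding Y_def by (rule someI_ex)
  qed
  show ?thesis
  proof (rule that)
    show "Re (cnj w * Y w) = 0" if "cmod w = 1" for w
      using Y[OF that] unfolding good_def by blast
    fix \<psi> assume cont: "continuous_on disc \<psi>" and \<psi>: "c = coboundary \<Gamma> \<psi>"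
    have "cball 0 step_radius \<subseteq> disc" using step_radius by auto
    then have "compact (\<psi> ` cball 0 step_radius)"
      by (intro compact_continuous_image continuous_on_subset[OF cont]) auto
    then obtain K where K: "\<And>z. cmod z \<le> step_radius \<Longrightarrow> cmod (\<psi> z) \<le> K"
      by (meson bounded_iff compact_imp_bounded image_eqI mem_cball_0)
    show "\<exists>C. \<forall>w r. cmod w = 1 \<and> 0 \<le> r \<and> r < 1 \<longrightarrow> cmod (\<psi> (of_real r * w) - Y w) \<le> C * sqrt (1 - r)"
      using Y \<psi> K unfolding good_def by blast
  qed
qed

end

section \<open>Integration over the circle\<close>

lemma cis_measurable:
  "cis \<in> measurable (restrict_space lborel {0..<2 * pi}) (restrict_space borel (sphere 0 1))"
proof (rule measurable_restrict_space2)
  have "cis \<in> borel_measurable borel"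
    by (intro borel_measurable_continuous_onI continuous_intros)
  then show "cis \<in> borel_measurable (restrict_space lborel {0..<2 * pi})"
    by (intro measurable_restrict_space1) simp
qed auto

lemma space_circle_measure: "space circle_measure = sphere 0 1"
  by (simp add: circle_measure_def space_restrict_space)

lemma finite_measure_circle: "finite_measure circle_measure"
  unfolding circle_measure_def
proof (rule finite_measure.finite_measure_distr[OF _ cis_measurable])
  show "finite_measure (restrict_space lborel {0..<2 * pi})"
    by (intro finite_measureI) (simp add: space_restrict_space emeasure_restrict_space)
qed

lemma circle_measurable_continuous:
  fixes f :: "complex \<Rightarrow> 'a::topological_space"
  assumes "continuous_on (sphere 0 1) f"
  shows "f \<in> borel_measurable circle_measure"
proof -
  have "f \<in> borel_measurable (restrict_space borel (sphere 0 1))"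
    using assms by (rule borel_measurable_continuous_on_restrict)
  then show ?thesis
    by (simp add: circle_measure_def)
qed

text \<open>A gauge integral over the closed parameter interval, to which the Leibniz rule, the
  fundamental theorem of calculus and contour integration apply;
  \<open>integral_circle_measure\<close> relates it to \<open>circle_measure\<close>.\<close>

definition circle_mean :: "(complex \<Rightarrow> complex) \<Rightarrow> complex" where
  "circle_mean f = integral {0..2 * pi} (\<lambda>t. f (cis t)) / of_real (2 * pi)"

lemma integral_circle_measure:
  fixes f :: "complex \<Rightarrow> complex"
  assumes "continuous_on (sphere 0 1) f"
  shows "(\<integral>w. f w \<partial>circle_measure) = of_real (2 * pi) * circle_mean f"
proof -
  have m: "f \<in> borel_measurable (restrict_space borel (sphere 0 1))"
    using assms by (rule borel_measurable_continuous_on_restrict)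
  have c: "continuous_on {0..2 * pi} (\<lambda>t. f (cis t))"
    by (rule continuous_on_compose2[OF assms]) (auto intro!: continuous_intros)
  have si: "set_integrable lborel {0..2 * pi} (\<lambda>t. f (cis t))"
    by (rule borel_integrable_atLeastAtMost'[OF c])
  have si': "set_integrable lborel {0..<2 * pi} (\<lambda>t. f (cis t))"
    by (rule set_integrable_subset[OF si]) auto
  have "(\<integral>w. f w \<partial>circle_measure) = (\<integral>t. f (cis t) \<partial>restrict_space lborel {0..<2 * pi})"
    unfolding circle_measure_def by (rule integral_distr[OF cis_measurable m])
  also have "\<dots> = (\<integral>t\<in>{0..<2 * pi}. f (cis t) \<partial>lborel)"
    by (subst integral_restrict_space) (auto simp: set_lebesgue_integral_def)
  also have "\<dots> = integral {0..<2 * pi} (\<lambda>t. f (cis t))"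
    by (rule set_borel_integral_eq_integral(2)[OF si'])
  also have "\<dots> = integral {0..2 * pi} (\<lambda>t. f (cis t))"
    by (rule integral_subset_negligible) (auto intro: negligible_subset[of "{2 * pi}"])
  finally show ?thesis
    by (simp add: circle_mean_def)
qed

lemma L2_circle_continuous:
  assumes "continuous_on (sphere 0 1) f"
  shows "L2_circle f"
proof -
  have c: "continuous_on (sphere 0 1) (\<lambda>w. (cmod (f w))\<^sup>2)"
    using assms by (intro continuous_intros)
  then have "compact ((\<lambda>w. (cmod (f w))\<^sup>2) ` sphere 0 1)"
    by (intro compact_continuous_image) auto
  then obtain B where "\<And>w. w \<in> sphere 0 1 \<Longrightarrow> norm ((cmod (f w))\<^sup>2) \<le> B"
    by (meson bounded_iff compact_imp_bounded image_eqI)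
  then have "integrable circle_measure (\<lambda>w. (cmod (f w))\<^sup>2)"
    by (intro finite_measure.integrable_const_bound[OF finite_measure_circle, of _ B] AE_I2
        circle_measurable_continuous[OF c]) (simp add: space_circle_measure)
  then show ?thesis
    using circle_measurable_continuous[OF assms] by (simp add: L2_circle_def)
qed

lemma norm_diff_power2_le: "(cmod (a - b))\<^sup>2 \<le> 2 * (cmod a)\<^sup>2 + 2 * (cmod b)\<^sup>2"
proof -
  have "(cmod (a - b))\<^sup>2 \<le> (cmod a + cmod b)\<^sup>2"
    by (intro power_mono norm_triangle_ineq4) simp
  also have "\<dots> \<le> 2 * (cmod a)\<^sup>2 + 2 * (cmod b)\<^sup>2"
    using zero_le_power2[of "cmod a - cmod b"] by (simp add: power2_sum power2_diff)
  finally show ?thesis .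
qed

lemma L2_circle_diff:
  assumes "L2_circle f" "L2_circle g"
  shows "L2_circle (\<lambda>w. f w - g w)"
proof -
  have [measurable]: "f \<in> borel_measurable circle_measure" "g \<in> borel_measurable circle_measure"
    using assms by (auto simp: L2_circle_def)
  have "integrable circle_measure (\<lambda>w. 2 * (cmod (f w))\<^sup>2 + 2 * (cmod (g w))\<^sup>2)"
    using assms by (auto simp: L2_circle_def)
  then have "integrable circle_measure (\<lambda>w. (cmod (f w - g w))\<^sup>2)"
    by (rule Bochner_Integration.integrable_bound) (auto intro!: AE_I2 norm_diff_power2_le)
  then show ?thesis
    by (simp add: L2_circle_def)
qed

section \<open>Uniform radial boundary values and their relation to square integrable
  extensions\<close>

text \<open>Stronger than convergence in mean square: the uniform rate makes Y continuous when
  \<psi> is, and later gives limits along non-radial approaches.\<close>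

definition boundary_values :: "(complex \<Rightarrow> complex) \<Rightarrow> (complex \<Rightarrow> complex) \<Rightarrow> bool" where
  "boundary_values \<psi> Y \<longleftrightarrow>
     (\<exists>C. \<forall>w r. cmod w = 1 \<and> 0 \<le> r \<and> r < 1 \<longrightarrow> cmod (\<psi> (of_real r * w) - Y w) \<le> C * sqrt (1 - r))"

lemma boundary_values_uniform_limit:
  assumes "boundary_values \<psi> Y"
  shows "uniform_limit (sphere 0 1) (\<lambda>r w. \<psi> (of_real r * w)) Y (at_left 1)"
proof -
  obtain C where C: "\<And>w r. cmod w = 1 \<Longrightarrow> 0 \<le> r \<Longrightarrow> r < 1 \<Longrightarrow> cmod (\<psi> (of_real r * w) - Y w) \<le> C * sqrt (1 - r)"
    using assms unfolding boundary_values_def by blast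
  have "((\<lambda>r. C * sqrt (1 - r)) \<longlongrightarrow> C * sqrt (1 - 1)) (at_left (1::real))"
    by (intro tendsto_intros)
  then have t: "((\<lambda>r. C * sqrt (1 - r)) \<longlongrightarrow> 0) (at_left (1::real))" by simp
  have ev: "eventually (\<lambda>r. r \<in> {0<..<1}) (at_left (1::real))"
    by (rule eventually_at_left_real) simp
  show ?thesis
  proof (rule uniform_limitI)
    fix e :: real assume "e > 0"
    then have "eventually (\<lambda>r. C * sqrt (1 - r) < e) (at_left (1::real))"
      using t by (rule order_tendstoD(2)[rotated])
    then show "\<forall>\<^sub>F r in at_left 1. \<forall>w\<in>sphere 0 1. dist (\<psi> (of_real r * w)) (Y w) < e"
      using ev
    proof eventually_elim
      case (elim r)
      then show ?case
        using C[of _ r] by (force simp: dist_norm)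
    qed
  qed
qed

lemma continuous_on_scaled_circle:
  assumes "continuous_on disc \<psi>" "0 \<le> r" "r < 1"
  shows "continuous_on (sphere 0 1) (\<lambda>w. \<psi> (of_real r * w))"
  by (rule continuous_on_compose2[OF assms(1)]) (use assms in \<open>auto intro!: continuous_intros simp: norm_mult\<close>)

lemma boundary_values_continuous:
  assumes "boundary_values \<psi> Y" "continuous_on disc \<psi>"
  shows "continuous_on (sphere 0 1) Y"
proof (rule uniform_limit_theorem[OF _ boundary_values_uniform_limit[OF assms(1)]])
  have "eventually (\<lambda>r. r \<in> {0<..<1}) (at_left (1::real))"
    by (rule eventually_at_left_real) simp
  then show "\<forall>\<^sub>F r in at_left 1. continuous_on (sphere 0 1) (\<lambda>w. \<psi> (of_real r * w))"
    by eventually_elim (auto intro!: continuous_on_scaled_circle assms)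
qed simp

lemma boundary_values_L2_tendsto:
  assumes "boundary_values \<psi> Y"
  shows "((\<lambda>\<epsilon>. \<integral>w. (cmod (\<psi> (of_real (1 - \<epsilon>) * w) - Y w))\<^sup>2 \<partial>circle_measure) \<longlongrightarrow> 0) (at_right (0::real))"
proof -
  obtain C where C: "\<And>w r. cmod w = 1 \<Longrightarrow> 0 \<le> r \<Longrightarrow> r < 1 \<Longrightarrow> cmod (\<psi> (of_real r * w) - Y w) \<le> C * sqrt (1 - r)"
    using assms unfolding boundary_values_def by blast
  interpret finite_measure circle_measure by (rule finite_measure_circle)
  define m where "m = measure circle_measure (space circle_measure)"
  have "((\<lambda>\<epsilon>. m * (C\<^sup>2 * \<epsilon>)) \<longlongrightarrow> m * (C\<^sup>2 * 0)) (at_right (0::real))"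
    by (intro tendsto_intros)
  then have t: "((\<lambda>\<epsilon>. m * (C\<^sup>2 * \<epsilon>)) \<longlongrightarrow> 0) (at_right (0::real))" by simp
  have ev: "eventually (\<lambda>\<epsilon>. \<epsilon> \<in> {0<..<1}) (at_right (0::real))"
    by (rule eventually_at_right_real) simp
  show ?thesis
  proof (rule tendsto_sandwich[OF _ _ tendsto_const t])
    show "\<forall>\<^sub>F \<epsilon> in at_right 0. 0 \<le> (\<integral>w. (cmod (\<psi> (of_real (1 - \<epsilon>) * w) - Y w))\<^sup>2 \<partial>circle_measure)"
      by (intro always_eventually allI integral_nonneg_AE AE_I2) simp
    show "\<forall>\<^sub>F \<epsilon> in at_right 0. (\<integral>w. (cmod (\<psi> (of_real (1 - \<epsilon>) * w) - Y w))\<^sup>2 \<partial>circle_measure) \<le> m * (C\<^sup>2 * \<epsilon>)"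
      using ev
    proof eventually_elim
      case (elim \<epsilon>)
      have "(\<integral>w. (cmod (\<psi> (of_real (1 - \<epsilon>) * w) - Y w))\<^sup>2 \<partial>circle_measure) \<le> (\<integral>w. C\<^sup>2 * \<epsilon> \<partial>circle_measure)"
      proof (rule integral_mono')
        fix w assume "w \<in> space circle_measure"
        then have "cmod (\<psi> (of_real (1 - \<epsilon>) * w) - Y w) \<le> C * sqrt \<epsilon>"
          using C[of w "1 - \<epsilon>"] elim by (simp add: space_circle_measure)
        then have "(cmod (\<psi> (of_real (1 - \<epsilon>) * w) - Y w))\<^sup>2 \<le> (C * sqrt \<epsilon>)\<^sup>2"
          by (intro power_mono) auto
        then show "(cmod (\<psi> (of_real (1 - \<epsilon>) * w) - Y w))\<^sup>2 \<le> C\<^sup>2 * \<epsilon>"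
          using elim by (simp add: power_mult_distrib)
      qed (use elim in auto)
      then show ?case by (simp add: m_def)
    qed
  qed
qed

lemma boundary_values_L2_extension:
  assumes "boundary_values \<psi> Y" "continuous_on disc \<psi>"
  shows "has_L2_extension \<psi> Y"
  using boundary_values_L2_tendsto[OF assms(1)] boundary_values_continuous[OF assms] assms(2)
  by (simp add: has_L2_extension_def L2_circle_continuous)

text \<open>Uniqueness of limits in mean square. The extension is only determined almost everywhere,
  and this reduces an arbitrary choice of it to the continuous field Y.\<close>

lemma L2_extension_AE_unique:
  assumes bv: "boundary_values \<psi> Y" and ext: "has_L2_extension \<psi> \<psi>'"
  shows "AE w in circle_measure. \<psi>' w = Y w"
proof -
  have cont: "continuous_on disc \<psi>" and L2: "L2_circle \<psi>'"
    and lim: "((\<lambda>\<epsilon>. \<integral>w. (cmod (\<psi> (of_real (1 - \<epsilon>) * w) - \<psi>' w))\<^sup>2 \<partial>circle_measure) \<longlongrightarrow> 0) (at_right (0::real))"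
    using ext by (auto simp: has_L2_extension_def)
  have Y: "L2_circle Y"
    by (intro L2_circle_continuous boundary_values_continuous[OF bv cont])
  let ?I = "\<integral>w. (cmod (\<psi>' w - Y w))\<^sup>2 \<partial>circle_measure"
  have int: "integrable circle_measure (\<lambda>w. (cmod (\<psi>' w - Y w))\<^sup>2)"
    using L2_circle_diff[OF L2 Y] by (simp add: L2_circle_def)
  have t: "((\<lambda>\<epsilon>. 2 * (\<integral>w. (cmod (\<psi> (of_real (1 - \<epsilon>) * w) - Y w))\<^sup>2 \<partial>circle_measure)
      + 2 * (\<integral>w. (cmod (\<psi> (of_real (1 - \<epsilon>) * w) - \<psi>' w))\<^sup>2 \<partial>circle_measure)) \<longlongrightarrow> 2 * 0 + 2 * 0) (at_right (0::real))"
    by (intro tendsto_intros lim boundary_values_L2_tendsto[OF bv])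
  have ev: "eventually (\<lambda>\<epsilon>. \<epsilon> \<in> {0<..<1}) (at_right (0::real))"
    by (rule eventually_at_right_real) simp
  have "?I \<le> 2 * 0 + 2 * 0"
  proof (rule tendsto_lowerbound[OF t])
    show "\<forall>\<^sub>F \<epsilon> in at_right 0. ?I \<le> 2 * (\<integral>w. (cmod (\<psi> (of_real (1 - \<epsilon>) * w) - Y w))\<^sup>2 \<partial>circle_measure)
      + 2 * (\<integral>w. (cmod (\<psi> (of_real (1 - \<epsilon>) * w) - \<psi>' w))\<^sup>2 \<partial>circle_measure)"
      using ev
    proof eventually_elim
      case (elim \<epsilon>)
      have s: "L2_circle (\<lambda>w. \<psi> (of_real (1 - \<epsilon>) * w))"
        using elim by (intro L2_circle_continuous continuous_on_scaled_circle cont) auto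
      have i1: "integrable circle_measure (\<lambda>w. (cmod (\<psi> (of_real (1 - \<epsilon>) * w) - Y w))\<^sup>2)"
        using L2_circle_diff[OF s Y] by (simp add: L2_circle_def)
      have i2: "integrable circle_measure (\<lambda>w. (cmod (\<psi> (of_real (1 - \<epsilon>) * w) - \<psi>' w))\<^sup>2)"
        using L2_circle_diff[OF s L2] by (simp add: L2_circle_def)
      have "?I \<le> (\<integral>w. 2 * (cmod (\<psi> (of_real (1 - \<epsilon>) * w) - Y w))\<^sup>2
          + 2 * (cmod (\<psi> (of_real (1 - \<epsilon>) * w) - \<psi>' w))\<^sup>2 \<partial>circle_measure)"
      proof (rule integral_mono[OF int])
        show "(cmod (\<psi>' w - Y w))\<^sup>2 \<le> 2 * (cmod (\<psi> (of_real (1 - \<epsilon>) * w) - Y w))\<^sup>2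
          + 2 * (cmod (\<psi> (of_real (1 - \<epsilon>) * w) - \<psi>' w))\<^sup>2" for w
          using norm_diff_power2_le[of "\<psi> (of_real (1 - \<epsilon>) * w) - Y w" "\<psi> (of_real (1 - \<epsilon>) * w) - \<psi>' w"]
          by simp
      qed (use i1 i2 in auto)
      then show ?case using i1 i2 by simp
    qed
  qed simp
  moreover have "?I \<ge> 0" by (intro integral_nonneg_AE AE_I2) simp
  ultimately have "?I = 0" by simp
  then have "AE w in circle_measure. (cmod (\<psi>' w - Y w))\<^sup>2 = 0"
    using integral_nonneg_eq_0_iff_AE[OF int] by simp
  then show ?thesis by simp
qed

section \<open>The Poisson extension of a continuous tangential field\<close>

lemma one_minus_cnj_mult_nonzero:
  assumes "cmod w = 1" "z \<in> disc"
  shows "1 - z * cnj w \<noteq> 0" "1 - cnj z * w \<noteq> 0"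
proof -
  have "cmod (z * cnj w) < 1" "cmod (cnj z * w) < 1"
    using assms by (auto simp: norm_mult)
  then show "1 - z * cnj w \<noteq> 0" "1 - cnj z * w \<noteq> 0"
    by (metis eq_iff_diff_eq_0 less_irrefl norm_one)+
qed

lemma cnj_eq_inverse: "cmod w = 1 \<Longrightarrow> cnj w = inverse w"
  by (metis complex_norm_square inverse_unique of_real_1 one_power2)

text \<open>Tangency makes the real number Re (y / (i w)) equal to -i \<open>cnj w\<close> y, so the
  integrand becomes complex linear in y; the factor i of the kernel cancels.\<close>

lemma poisson_integrand:
  assumes w: "cmod w = 1" and z: "z \<in> disc" and tan: "Re (cnj w * y) = 0"
  shows "of_real (Re (y / (\<i> * w))) * w * poisson_field (z * inverse w)
    = y * of_real ((1 - (cmod z)\<^sup>2) ^ 3) / ((1 - z * cnj w) * (1 - cnj z * w) ^ 3)"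
proof -
  have w0: "w \<noteq> 0" using w by auto
  have ww: "cnj w * w = 1" using cnj_eq_inverse[OF w] w0 by simp
  have e1: "y / (\<i> * w) = - \<i> * (cnj w * y)"
    using cnj_eq_inverse[OF w] w0 by (simp add: divide_inverse mult.commute)
  have re: "of_real (Re (y / (\<i> * w))) = - \<i> * (cnj w * y)"
    unfolding e1 using tan by (simp add: complex_eq_iff)
  have i: "inverse w = cnj w" using cnj_eq_inverse[OF w] by simp
  have "complex_of_real ((cmod (1 - cnj z * w))\<^sup>2) = (1 - z * cnj w) * (1 - cnj z * w)"
    unfolding complex_norm_square by (simp add: mult.commute)
  moreover have "cmod (z * cnj w) = cmod z" using w by (simp add: norm_mult)
  ultimately have "poisson_field (z * inverse w)
      = \<i> * of_real ((1 - (cmod z)\<^sup>2) ^ 3) / ((1 - z * cnj w) * (1 - cnj z * w) * (1 - cnj z * w)\<^sup>2)"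
    unfolding poisson_field_def i by simp
  then have "of_real (Re (y / (\<i> * w))) * w * poisson_field (z * inverse w)
    = (cnj w * w) * (y * of_real ((1 - (cmod z)\<^sup>2) ^ 3) / ((1 - z * cnj w) * (1 - cnj z * w) * (1 - cnj z * w)\<^sup>2))"
    unfolding re by (simp add: mult_ac)
  then show ?thesis
    unfolding ww by (simp add: power3_eq_cube power2_eq_square mult.assoc)
qed

text \<open>The continuous and pointwise counterpart of \<open>tangential\<close>, which holds only
  almost everywhere.\<close>

definition tangent_field :: "(complex \<Rightarrow> complex) \<Rightarrow> bool" where
  "tangent_field Y \<longleftrightarrow> continuous_on (sphere 0 1) Y \<and> (\<forall>w. cmod w = 1 \<longrightarrow> Re (cnj w * Y w) = 0)"

lemma poisson_extension_eq:
  assumes tan: "tangent_field Y" and z: "z \<in> disc"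
    and X: "X \<in> borel_measurable circle_measure" "AE w in circle_measure. X w = Y w"
  shows "poisson_extension X z =
    circle_mean (\<lambda>w. Y w * of_real ((1 - (cmod z)\<^sup>2) ^ 3) / ((1 - z * cnj w) * (1 - cnj z * w) ^ 3))"
proof -
  have cY: "continuous_on (sphere 0 1) Y" and rY: "\<And>w. cmod w = 1 \<Longrightarrow> Re (cnj w * Y w) = 0"
    using tan by (auto simp: tangent_field_def)
  let ?g = "\<lambda>w. Y w * of_real ((1 - (cmod z)\<^sup>2) ^ 3) / ((1 - z * cnj w) * (1 - cnj z * w) ^ 3)"
  have cg: "continuous_on (sphere 0 1) ?g"
    using one_minus_cnj_mult_nonzero[OF _ z] by (intro continuous_intros cY) auto
  have [measurable]: "(\<lambda>w. \<i> * w) \<in> borel_measurable circle_measure"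
    by (intro circle_measurable_continuous continuous_intros)
  have kc: "continuous_on (sphere 0 1) (\<lambda>w. w * poisson_field (z * inverse w))"
    unfolding poisson_field_def
    by (intro continuous_intros)
      (use one_minus_cnj_mult_nonzero(2)[OF _ z] in \<open>auto simp: cnj_eq_inverse[symmetric]\<close>)
  have [measurable]: "(\<lambda>w. w * poisson_field (z * inverse w)) \<in> borel_measurable circle_measure"
    by (rule circle_measurable_continuous[OF kc])
  note [measurable] = X(1)
  have "(\<integral>w. of_real (Re (X w / (\<i> * w))) * w * poisson_field (z * inverse w) \<partial>circle_measure)
      = (\<integral>w. ?g w \<partial>circle_measure)"
  proof (rule integral_cong_AE)
    have "(\<lambda>w. of_real (Re (X w / (\<i> * w))) * (w * poisson_field (z * inverse w))) \<in> borel_measurable circle_measure"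
      by measurable
    then show "(\<lambda>w. of_real (Re (X w / (\<i> * w))) * w * poisson_field (z * inverse w)) \<in> borel_measurable circle_measure"
      by (simp add: mult.assoc)
    show "?g \<in> borel_measurable circle_measure"
      by (rule circle_measurable_continuous[OF cg])
    show "AE w in circle_measure. of_real (Re (X w / (\<i> * w))) * w * poisson_field (z * inverse w) = ?g w"
      using X(2) AE_space
    proof eventually_elim
      case (elim w)
      then have "cmod w = 1" by (simp add: space_circle_measure)
      then show ?case
        using poisson_integrand[OF \<open>cmod w = 1\<close> z rY[OF \<open>cmod w = 1\<close>]] elim by simp
    qed
  qed
  then show ?thesis
    unfolding poisson_extension_def integral_circle_measure[OF cg] by simp
qed

section \<open>Means and moments over the circle\<close>

lemma circle_integrable:
  fixes f :: "complex \<Rightarrow> complex"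
  assumes "continuous_on (sphere 0 1) f"
  shows "(\<lambda>t. f (cis t)) integrable_on {0..2 * pi}"
  by (intro integrable_continuous_real continuous_on_compose2[OF assms])
    (auto intro!: continuous_intros)

lemma circle_mean_cong: "(\<And>w. cmod w = 1 \<Longrightarrow> f w = g w) \<Longrightarrow> circle_mean f = circle_mean g"
  unfolding circle_mean_def by (simp cong: Henstock_Kurzweil_Integration.integral_cong)

lemma circle_mean_add:
  "continuous_on (sphere 0 1) f \<Longrightarrow> continuous_on (sphere 0 1) g \<Longrightarrow>
    circle_mean (\<lambda>w. f w + g w) = circle_mean f + circle_mean g"
  unfolding circle_mean_def
  by (simp add: Henstock_Kurzweil_Integration.integral_add circle_integrable add_divide_distrib)

lemma circle_mean_diff:
  "continuous_on (sphere 0 1) f \<Longrightarrow> continuous_on (sphere 0 1) g \<Longrightarrow>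
    circle_mean (\<lambda>w. f w - g w) = circle_mean f - circle_mean g"
  unfolding circle_mean_def
  by (simp add: Henstock_Kurzweil_Integration.integral_diff circle_integrable diff_divide_distrib)

lemma circle_mean_mult_left: "circle_mean (\<lambda>w. c * f w) = c * circle_mean f"
  unfolding circle_mean_def by simp

lemma circle_mean_cnj: "circle_mean (\<lambda>w. cnj (f w)) = cnj (circle_mean f)"
  unfolding circle_mean_def by (simp add: integral_cnj)

text \<open>The weight \<open>cnj (Y w * w)\<close> gives the L_k of the overview. A general weight
  is needed because differentiation multiplies it by \<open>cnj w\<close>, and because the
  holomorphic part of the extension has weight Y.\<close>

definition moment :: "(complex \<Rightarrow> complex) \<Rightarrow> nat \<Rightarrow> complex \<Rightarrow> complex" where
  "moment a k z = circle_mean (\<lambda>w. a w / (1 - z * cnj w) ^ k)"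

lemma continuous_moment_integrand:
  assumes "continuous_on (sphere 0 1) a" "z \<in> disc"
  shows "continuous_on (sphere 0 1) (\<lambda>w. a w / (1 - z * cnj w) ^ k)"
  using one_minus_cnj_mult_nonzero(1)[OF _ assms(2)] by (intro continuous_intros assms(1)) auto

lemma moment_has_field_derivative:
  assumes a: "continuous_on (sphere 0 1) a" and z: "z \<in> disc"
  shows "(moment a k has_field_derivative of_nat k * moment (\<lambda>w. a w * cnj w) (Suc k) z) (at z)"
proof -
  have nz: "1 - x * cnj (cis t) \<noteq> 0" if "x \<in> disc" for x t
    using one_minus_cnj_mult_nonzero(1)[of "cis t" x] that by simp
  have ca: "continuous_on UNIV (\<lambda>t. a (cis t))"
    by (rule continuous_on_compose2[OF a]) (auto intro!: continuous_intros)
  have "((\<lambda>x. integral (cbox 0 (2 * pi)) (\<lambda>t. a (cis t) / (1 - x * cnj (cis t)) ^ k)) has_field_derivative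
      integral (cbox 0 (2 * pi)) (\<lambda>t. of_nat k * (a (cis t) * cnj (cis t)) / (1 - z * cnj (cis t)) ^ Suc k))
      (at z within disc)"
  proof (rule leibniz_rule_field_derivative[OF _ _ _ z])
    show "((\<lambda>x. a (cis t) / (1 - x * cnj (cis t)) ^ k) has_field_derivative
        of_nat k * (a (cis t) * cnj (cis t)) / (1 - x * cnj (cis t)) ^ Suc k) (at x within disc)"
      if x: "x \<in> disc" for x t
    proof (cases k)
      case (Suc m)
      define c where "c = cnj (cis t)"
      have b: "1 - x * c \<noteq> 0" using nz[OF x, of t] by (simp add: c_def)
      have "((\<lambda>x. 1 / (1 - x * c)) has_field_derivative c / (1 - x * c)\<^sup>2) (at x within disc)"
        using b by (auto intro!: derivative_eq_intros simp: power2_eq_square)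
      from DERIV_cmult[OF DERIV_power[OF this, of k], of "a (cis t)"]
      show ?thesis
        unfolding Suc c_def[symmetric] by (simp add: power_divide power2_eq_square mult_ac)
    qed simp
    show "(\<lambda>t. a (cis t) / (1 - x * cnj (cis t)) ^ k) integrable_on cbox 0 (2 * pi)" if "x \<in> disc" for x
      using circle_integrable[OF continuous_moment_integrand[OF a that]] by simp
    show "continuous_on (disc \<times> cbox 0 (2 * pi))
        (\<lambda>(x, t). of_nat k * (a (cis t) * cnj (cis t)) / (1 - x * cnj (cis t)) ^ Suc k)"
      unfolding case_prod_beta
      by (intro continuous_intros continuous_on_compose2[OF ca]) (use nz in auto)
  qed simp
  then have "((\<lambda>x. integral {0..2 * pi} (\<lambda>t. a (cis t) / (1 - x * cnj (cis t)) ^ k) / of_real (2 * pi)) has_field_derivative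
      integral {0..2 * pi} (\<lambda>t. of_nat k * (a (cis t) * cnj (cis t)) / (1 - z * cnj (cis t)) ^ Suc k) / of_real (2 * pi))
      (at z)"
    using at_within_open[OF z open_ball] by (intro DERIV_cdivide) simp
  moreover have "integral {0..2 * pi} (\<lambda>t. of_nat k * (a (cis t) * cnj (cis t)) / (1 - z * cnj (cis t)) ^ Suc k) / of_real (2 * pi)
      = circle_mean (\<lambda>w. of_nat k * (a w * cnj w / (1 - z * cnj w) ^ Suc k))"
    unfolding circle_mean_def by (simp only: times_divide_eq_right)
  ultimately show ?thesis
    unfolding moment_def[abs_def] circle_mean_mult_left[symmetric] unfolding circle_mean_def by simp
qed

lemma moment_holomorphic:
  "continuous_on (sphere 0 1) a \<Longrightarrow> moment a k holomorphic_on disc"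
  unfolding holomorphic_on_open[OF open_ball] using moment_has_field_derivative by blast

text \<open>Write z \<open>cnj w\<close> as 1 - (1 - z \<open>cnj w\<close>). Multiplying the
  derivative of a moment by z thus returns to moments with the original weight.\<close>

lemma moment_shift:
  assumes a: "continuous_on (sphere 0 1) a" and z: "z \<in> disc"
  shows "z * moment (\<lambda>w. a w * cnj w) (Suc k) z = moment a (Suc k) z - moment a k z"
proof -
  have "z * moment (\<lambda>w. a w * cnj w) (Suc k) z
      = circle_mean (\<lambda>w. a w / (1 - z * cnj w) ^ Suc k - a w / (1 - z * cnj w) ^ k)"
    unfolding moment_def circle_mean_mult_left[symmetric]
  proof (rule circle_mean_cong)
    fix w :: complex assume "cmod w = 1"
    then have nz: "1 - z * cnj w \<noteq> 0" using one_minus_cnj_mult_nonzero z by blast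
    have "a w / (1 - z * cnj w) ^ k = a w * (1 - z * cnj w) / (1 - z * cnj w) ^ Suc k"
      using nz by simp
    then show "z * (a w * cnj w / (1 - z * cnj w) ^ Suc k) = a w / (1 - z * cnj w) ^ Suc k - a w / (1 - z * cnj w) ^ k"
      by (simp only: diff_divide_distrib[symmetric]) (simp add: algebra_simps)
  qed
  also have "\<dots> = moment a (Suc k) z - moment a k z"
    unfolding moment_def by (intro circle_mean_diff continuous_moment_integrand a z)
  finally show ?thesis .
qed

definition cmoment :: "(complex \<Rightarrow> complex) \<Rightarrow> nat \<Rightarrow> complex \<Rightarrow> complex" where
  "cmoment Y k z = cnj (moment (\<lambda>w. cnj (Y w * w)) k z)"

text \<open>The Poisson extension after partial fractions, see \<open>circle_mean_pext\<close>: a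
  holomorphic term, and antiholomorphic terms with powers of 1 - |z|^2.\<close>

definition pext :: "(complex \<Rightarrow> complex) \<Rightarrow> complex \<Rightarrow> complex" where
  "pext Y z = moment Y 1 z + cnj z * cmoment Y 1 z + (1 - z * cnj z) * (cnj z * cmoment Y 2 z)
     + (1 - z * cnj z)\<^sup>2 * (cnj z * cmoment Y 3 z)"

lemma cmoment_eq: "cmoment Y k z = circle_mean (\<lambda>w. Y w * w / (1 - cnj z * w) ^ k)"
  by (simp add: cmoment_def moment_def circle_mean_cnj[symmetric])

text \<open>On the circle s - b = a \<open>cnj z\<close> w. The expansion is s^3 - b^3 = (s - b)
  (s^2 + s b + b^2) divided by a b^3.\<close>

lemma poisson_partial_fractions:
  assumes w: "cmod w = 1" and z: "z \<in> disc"
  shows "of_real ((1 - (cmod z)\<^sup>2) ^ 3) / ((1 - z * cnj w) * (1 - cnj z * w) ^ 3)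
    = 1 / (1 - z * cnj w) ^ 1 + cnj z * (w / (1 - cnj z * w) ^ 1)
      + (1 - z * cnj z) * (cnj z * (w / (1 - cnj z * w) ^ 2))
      + (1 - z * cnj z)\<^sup>2 * (cnj z * (w / (1 - cnj z * w) ^ 3))"
proof -
  define a b s where "a = 1 - z * cnj w" and "b = 1 - cnj z * w" and "s = 1 - z * cnj z"
  have nz: "a \<noteq> 0" "b \<noteq> 0"
    unfolding a_def b_def using one_minus_cnj_mult_nonzero[OF w z] by auto
  have w0: "w \<noteq> 0" using w by auto
  have ww: "cnj w * w = 1" using cnj_eq_inverse[OF w] w0 by simp
  have "a * (cnj z * w) = cnj z * w - z * cnj z * (cnj w * w)" by (simp add: a_def algebra_simps)
  then have as: "a * (cnj z * w) = s - b" unfolding ww by (simp add: b_def s_def)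
  have "complex_of_real ((1 - (cmod z)\<^sup>2) ^ 3) = s ^ 3"
    unfolding of_real_power of_real_diff complex_norm_square[symmetric] of_real_1 s_def by simp
  moreover have "s ^ 3 = b ^ 3 + (a * (cnj z * w)) * (b\<^sup>2 + s * b + s\<^sup>2)"
    unfolding as by (simp add: power2_eq_square power3_eq_cube algebra_simps)
  then have "s ^ 3 / (a * b ^ 3) = 1 / a ^ 1 + cnj z * (w / b ^ 1) + s * (cnj z * (w / b ^ 2)) + s\<^sup>2 * (cnj z * (w / b ^ 3))"
    using nz by (simp add: field_simps power2_eq_square power3_eq_cube)
  ultimately show ?thesis unfolding a_def b_def s_def by simp
qed

lemma continuous_cmoment_integrand:
  assumes "continuous_on (sphere 0 1) Y" "z \<in> disc"
  shows "continuous_on (sphere 0 1) (\<lambda>w. Y w * w / (1 - cnj z * w) ^ k)"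
  using one_minus_cnj_mult_nonzero(2)[OF _ assms(2)] by (intro continuous_intros assms(1)) auto

lemma circle_mean_pext:
  assumes Y: "continuous_on (sphere 0 1) Y" and z: "z \<in> disc"
  shows "circle_mean (\<lambda>w. Y w * of_real ((1 - (cmod z)\<^sup>2) ^ 3) / ((1 - z * cnj w) * (1 - cnj z * w) ^ 3)) = pext Y z"
proof -
  let ?f = "\<lambda>k w. Y w * w / (1 - cnj z * w) ^ k"
  note cont = continuous_moment_integrand[OF Y z] continuous_cmoment_integrand[OF Y z]
  have "circle_mean (\<lambda>w. Y w * of_real ((1 - (cmod z)\<^sup>2) ^ 3) / ((1 - z * cnj w) * (1 - cnj z * w) ^ 3))
      = circle_mean (\<lambda>w. Y w / (1 - z * cnj w) ^ 1 + cnj z * ?f 1 w + ((1 - z * cnj z) * cnj z) * ?f 2 w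
          + ((1 - z * cnj z)\<^sup>2 * cnj z) * ?f 3 w)"
  proof (rule circle_mean_cong)
    fix w :: complex assume "cmod w = 1"
    from poisson_partial_fractions[OF this z]
    show "Y w * of_real ((1 - (cmod z)\<^sup>2) ^ 3) / ((1 - z * cnj w) * (1 - cnj z * w) ^ 3)
      = Y w / (1 - z * cnj w) ^ 1 + cnj z * ?f 1 w + ((1 - z * cnj z) * cnj z) * ?f 2 w
          + ((1 - z * cnj z)\<^sup>2 * cnj z) * ?f 3 w"
      unfolding times_divide_eq_right[symmetric] by (simp only:) (simp add: algebra_simps)
  qed
  also have "\<dots> = circle_mean (\<lambda>w. Y w / (1 - z * cnj w) ^ 1) + circle_mean (\<lambda>w. cnj z * ?f 1 w)
      + circle_mean (\<lambda>w. ((1 - z * cnj z) * cnj z) * ?f 2 w) + circle_mean (\<lambda>w. ((1 - z * cnj z)\<^sup>2 * cnj z) * ?f 3 w)"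
    by (subst circle_mean_add, (intro continuous_on_add continuous_on_mult_left cont)+)+ simp
  also have "\<dots> = pext Y z"
    unfolding circle_mean_mult_left pext_def moment_def cmoment_eq by simp
  finally show ?thesis .
qed

lemma poisson_extension_pext:
  assumes "tangent_field Y" "z \<in> disc" "X \<in> borel_measurable circle_measure" "AE w in circle_measure. X w = Y w"
  shows "poisson_extension X z = pext Y z"
  using poisson_extension_eq[OF assms] circle_mean_pext[OF _ assms(2), of Y] assms(1)
  by (simp add: tangent_field_def)

text \<open>The factor \<open>cnj z\<close> is what lets \<open>moment_shift\<close> express the
  derivative through the same family.\<close>

lemma cnj_cmoment_has_derivative:
  assumes Y: "continuous_on (sphere 0 1) Y" and z: "z \<in> disc"
  shows "((\<lambda>z. cnj z * cmoment Y k z) has_derivative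
    (\<lambda>u. (cmoment Y k z + of_nat k * (cmoment Y (Suc k) z - cmoment Y k z)) * cnj u)) (at z)"
proof -
  let ?a = "\<lambda>w. cnj (Y w * w)"
  have a: "continuous_on (sphere 0 1) ?a" using Y by (intro continuous_intros)
  define D where "D = of_nat k * moment (\<lambda>w. ?a w * cnj w) (Suc k) z"
  have "z * D = of_nat k * (z * moment (\<lambda>w. ?a w * cnj w) (Suc k) z)"
    by (simp add: D_def)
  also have "\<dots> = of_nat k * (moment ?a (Suc k) z - moment ?a k z)"
    by (simp only: moment_shift[OF a z])
  finally have zD: "cnj z * cnj D = of_nat k * (cmoment Y (Suc k) z - cmoment Y k z)"
    unfolding cmoment_def complex_cnj_mult[symmetric] by (simp only:) simp
  have "(moment ?a k has_derivative (\<lambda>u. D * u)) (at z)"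
    using moment_has_field_derivative[OF a z, of k] by (simp add: D_def has_field_derivative_def)
  then have "(cmoment Y k has_derivative (\<lambda>u. cnj (D * u))) (at z)"
    unfolding cmoment_def[abs_def] by (rule has_derivative_cnj)
  then have "((\<lambda>z. cnj z * cmoment Y k z) has_derivative (\<lambda>u. cnj z * cnj (D * u) + cnj u * cmoment Y k z)) (at z)"
    by (intro has_derivative_mult has_derivative_cnj has_derivative_ident)
  moreover have "(\<lambda>u. cnj z * cnj (D * u) + cnj u * cmoment Y k z)
      = (\<lambda>u. (cmoment Y k z + of_nat k * (cmoment Y (Suc k) z - cmoment Y k z)) * cnj u)"
    unfolding zD[symmetric] by (simp add: fun_eq_iff algebra_simps)
  ultimately show ?thesis by simp
qed

definition pext_dz :: "(complex \<Rightarrow> complex) \<Rightarrow> complex \<Rightarrow> complex" where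
  "pext_dz Y z = moment (\<lambda>w. Y w * cnj w) 2 z - cnj z * (cnj z * cmoment Y 2 z)
     - 2 * (1 - z * cnj z) * cnj z * (cnj z * cmoment Y 3 z)"

definition pext_dzbar :: "(complex \<Rightarrow> complex) \<Rightarrow> complex \<Rightarrow> complex" where
  "pext_dzbar Y z = 3 * (1 - z * cnj z)\<^sup>2 * cmoment Y 4 z"

text \<open>Write s = 1 - |z|^2 and C_k for the conjugate moments. The three terms with C_k have
  \<open>cnj z\<close>-derivatives C_2, -C_2 + 2 s C_3 and -2 s C_3 + 3 s^2 C_4, whose sum
  telescopes to 3 s^2 C_4.\<close>

lemma pext_has_derivative:
  assumes Y: "continuous_on (sphere 0 1) Y" and z: "z \<in> disc"
  shows "(pext Y has_derivative (\<lambda>u. pext_dz Y z * u + pext_dzbar Y z * cnj u)) (at z)"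
proof -
  note d = cnj_cmoment_has_derivative[OF Y z]
  have m: "(moment Y 1 has_derivative (\<lambda>u. moment (\<lambda>w. Y w * cnj w) 2 z * u)) (at z)"
    using moment_has_field_derivative[OF Y z, of 1] by (simp add: has_field_derivative_def numeral_2_eq_2)
  show ?thesis
    unfolding pext_def[abs_def]
    by (rule derivative_eq_intros m d refl | simp)+
      (simp add: fun_eq_iff pext_dz_def pext_dzbar_def eval_nat_numeral algebra_simps)
qed

text \<open>The tension field involves only the mixed second derivative, so the pure one is left
  existential. The same mixed coefficient comes from the other order in
  \<open>pext_dzbar_has_derivative\<close>.\<close>

lemma pext_dz_has_derivative:
  assumes Y: "continuous_on (sphere 0 1) Y" and z: "z \<in> disc"
  shows "\<exists>a. (pext_dz Y has_derivative (\<lambda>u. a * u + (- 6 * (1 - z * cnj z) * cnj z * cmoment Y 4 z) * cnj u)) (at z)"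
proof -
  note d = cnj_cmoment_has_derivative[OF Y z]
  have Y': "continuous_on (sphere 0 1) (\<lambda>w. Y w * cnj w)" using Y by (intro continuous_intros)
  define c where "c = of_nat 2 * moment (\<lambda>w. Y w * cnj w * cnj w) (Suc 2) z"
  have m: "(moment (\<lambda>w. Y w * cnj w) 2 has_derivative (\<lambda>u. c * u)) (at z)"
    using moment_has_field_derivative[OF Y' z, of 2] by (simp add: has_field_derivative_def c_def)
  show ?thesis
    unfolding pext_dz_def[abs_def]
    by (rule exI[of _ "c + 2 * cnj z * cnj z * (cnj z * cmoment Y 3 z)"])
      ((rule derivative_eq_intros m d refl | simp)+,
       simp add: fun_eq_iff eval_nat_numeral algebra_simps)
qed

lemma pext_dzbar_has_derivative:
  assumes Y: "continuous_on (sphere 0 1) Y" and z: "z \<in> disc"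
  shows "\<exists>d. (pext_dzbar Y has_derivative (\<lambda>u. (- 6 * (1 - z * cnj z) * cnj z * cmoment Y 4 z) * u + d * cnj u)) (at z)"
proof -
  let ?a = "\<lambda>w. cnj (Y w * w)"
  have a: "continuous_on (sphere 0 1) ?a" using Y by (intro continuous_intros)
  define D where "D = of_nat 4 * moment (\<lambda>w. ?a w * cnj w) (Suc 4) z"
  have "(moment ?a 4 has_derivative (\<lambda>u. D * u)) (at z)"
    using moment_has_field_derivative[OF a z, of 4] by (simp add: D_def has_field_derivative_def)
  then have m: "(cmoment Y 4 has_derivative (\<lambda>u. cnj (D * u))) (at z)"
    unfolding cmoment_def[abs_def] by (rule has_derivative_cnj)
  show ?thesis
    unfolding pext_dzbar_def[abs_def]
    by (rule exI[of _ "3 * (1 - z * cnj z)\<^sup>2 * cnj D - 6 * (1 - z * cnj z) * z * cmoment Y 4 z"])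
      ((rule derivative_eq_intros m refl | simp)+,
       simp add: fun_eq_iff eval_nat_numeral algebra_simps)
qed

lemma lie_gD_20_pext:
  assumes Y: "continuous_on (sphere 0 1) Y" and z: "z \<in> disc"
  shows "lie_gD_20 (pext Y) z = 24 * moment (\<lambda>w. cnj (Y w * w)) 4 z"
proof -
  define s where "s = 1 - (cmod z)\<^sup>2"
  have s: "s \<noteq> 0"
    using z unfolding disc_iff s_def by simp
  have c: "1 - z * cnj z = of_real s"
    unfolding s_def of_real_diff complex_norm_square by simp
  show ?thesis
    unfolding lie_gD_20_eq[OF z pext_has_derivative[OF Y z]] pext_dzbar_def c s_def[symmetric] cmoment_def
    using s by simp
qed

section \<open>The tension field and harmonicity\<close>

text \<open>For a conformal metric the connection form is the z-derivative of the logarithm of the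
  conformal factor, hence complex bilinear in u and v.\<close>

lemma christoffel_eq:
  assumes z: "z \<in> disc"
  shows "christoffel z u v = of_real (2 / (1 - (cmod z)\<^sup>2)) * cnj z * u * v"
proof -
  define s where "s = 1 - (cmod z)\<^sup>2"
  have s: "s \<noteq> 0"
    using z unfolding disc_iff s_def by simp
  have "christoffel z u v = of_real (2 / s) *
      (((z \<bullet> u) * (v \<bullet> 1) + (z \<bullet> v) * (u \<bullet> 1) - (z \<bullet> 1) * (u \<bullet> v))
       + ((z \<bullet> u) * (v \<bullet> \<i>) + (z \<bullet> v) * (u \<bullet> \<i>) - (z \<bullet> \<i>) * (u \<bullet> v)) * \<i>)"
    unfolding christoffel_def sum_frame[OF z] ddir_gD[OF z] s_def[symmetric] using s
    by (simp add: complex_eq_iff inner_complex_def field_simps power2_eq_square power3_eq_cube)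
  also have "((z \<bullet> u) * (v \<bullet> 1) + (z \<bullet> v) * (u \<bullet> 1) - (z \<bullet> 1) * (u \<bullet> v))
       + ((z \<bullet> u) * (v \<bullet> \<i>) + (z \<bullet> v) * (u \<bullet> \<i>) - (z \<bullet> \<i>) * (u \<bullet> v)) * \<i> = cnj z * u * v"
    by (simp add: complex_eq_iff inner_complex_def algebra_simps)
  finally show ?thesis by (simp add: s_def mult.assoc)
qed

text \<open>Over the two frame vectors the squares e^2 cancel and the products e
  \<open>cnj e\<close> add up. The pure second derivatives and the Christoffel term of the source
  therefore disappear.\<close>

lemma tension_eq:
  assumes z: "z \<in> disc" and f: "f z \<in> disc"
    and D: "\<And>w. w \<in> disc \<Longrightarrow> (f has_derivative (\<lambda>u. P w * u + Q w * cnj u)) (at w)"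
    and P: "(P has_derivative (\<lambda>u. a * u + b * cnj u)) (at z)"
    and Q: "(Q has_derivative (\<lambda>u. c * u + d * cnj u)) (at z)"
  shows "tension f z = (1 - z * cnj z)\<^sup>2 *
    ((b + c) / 2 + 2 * cnj (f z) / (1 - f z * cnj (f z)) * P z * Q z)"
proof -
  define r where "r = complex_of_real ((1 - (cmod z)\<^sup>2) / 2)"
  have r: "cnj r = r" "r = (1 - z * cnj z) / 2"
    by (simp_all add: r_def complex_norm_square[symmetric])
  have dd: "ddir f w = (\<lambda>u. P w * u + Q w * cnj u)" if "w \<in> disc" for w
    using D[OF that] by (rule ddir_eq)
  have second: "ddir (\<lambda>w. ddir f w e) z = (\<lambda>u. (a * u + b * cnj u) * e + (c * u + d * cnj u) * cnj e)" for e
  proof (rule ddir_eq)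
    have "((\<lambda>w. P w * e + Q w * cnj e) has_derivative
        (\<lambda>u. (a * u + b * cnj u) * e + (c * u + d * cnj u) * cnj e)) (at z)"
      by (intro has_derivative_add has_derivative_mult_left P Q)
    then show "((\<lambda>w. ddir f w e) has_derivative
        (\<lambda>u. (a * u + b * cnj u) * e + (c * u + d * cnj u) * cnj e)) (at z)"
      by (rule has_derivative_transform_within_open[OF _ open_ball z]) (simp add: dd)
  qed
  define K where "K = 1 / (1 - f z * cnj (f z))"
  have K: "complex_of_real (2 / (1 - (cmod (f z))\<^sup>2)) = 2 * K"
    "2 * cnj (f z) / (1 - f z * cnj (f z)) = 2 * cnj (f z) * K"
    by (simp_all add: K_def complex_norm_square[symmetric])
  define L where "L = complex_of_real (2 / (1 - (cmod z)\<^sup>2))"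
  show ?thesis
    unfolding tension_def sum_frame[OF z] nabla_d_def second christoffel_eq[OF z] christoffel_eq[OF f]
      dd[OF z] r_def[symmetric] K L_def[symmetric]
    unfolding complex_cnj_mult r(1) complex_cnj_i
    unfolding r(2) by (simp add: algebra_simps add_divide_distrib diff_divide_distrib power2_eq_square)
qed

text \<open>Composing with the hyperbolic translation that moves \<open>0\<close> to \<open>\<tau> / (1 + |\<tau>|\<^sup>2)\<close> keeps
  the deformation of the identity inside the disc for all times.\<close>

lemma translation_in_disc:
  fixes z \<tau> :: complex
  assumes z: "z \<in> disc"
  defines "N \<equiv> 1 + (cmod \<tau>)\<^sup>2"
  shows "of_real N + cnj z * \<tau> \<noteq> 0" "(z * of_real N + \<tau>) / (of_real N + cnj z * \<tau>) \<in> disc"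
proof -
  have N: "(cmod \<tau>)\<^sup>2 < N\<^sup>2"
  proof -
    have "N \<le> N\<^sup>2" by (rule self_le_power) (auto simp: N_def)
    then show ?thesis by (simp add: N_def)
  qed
  have "complex_of_real ((cmod (of_real N + cnj z * \<tau>))\<^sup>2 - (cmod (z * of_real N + \<tau>))\<^sup>2)
      = of_real ((1 - (cmod z)\<^sup>2) * (N\<^sup>2 - (cmod \<tau>)\<^sup>2))"
    unfolding of_real_diff of_real_mult complex_norm_square by (simp add: algebra_simps power2_eq_square)
  then have "(cmod (of_real N + cnj z * \<tau>))\<^sup>2 - (cmod (z * of_real N + \<tau>))\<^sup>2
      = (1 - (cmod z)\<^sup>2) * (N\<^sup>2 - (cmod \<tau>)\<^sup>2)"
    by (simp only: of_real_eq_iff)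
  moreover have "0 < (1 - (cmod z)\<^sup>2) * (N\<^sup>2 - (cmod \<tau>)\<^sup>2)"
    using z N unfolding disc_iff by (intro mult_pos_pos) auto
  ultimately have "(cmod (z * of_real N + \<tau>))\<^sup>2 < (cmod (of_real N + cnj z * \<tau>))\<^sup>2" by simp
  then have lt: "cmod (z * of_real N + \<tau>) < cmod (of_real N + cnj z * \<tau>)"
    by (rule power2_less_imp_less) simp
  then show nz: "of_real N + cnj z * \<tau> \<noteq> 0"
    by (metis norm_not_less_zero norm_zero)
  then show "(z * of_real N + \<tau>) / (of_real N + cnj z * \<tau>) \<in> disc"
    using lt by (simp add: norm_divide)
qed

text \<open>Continuity of M at 0 suffices, so the tension of the deformation need not be
  differentiated in time once a factor t is split off.\<close>

lemma has_vector_derivative_scaleR_at_0: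
  fixes M :: "real \<Rightarrow> 'a::real_normed_vector"
  assumes "(M \<longlongrightarrow> M 0) (at 0 within S)"
  shows "((\<lambda>t. t *\<^sub>R M t) has_vector_derivative M 0) (at 0 within S)"
  unfolding has_vector_derivative_def has_derivative_within
proof (intro conjI bounded_linear_scaleR_left)
  have "((\<lambda>t. norm (M t - M 0)) \<longlongrightarrow> 0) (at 0 within S)"
    using assms by (simp add: LIM_zero tendsto_norm_zero)
  then have "((\<lambda>t. norm ((1 / norm (t - 0)) *\<^sub>R (t *\<^sub>R M t - (0 *\<^sub>R M 0 + (t - 0) *\<^sub>R M 0)))) \<longlongrightarrow> 0) (at 0 within S)"
  proof (rule Lim_transform_eventually)
    show "\<forall>\<^sub>F t in at 0 within S. norm (M t - M 0)
        = norm ((1 / norm (t - 0)) *\<^sub>R (t *\<^sub>R M t - (0 *\<^sub>R M 0 + (t - 0) *\<^sub>R M 0)))"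
      unfolding eventually_at_filter
      by (rule always_eventually) (simp add: scaleR_diff_right[symmetric])
  qed
  then show "((\<lambda>t. (1 / norm (t - 0)) *\<^sub>R (t *\<^sub>R M t - (0 *\<^sub>R M 0 + (t - 0) *\<^sub>R M 0))) \<longlongrightarrow> 0) (at 0 within S)"
    by (rule tendsto_norm_zero_cancel)
qed

text \<open>Wirtinger derivatives in the space variable, taken from the joint derivative so that
  smoothness in time and space together is retained.\<close>

definition slice_dz :: "(real \<times> complex \<Rightarrow> complex) \<Rightarrow> real \<times> complex \<Rightarrow> complex" where
  "slice_dz F q = (frechet_derivative F (at q) (0, 1) - \<i> * frechet_derivative F (at q) (0, \<i>)) / 2"

definition slice_dzbar :: "(real \<times> complex \<Rightarrow> complex) \<Rightarrow> real \<times> complex \<Rightarrow> complex" where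
  "slice_dzbar F q = (frechet_derivative F (at q) (0, 1) + \<i> * frechet_derivative F (at q) (0, \<i>)) / 2"

lemma slice_has_derivative:
  fixes F :: "real \<times> complex \<Rightarrow> complex"
  assumes F: "\<And>k. Ck_on k (UNIV \<times> disc) F" and z: "z \<in> disc"
  shows "((\<lambda>w. F (t, w)) has_derivative (\<lambda>u. slice_dz F (t, z) * u + slice_dzbar F (t, z) * cnj u)) (at z)"
    and "\<And>k. Ck_on k (UNIV \<times> disc) (slice_dz F)" and "\<And>k. Ck_on k (UNIV \<times> disc) (slice_dzbar F)"
proof -
  have op: "open ((UNIV :: real set) \<times> disc)" by (intro open_Times) auto
  have D: "(F has_derivative frechet_derivative F (at (t, z))) (at (t, z))"
    using Ck_on_SucD[OF F] z by blast
  have "((\<lambda>w. (t, w)) has_derivative (\<lambda>u. (0, u))) (at z)"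
    by (auto intro!: derivative_eq_intros)
  from has_derivative_compose[OF this, of F "frechet_derivative F (at (t, z))"] D
  have h: "((\<lambda>w. F (t, w)) has_derivative (\<lambda>u. frechet_derivative F (at (t, z)) (0, u))) (at z)"
    by simp
  then have "linear (\<lambda>u. frechet_derivative F (at (t, z)) (0, u))"
    by (rule has_derivative_linear)
  from linear_complex_split[OF this]
  have "(\<lambda>u. frechet_derivative F (at (t, z)) (0, u))
      = (\<lambda>u. slice_dz F (t, z) * u + slice_dzbar F (t, z) * cnj u)"
    unfolding slice_dz_def slice_dzbar_def by (rule ext)
  then show "((\<lambda>w. F (t, w)) has_derivative (\<lambda>u. slice_dz F (t, z) * u + slice_dzbar F (t, z) * cnj u)) (at z)"
    using h by (simp only:)
  have "Ck_on k (UNIV \<times> disc) (\<lambda>q. frechet_derivative F (at q) v)" for k v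
    using F[of "Suc k"] by simp
  then show "\<And>k. Ck_on k (UNIV \<times> disc) (slice_dz F)" "\<And>k. Ck_on k (UNIV \<times> disc) (slice_dzbar F)"
    unfolding slice_dz_def[abs_def] slice_dzbar_def[abs_def] by (auto intro!: Ck_on_intros op)
qed

text \<open>The last hypothesis is the linearisation at the identity of the harmonic map equation in
  \<open>tension_eq\<close>, with b the mixed second derivative of X.\<close>

lemma harmonic_vector_fieldI:
  assumes sm: "\<And>k. Ck_on k disc X"
    and D: "\<And>w. w \<in> disc \<Longrightarrow> (X has_derivative (\<lambda>u. P w * u + Q w * cnj u)) (at w)"
    and P: "\<And>z. z \<in> disc \<Longrightarrow> \<exists>a. (P has_derivative (\<lambda>u. a * u + b z * cnj u)) (at z)"
    and Q: "\<And>z. z \<in> disc \<Longrightarrow> \<exists>d. (Q has_derivative (\<lambda>u. b z * u + d * cnj u)) (at z)"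
    and eq: "\<And>z. z \<in> disc \<Longrightarrow> b z + 2 * cnj z / (1 - z * cnj z) * Q z = 0"
  shows "harmonic_vector_field disc X"
proof -
  define W where "W = (UNIV :: real set) \<times> disc"
  have op: "open W" unfolding W_def by (intro open_Times) auto
  have s0: "1 - z * cnj z \<noteq> 0" if "z \<in> disc" for z
  proof -
    have "1 - z * cnj z = of_real (1 - (cmod z)\<^sup>2)"
      by (simp add: complex_norm_square[symmetric])
    then show ?thesis using that unfolding disc_iff by (simp only: of_real_eq_0_iff)
  qed
  \<comment> \<open>Adding t X itself could leave the disc. With N = 1 + |\<tau>|^2 the deformation
    (z N + \<tau>) / (N + \<open>cnj z\<close> \<tau>) equals z + t X / \<open>den\<close>; the
    division by 1 - |z|^2 gives it the velocity X at t = 0.\<close>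
  define \<eta> where "\<eta> q = X (snd q) / (1 - snd q * cnj (snd q))" for q :: "real \<times> complex"
  define \<tau> where "\<tau> q = of_real (fst q) * \<eta> q" for q :: "real \<times> complex"
  define den where "den q = of_real (1 + (cmod (\<tau> q))\<^sup>2) + cnj (snd q) * \<tau> q" for q
  define S where "S q = X (snd q) / den q" for q
  define \<phi> where "\<phi> t z = z + of_real t * S (t, z)" for t z
  have den0: "den q \<noteq> 0" if "q \<in> W" for q
    unfolding den_def using translation_in_disc(1)[of "snd q" "\<tau> q"] that by (auto simp: W_def)
  have fs: "Ck_on k W (\<lambda>q. of_real (fst q))" "Ck_on k W snd" for k
    by (intro Ck_on_of_real op Ck_on_linear[OF bounded_linear_fst] Ck_on_linear[OF bounded_linear_snd] Ck_on_ident)+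
  have Xs: "Ck_on k W (\<lambda>q. X (snd q))" for k
  proof -
    have "Ck_on k W (\<lambda>q. X (snd q))" if "\<And>k. Ck_on k disc X" for X :: "complex \<Rightarrow> complex"
      using that
    proof (induction k arbitrary: X)
      case 0
      then have "continuous_on disc X" by (metis Ck_on.simps(1))
      then show ?case
        unfolding Ck_on.simps by (rule continuous_on_compose2[of disc X _ snd]) (auto simp: W_def intro!: continuous_intros)
    next
      case (Suc k)
      show ?case
      proof (rule Ck_on_SucI[OF op])
        show "((\<lambda>q. X (snd q)) has_derivative (\<lambda>v. frechet_derivative X (at (snd q)) (snd v))) (at q)"
          if q: "q \<in> W" for q
        proof (rule has_derivative_compose[OF bounded_linear.has_derivative[OF bounded_linear_snd has_derivative_ident]])
          show "(X has_derivative frechet_derivative X (at (snd q))) (at (snd q))"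
            using Ck_on_SucD[OF Suc.prems] q by (auto simp: W_def)
        qed
        show "Ck_on k W (\<lambda>q. frechet_derivative X (at (snd q)) (snd v))" for v
          by (rule Suc.IH) (use Suc.prems in \<open>metis Ck_on.simps(2)\<close>)
      qed
    qed
    then show ?thesis using sm by blast
  qed
  have \<tau>s: "Ck_on k W \<tau>" for k
    unfolding \<tau>_def[abs_def] \<eta>_def
    by (intro Ck_on_mult Ck_on_divide Ck_on_diff Ck_on_const Ck_on_cnj fs Xs op)
      (use s0 in \<open>auto simp: W_def\<close>)
  have dens: "Ck_on k W den" for k
    unfolding den_def[abs_def]
    by (intro Ck_on_add Ck_on_mult Ck_on_of_real Ck_on_norm_power2 Ck_on_const Ck_on_cnj fs \<tau>s op)
  have Ss: "Ck_on k W S" for k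
    unfolding S_def[abs_def] by (intro Ck_on_divide Xs dens op den0)
  have \<phi>s: "Ck_on k W (\<lambda>(t, z). \<phi> t z)" for k
    unfolding \<phi>_def case_prod_beta prod.collapse
    by (intro Ck_on_add Ck_on_mult fs Ss op)
  have \<phi>_disc: "\<phi> t z \<in> disc" if z: "z \<in> disc" for t z
  proof -
    let ?\<tau> = "\<tau> (t, z)" and ?N = "complex_of_real (1 + (cmod (\<tau> (t, z)))\<^sup>2)"
    have d: "den (t, z) = ?N + cnj z * ?\<tau>" by (simp add: den_def)
    have d0: "den (t, z) \<noteq> 0" using den0 z by (simp add: W_def)
    have "of_real t * X z = (1 - z * cnj z) * ?\<tau>"
      using s0[OF z] by (simp add: \<tau>_def \<eta>_def)
    then have "\<phi> t z = (z * den (t, z) + (1 - z * cnj z) * ?\<tau>) / den (t, z)"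
      using d0 by (simp add: \<phi>_def S_def add_divide_distrib)
    also have "z * den (t, z) + (1 - z * cnj z) * ?\<tau> = z * ?N + ?\<tau>"
      unfolding d by (simp add: algebra_simps)
    finally show ?thesis
      unfolding d using translation_in_disc(2)[OF z, of ?\<tau>] by simp
  qed
  have S0: "S (0, z) = X z" if "z \<in> disc" for z
    by (simp add: S_def den_def \<tau>_def)
  define p where "p = slice_dz S"
  define r where "r = slice_dzbar S"
  note sl = slice_has_derivative[OF Ss[unfolded W_def], folded p_def r_def W_def]
  have ps: "Ck_on k W p" and rs: "Ck_on k W r" for k
    using sl(2,3)[of 0] by auto
  define pa where "pa = slice_dz p"
  define pb where "pb = slice_dzbar p"
  define rc where "rc = slice_dz r"
  define rd where "rd = slice_dzbar r"
  note slp = slice_has_derivative[OF ps[unfolded W_def], folded pa_def pb_def W_def]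
  note slr = slice_has_derivative[OF rs[unfolded W_def], folded rc_def rd_def W_def]
  \<comment> \<open>The deformation has derivatives 1 + t p in z and t r in \<open>cnj z\<close>, so
    every term of its tension contains a factor t; \<open>M\<close> is the quotient.\<close>
  define M where "M z t = (1 - z * cnj z)\<^sup>2 * ((pb (t, z) + rc (t, z)) / 2
      + 2 * cnj (\<phi> t z) / (1 - \<phi> t z * cnj (\<phi> t z)) * (1 + of_real t * p (t, z)) * r (t, z))" for z t
  have tens: "tension (\<phi> t) z = t *\<^sub>R M z t" if z: "z \<in> disc" for t z
  proof -
    have "tension (\<phi> t) z = (1 - z * cnj z)\<^sup>2 * ((of_real t * pb (t, z) + of_real t * rc (t, z)) / 2
      + 2 * cnj (\<phi> t z) / (1 - \<phi> t z * cnj (\<phi> t z)) * (1 + of_real t * p (t, z)) * (of_real t * r (t, z)))"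
    proof (rule tension_eq[where f = "\<phi> t" and P = "\<lambda>w. 1 + of_real t * p (t, w)"
          and Q = "\<lambda>w. of_real t * r (t, w)"])
      show "z \<in> disc" "\<phi> t z \<in> disc" using z \<phi>_disc by auto
      show "(\<phi> t has_derivative (\<lambda>u. (1 + of_real t * p (t, w)) * u + of_real t * r (t, w) * cnj u)) (at w)"
        if "w \<in> disc" for w
        unfolding \<phi>_def[abs_def]
        by (rule has_derivative_eq_rhs[OF has_derivative_add[OF has_derivative_ident
              has_derivative_mult_right[OF sl(1)[OF that]]]]) (simp add: fun_eq_iff algebra_simps)
      show "((\<lambda>w. 1 + of_real t * p (t, w)) has_derivative
          (\<lambda>u. (of_real t * pa (t, z)) * u + (of_real t * pb (t, z)) * cnj u)) (at z)"
        by (rule has_derivative_eq_rhs[OF has_derivative_add[OF has_derivative_const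
              has_derivative_mult_right[OF slp(1)[OF z]]]]) (simp add: fun_eq_iff algebra_simps)
      show "((\<lambda>w. of_real t * r (t, w)) has_derivative
          (\<lambda>u. (of_real t * rc (t, z)) * u + (of_real t * rd (t, z)) * cnj u)) (at z)"
        by (rule has_derivative_eq_rhs[OF has_derivative_mult_right[OF slr(1)[OF z]]])
          (simp add: fun_eq_iff algebra_simps)
    qed
    then show ?thesis
      by (simp add: M_def scaleR_conv_of_real algebra_simps add_divide_distrib)
  qed
  \<comment> \<open>At t = 0 the slice of \<open>S\<close> is X on the whole disc, so its
    derivatives are those of X and the hypothesis applies.\<close>
  have M0: "M z 0 = 0" if z: "z \<in> disc" for z
  proof -
    have pw: "p (0, w) = P w \<and> r (0, w) = Q w" if w: "w \<in> disc" for w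
    proof -
      have "((\<lambda>w. S (0, w)) has_derivative (\<lambda>u. P w * u + Q w * cnj u)) (at w)"
        by (rule has_derivative_transform_within_open[OF D[OF w] open_ball w]) (simp add: S0)
      from has_derivative_unique[OF sl(1)[OF w] this]
      have "(p (0, w) - P w) * u + (r (0, w) - Q w) * cnj u = 0" for u
        by (simp add: fun_eq_iff algebra_simps)
      from real_part_zero_imp_zero[OF this] show ?thesis by simp
    qed
    obtain a d where ad: "(P has_derivative (\<lambda>u. a * u + b z * cnj u)) (at z)"
      "(Q has_derivative (\<lambda>u. b z * u + d * cnj u)) (at z)"
      using P[OF z] Q[OF z] by blast
    have "((\<lambda>w. p (0, w)) has_derivative (\<lambda>u. a * u + b z * cnj u)) (at z)"
      by (rule has_derivative_transform_within_open[OF ad(1) open_ball z]) (simp add: pw)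
    from has_derivative_unique[OF slp(1)[OF z] this]
    have "(pa (0, z) - a) * u + (pb (0, z) - b z) * cnj u = 0" for u
      by (simp add: fun_eq_iff algebra_simps)
    from real_part_zero_imp_zero(2)[OF this] have 1: "pb (0, z) = b z" by simp
    have "((\<lambda>w. r (0, w)) has_derivative (\<lambda>u. b z * u + d * cnj u)) (at z)"
      by (rule has_derivative_transform_within_open[OF ad(2) open_ball z]) (simp add: pw)
    from has_derivative_unique[OF slr(1)[OF z] this]
    have "(rc (0, z) - b z) * u + (rd (0, z) - d) * cnj u = 0" for u
      by (simp add: fun_eq_iff algebra_simps)
    from real_part_zero_imp_zero(1)[OF this] have 2: "rc (0, z) = b z" by simp
    have "\<phi> 0 z = z" by (simp add: \<phi>_def)
    then show ?thesis
      using eq[OF z] pw[OF z] 1 2 by (simp add: M_def)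
  qed
  have cont: "((\<lambda>t. f (t, z)) \<longlongrightarrow> f (0, z)) (at 0 within A)"
    if f: "\<And>k. Ck_on k W f" and z: "z \<in> disc" for f :: "real \<times> complex \<Rightarrow> complex" and z A
  proof -
    have "continuous_on W f" using f[of 0] by simp
    then have "isCont f (0, z)" using z op by (simp add: continuous_on_eq_continuous_at W_def)
    moreover have "((\<lambda>t. (t, z)) \<longlongrightarrow> (0, z)) (at 0 within A)"
      by (intro tendsto_intros)
    ultimately show ?thesis
      by (rule isCont_tendsto_compose)
  qed
  have pbs: "Ck_on k W pb" and rcs: "Ck_on k W rc" for k
    using slp(3)[of 0] slr(2)[of 0] by auto
  have Mc: "(M z \<longlongrightarrow> M z 0) (at 0 within A)" if z: "z \<in> disc" for z A
    unfolding M_def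
  proof (intro tendsto_intros)
    have ph: "((\<lambda>t. \<phi> t z) \<longlongrightarrow> \<phi> 0 z) (at 0 within A)"
      using cont[OF \<phi>s z] by simp
    show "((\<lambda>t. pb (t, z)) \<longlongrightarrow> pb (0, z)) (at 0 within A)" "((\<lambda>t. rc (t, z)) \<longlongrightarrow> rc (0, z)) (at 0 within A)"
      "((\<lambda>t. p (t, z)) \<longlongrightarrow> p (0, z)) (at 0 within A)" "((\<lambda>t. r (t, z)) \<longlongrightarrow> r (0, z)) (at 0 within A)"
      using cont[OF pbs z] cont[OF rcs z] cont[OF ps z] cont[OF rs z] by auto
    show "((\<lambda>t. \<phi> t z) \<longlongrightarrow> \<phi> 0 z) (at 0 within A)" "((\<lambda>t. \<phi> t z) \<longlongrightarrow> \<phi> 0 z) (at 0 within A)"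
      "((\<lambda>t. \<phi> t z) \<longlongrightarrow> \<phi> 0 z) (at 0 within A)"
      by (rule ph)+
    show "1 - \<phi> 0 z * cnj (\<phi> 0 z) \<noteq> 0"
      using s0[OF \<phi>_disc[OF z]] .
  qed auto
  show ?thesis
    unfolding harmonic_vector_field_def
  proof (intro conjI exI[of _ "1::real"] exI[of _ \<phi>] ballI)
    show "smooth_on disc X" using sm by (simp add: smooth_on_disc)
    show "smooth_on ({0..<1} \<times> disc) (\<lambda>(t, x). \<phi> t x)"
      unfolding smooth_on_def using op \<phi>s
      by (intro exI[of _ W] exI[of _ "\<lambda>(t, x). \<phi> t x"]) (auto simp: W_def)
    show "\<phi> t ` disc \<subseteq> disc" for t using \<phi>_disc by blast
    fix z :: complex assume z: "z \<in> disc"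
    show "\<phi> 0 z = z" by (simp add: \<phi>_def)
    have "((\<lambda>t. t *\<^sub>R S (t, z)) has_vector_derivative S (0, z)) (at 0 within {0..<1})"
      by (rule has_vector_derivative_scaleR_at_0[OF cont[OF Ss z]])
    then have "((\<lambda>t. z + t *\<^sub>R S (t, z)) has_vector_derivative 0 + S (0, z)) (at 0 within {0..<1})"
      by (intro has_vector_derivative_add has_vector_derivative_const)
    then show "((\<lambda>t. \<phi> t z) has_vector_derivative X z) (at 0 within {0..<1})"
      by (simp add: \<phi>_def scaleR_conv_of_real S0[OF z])
    show "((\<lambda>t. tension (\<phi> t) z) has_vector_derivative 0) (at 0 within {0..<1})"
      using has_vector_derivative_scaleR_at_0[OF Mc[OF z]] by (simp add: tens[OF z] M0[OF z])
  qed simp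
qed

section \<open>Harmonicity of the Poisson extension\<close>

lemma Ck_on_pext:
  assumes Y: "continuous_on (sphere 0 1) Y"
  shows "Ck_on k disc (pext Y)"
proof -
  have mom: "Ck_on k disc (moment a j)" if "continuous_on (sphere 0 1) a" for a j
    by (rule Ck_on_holomorphic_compose[where T = disc and g = "moment a j" and f = "\<lambda>z. z", OF open_ball open_ball])
      (use that in \<open>auto intro!: Ck_on_ident moment_holomorphic\<close>)
  have "continuous_on (sphere 0 1) (\<lambda>w. cnj (Y w * w))" using Y by (intro continuous_intros)
  then have "Ck_on k disc (cmoment Y j)" for j
    unfolding cmoment_def[abs_def] by (intro Ck_on_cnj mom open_ball)
  then show ?thesis
    unfolding pext_def[abs_def] by (intro Ck_on_intros mom Y open_ball)
qed

text \<open>The mixed derivative -6 s \<open>cnj z\<close> C_4 cancels 2 \<open>cnj z\<close> / s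
  times 3 s^2 C_4, where s = 1 - |z|^2 and C_4 is the fourth conjugate moment.\<close>

lemma harmonic_pext:
  assumes Y: "continuous_on (sphere 0 1) Y"
  shows "harmonic_vector_field disc (pext Y)"
proof (rule harmonic_vector_fieldI[OF Ck_on_pext[OF Y] pext_has_derivative[OF Y]
      pext_dz_has_derivative[OF Y] pext_dzbar_has_derivative[OF Y]])
  fix z :: complex assume z: "z \<in> disc"
  have "1 - z * cnj z = of_real (1 - (cmod z)\<^sup>2)"
    by (simp add: complex_norm_square[symmetric])
  then have nz: "1 - z * cnj z \<noteq> 0"
    using z unfolding disc_iff by (simp only: of_real_eq_0_iff)
  have "2 * c / s * (3 * s\<^sup>2 * m) = 6 * s * c * m" if "s \<noteq> 0" for c s m :: complex
    using that by (simp add: power2_eq_square)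
  note e = this[OF nz]
  show "- 6 * (1 - z * cnj z) * cnj z * cmoment Y 4 z
      + 2 * cnj z / (1 - z * cnj z) * pext_dzbar Y z = 0"
    unfolding pext_dzbar_def e by (simp add: algebra_simps)
qed

lemma harmonic_vector_field_cong:
  assumes "\<And>z. z \<in> disc \<Longrightarrow> X z = Y z" "harmonic_vector_field disc X"
  shows "harmonic_vector_field disc Y"
proof -
  have "smooth_on disc X \<longleftrightarrow> smooth_on disc Y"
    unfolding smooth_on_def using assms(1) by (metis (no_types, lifting) subsetD)
  then have "harmonic_vector_field disc X = harmonic_vector_field disc Y"
    unfolding harmonic_vector_field_def
    by (intro conj_cong ex_cong1 ball_cong refl) (simp_all add: assms(1))
  then show ?thesis using assms(2) by simp
qed

text \<open>Needed because the Poisson extension is identified with \<open>pext\<close> only inside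
  the disc.\<close>

lemma lie_gD_20_cong:
  assumes "\<And>z. z \<in> disc \<Longrightarrow> X z = Y z"
  shows "lie_gD_20 X = lie_gD_20 Y"
proof
  fix z
  show "lie_gD_20 X z = lie_gD_20 Y z"
  proof (cases "z \<in> disc")
    case True
    have iff: "(X has_derivative L) (at z) \<longleftrightarrow> (Y has_derivative L) (at z)" for L
    proof
      assume "(X has_derivative L) (at z)"
      then show "(Y has_derivative L) (at z)"
        by (rule has_derivative_transform_within_open[OF _ open_ball True]) (simp add: assms)
    next
      assume "(Y has_derivative L) (at z)"
      then show "(X has_derivative L) (at z)"
        by (rule has_derivative_transform_within_open[OF _ open_ball True]) (simp add: assms)
    qed
    then have "frechet_derivative X (at z) = frechet_derivative Y (at z)"
      unfolding frechet_derivative_def by simp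
    then have "lie_gD X z = lie_gD Y z"
      unfolding lie_gD_def[abs_def] by (simp add: assms[OF True])
    then show ?thesis
      unfolding lie_gD_20_def lie_gD_tracefree_def by simp
  qed (simp add: lie_gD_20_def)
qed

section \<open>Moebius transformations of the circle\<close>

lemma mnum_eq_circle: "cmod w = 1 \<Longrightarrow> mnum p w = w * cnj (mden p w)"
proof -
  assume "cmod w = 1"
  then have "w * cnj w = 1"
    by (simp add: complex_norm_square[symmetric])
  have "w * cnj (mden p w) = snd p * (w * cnj w) + fst p * w"
    by (simp add: mden_def algebra_simps)
  then show ?thesis
    unfolding \<open>w * cnj w = 1\<close> by (simp add: mnum_def)
qed

lemma moebius_circle_norm:
  assumes "p \<in> SU11" "cmod w = 1"
  shows "cmod (mnum p w / mden p w) = 1"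
  using mden_nonzero[OF assms(1), of w] assms(2) by (simp add: mnum_eq_circle norm_divide norm_mult)

text \<open>The denominator is \<open>cnj a\<close> (1 + b w) with |b| < 1, so 1 + b w stays in the
  right half plane and has a logarithm. On the circle the numerator is w times the conjugate
  denominator, whence an explicit argument of the image; its increment over a period can be read
  off.\<close>

lemma moebius_circle_lift:
  assumes p: "p \<in> SU11"
  obtains \<sigma> where "\<And>t. cis (\<sigma> t) = mnum p (cis t) / mden p (cis t)"
    "\<And>t S. (\<sigma> has_vector_derivative 1 / (cmod (mden p (cis t)))\<^sup>2) (at t within S)"
    "\<sigma> (2 * pi) = \<sigma> 0 + 2 * pi"
proof -
  define a where "a = fst p"
  define b where "b = cnj (snd p) / cnj a"
  have a0: "a \<noteq> 0"
    using SU11_norm_less[OF p] norm_ge_zero[of "snd p"] unfolding a_def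
    by (metis norm_zero not_le)
  have b1: "cmod b < 1"
    using SU11_norm_less[OF p] a0 by (simp add: b_def norm_divide a_def)
  have ab: "(cmod a)\<^sup>2 * (1 - (cmod b)\<^sup>2) = 1"
    using p a0 unfolding SU11_iff b_def norm_divide power_divide right_diff_distrib a_def by simp
  have den: "mden p w = cnj a * (1 + b * w)" for w
    using a0 by (simp add: mden_def b_def a_def field_simps)
  define L where "L = (\<lambda>z. Ln (1 + b * exp (\<i> * z)))"
  have re: "0 < Re (1 + b * cis t)" for t
  proof -
    have "cmod (b * cis t) < 1" using b1 by (simp add: norm_mult)
    then show ?thesis using abs_Re_le_cmod[of "b * cis t"] by simp
  qed
  have ct: "exp (\<i> * of_real t) = cis t" for t
    by (simp add: cis_conv_exp)
  have np: "1 + b * cis t \<notin> \<real>\<^sub>\<le>\<^sub>0" for t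
    using re[of t] complex_nonpos_Reals_iff by force
  have nz: "1 + b * cis t \<noteq> 0" for t
    using re[of t] by (metis less_irrefl zero_complex.sel(1))
  define \<sigma> where "\<sigma> t = t + 2 * Arg a - 2 * Im (L (of_real t))" for t
  show ?thesis
  proof (rule that)
    show "cis (\<sigma> t) = mnum p (cis t) / mden p (cis t)" for t
    proof -
      have expL: "exp (L (of_real t)) = 1 + b * cis t"
        using nz[of t] by (simp add: L_def ct)
      have "cis (- 2 * Im z) = cnj (exp z) / exp z" for z
        by (simp add: cis_conv_exp exp_cnj exp_diff[symmetric] complex_eq_iff Re_exp Im_exp)
      from this[of "L (of_real t)"]
      have 1: "cis (- 2 * Im (L (of_real t))) = cnj (1 + b * cis t) / (1 + b * cis t)"
        unfolding expL .
      have "cis (Arg a) = a / of_real (cmod a)"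
        using a0 by (simp add: cis_Arg sgn_eq)
      then have "cis (Arg a) * cis (Arg a) = a * a / (of_real (cmod a) * of_real (cmod a))"
        by simp
      also have "of_real (cmod a) * of_real (cmod a) = a * cnj a"
        using complex_norm_square[of a] by (simp add: power2_eq_square)
      finally have 2: "cis (2 * Arg a) = a / cnj a"
        using a0 by (simp add: cis_mult)
      have "\<sigma> t = t + (2 * Arg a + - 2 * Im (L (of_real t)))" by (simp add: \<sigma>_def)
      then have "cis (\<sigma> t) = cis t * (a / cnj a * (cnj (1 + b * cis t) / (1 + b * cis t)))"
        using 1 2 by (metis cis_mult)
      also have "\<dots> = mnum p (cis t) / mden p (cis t)"
        by (simp add: mnum_eq_circle den)
      finally show ?thesis .
    qed
    show "\<sigma> (2 * pi) = \<sigma> 0 + 2 * pi"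
      by (simp add: \<sigma>_def L_def ct[of "2 * pi", simplified])
    show "(\<sigma> has_vector_derivative 1 / (cmod (mden p (cis t)))\<^sup>2) (at t within S)" for t S
    proof -
      define x where "x = b * cis t"
      have x1: "1 + x \<noteq> 0" using nz[of t] by (simp add: x_def)
      have x1': "1 + cnj x \<noteq> 0"
        using x1 complex_cnj_zero_iff[of "1 + x"] by simp
      have "(L has_field_derivative \<i> * x / (1 + x)) (at (of_real t))"
        unfolding L_def x_def using np[of t]
        by (auto intro!: derivative_eq_intros simp: ct divide_inverse)
      then have "((\<lambda>t. L (of_real t)) has_vector_derivative \<i> * x / (1 + x)) (at t within S)"
        by (rule has_vector_derivative_real_field)
      from bounded_linear.has_vector_derivative[OF bounded_linear_Im this]
      have "(\<sigma> has_vector_derivative 1 + 0 - 2 * Im (\<i> * x / (1 + x))) (at t within S)"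
        unfolding \<sigma>_def[abs_def]
        by (intro has_vector_derivative_diff has_vector_derivative_add has_vector_derivative_const
            has_vector_derivative_id has_vector_derivative_mult_right)
      moreover have "1 + 0 - 2 * Im (\<i> * x / (1 + x)) = 1 / (cmod (mden p (cis t)))\<^sup>2"
      proof -
        have n1: "(cmod (1 + x))\<^sup>2 \<noteq> 0" using x1 by simp
        have "\<i> * x / (1 + x) = \<i> * (x * cnj (1 + x)) / of_real ((cmod (1 + x))\<^sup>2)"
          using x1 x1' unfolding complex_norm_square by simp
        then have "Im (\<i> * x / (1 + x)) = Re (x * cnj (1 + x)) / (cmod (1 + x))\<^sup>2"
          by (simp only: Im_divide_of_real) simp
        moreover have "(cmod (1 + x))\<^sup>2 - 2 * Re (x * cnj (1 + x)) = 1 - (cmod x)\<^sup>2"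
          unfolding cmod_power2 by (simp add: power2_eq_square algebra_simps)
        ultimately have "1 + 0 - 2 * Im (\<i> * x / (1 + x)) = (1 - (cmod x)\<^sup>2) / (cmod (1 + x))\<^sup>2"
          using n1 by (simp add: field_simps)
        also have "cmod x = cmod b" by (simp add: x_def norm_mult)
        also have "(1 - (cmod b)\<^sup>2) / (cmod (1 + x))\<^sup>2
            = ((cmod a)\<^sup>2 * (1 - (cmod b)\<^sup>2)) / ((cmod a)\<^sup>2 * (cmod (1 + x))\<^sup>2)"
          using a0 by simp
        finally show ?thesis
          unfolding ab den x_def by (simp add: norm_mult power_mult_distrib)
      qed
      ultimately show ?thesis by simp
    qed
  qed
qed

text \<open>Substitution along the lifted angle, whose derivative is the given weight. The lift
  starts at an arbitrary angle, which is handled through an antiderivative and periodicity.\<close>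

lemma circle_mean_moebius:
  assumes p: "p \<in> SU11" and F: "continuous_on (sphere 0 1) F"
  shows "circle_mean (\<lambda>w. F (mnum p w / mden p w) / of_real ((cmod (mden p w))\<^sup>2)) = circle_mean F"
proof -
  obtain \<sigma> where \<sigma>: "\<And>t. cis (\<sigma> t) = mnum p (cis t) / mden p (cis t)"
    "\<And>t S. (\<sigma> has_vector_derivative 1 / (cmod (mden p (cis t)))\<^sup>2) (at t within S)"
    "\<sigma> (2 * pi) = \<sigma> 0 + 2 * pi"
    using moebius_circle_lift[OF p] by metis
  define G where "G t = F (cis t)" for t
  have G: "continuous_on S G" for S
    unfolding G_def by (rule continuous_on_compose2[OF F]) (auto intro!: continuous_intros)
  have "continuous_on {0..2 * pi} \<sigma>"
    using \<sigma>(2) by (intro continuous_on_vector_derivative) blast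
  then have "compact (\<sigma> ` {0..2 * pi})"
    by (intro compact_continuous_image) auto
  then obtain B where B: "\<And>t. t \<in> {0..2 * pi} \<Longrightarrow> \<bar>\<sigma> t\<bar> \<le> B"
    by (metis bounded_iff compact_imp_bounded image_eqI real_norm_def)
  have B0: "B \<ge> 0" using B[of 0] by simp
  \<comment> \<open>The interval contains 0, 2 pi, all values of \<sigma> on the parameter interval,
    and x + 2 pi whenever |x| \<le> B.\<close>
  define l u where "l = - B" and "u = B + 2 * pi"
  obtain \<Phi> where \<Phi>: "\<And>x. x \<in> {l..u} \<Longrightarrow> (\<Phi> has_vector_derivative G x) (at x within {l..u})"
    using antiderivative_continuous[OF G] by metis
  have sub: "{l..u - 2 * pi} \<subseteq> {l..u}" "(\<lambda>x. x + 2 * pi) ` {l..u - 2 * pi} \<subseteq> {l..u}"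
    by (auto intro: order_trans[of _ "u - 2 * pi"] order_trans[of _ "_ + 0"])
  \<comment> \<open>The integrand is 2 pi periodic, so its integral over a period does not depend on
    the starting point; 0 and \<sigma> 0 are then compared.\<close>
  have "\<exists>c. \<forall>x\<in>{l..u - 2 * pi}. \<Phi> (x + 2 * pi) - \<Phi> x = c"
  proof (rule has_vector_derivative_zero_constant)
    fix x assume x: "x \<in> {l..u - 2 * pi}"
    have 1: "(\<Phi> has_vector_derivative G x) (at x within {l..u - 2 * pi})"
      by (rule has_vector_derivative_within_subset[OF \<Phi> sub(1)]) (use x sub in blast)
    have s: "((\<lambda>x. x + 2 * pi) has_vector_derivative 1) (at x within {l..u - 2 * pi})"
      by (auto intro!: derivative_eq_intros simp: has_vector_derivative_def)
    have "(\<Phi> has_vector_derivative G (x + 2 * pi)) (at (x + 2 * pi) within (\<lambda>x. x + 2 * pi) ` {l..u - 2 * pi})"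
      by (rule has_vector_derivative_within_subset[OF \<Phi> sub(2)]) (use x sub in blast)
    from vector_diff_chain_within[OF s this]
    have "((\<lambda>x. \<Phi> (x + 2 * pi)) has_vector_derivative G (x + 2 * pi)) (at x within {l..u - 2 * pi})"
      by (simp add: o_def)
    have "cis (x + 2 * pi) = cis x"
      by (simp add: complex_eq_iff)
    with has_vector_derivative_diff[OF \<open>((\<lambda>x. \<Phi> (x + 2 * pi)) has_vector_derivative G (x + 2 * pi)) (at x within {l..u - 2 * pi})\<close> 1]
    show "((\<lambda>x. \<Phi> (x + 2 * pi) - \<Phi> x) has_vector_derivative 0) (at x within {l..u - 2 * pi})"
      by (simp add: G_def)
  qed auto
  then obtain c where c: "\<And>x. x \<in> {l..u - 2 * pi} \<Longrightarrow> \<Phi> (x + 2 * pi) - \<Phi> x = c"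
    by blast
  have "(G has_integral (\<Phi> (2 * pi) - \<Phi> 0)) {0..2 * pi}"
  proof (rule fundamental_theorem_of_calculus)
    show "(\<Phi> has_vector_derivative G x) (at x within {0..2 * pi})" if "x \<in> {0..2 * pi}" for x
      by (rule has_vector_derivative_within_subset[OF \<Phi>]) (use that B0 in \<open>auto simp: l_def u_def\<close>)
  qed simp
  moreover have "((\<lambda>t. (1 / (cmod (mden p (cis t)))\<^sup>2) *\<^sub>R G (\<sigma> t)) has_integral
      ((\<Phi> \<circ> \<sigma>) (2 * pi) - (\<Phi> \<circ> \<sigma>) 0)) {0..2 * pi}"
  proof (rule fundamental_theorem_of_calculus)
    fix t :: real assume t: "t \<in> {0..2 * pi}"
    have "(\<Phi> has_vector_derivative G (\<sigma> t)) (at (\<sigma> t) within \<sigma> ` {0..2 * pi})"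
    proof (rule has_vector_derivative_within_subset[OF \<Phi>])
      show "\<sigma> t \<in> {l..u}" "\<sigma> ` {0..2 * pi} \<subseteq> {l..u}"
        using B t pi_gt_zero by (force simp: l_def u_def abs_le_iff)+
    qed
    then show "((\<Phi> \<circ> \<sigma>) has_vector_derivative (1 / (cmod (mden p (cis t)))\<^sup>2) *\<^sub>R G (\<sigma> t)) (at t within {0..2 * pi})"
      by (rule vector_diff_chain_within[OF \<sigma>(2)])
  qed simp
  moreover have "\<sigma> 0 \<in> {l..u - 2 * pi}"
    using B[of 0] by (auto simp: l_def u_def abs_le_iff)
  from c[OF this] have "(\<Phi> \<circ> \<sigma>) (2 * pi) - (\<Phi> \<circ> \<sigma>) 0 = c"
    by (simp add: \<sigma>(3))
  moreover have "\<Phi> (2 * pi) - \<Phi> 0 = c"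
    using c[of 0] B0 by (simp add: l_def u_def)
  ultimately have "integral {0..2 * pi} (\<lambda>t. (1 / (cmod (mden p (cis t)))\<^sup>2) *\<^sub>R G (\<sigma> t)) = integral {0..2 * pi} G"
    using integral_unique by metis
  moreover have "(\<lambda>t. (1 / (cmod (mden p (cis t)))\<^sup>2) *\<^sub>R G (\<sigma> t))
      = (\<lambda>t. F (mnum p (cis t) / mden p (cis t)) / of_real ((cmod (mden p (cis t)))\<^sup>2))"
    by (rule ext) (simp add: G_def \<sigma>(1) scaleR_conv_of_real)
  ultimately show ?thesis
    unfolding circle_mean_def G_def by (simp only:)
qed

text \<open>Cauchy's theorem on the unit circle, where dw = i w dt accounts for the extra factor
  w.\<close>

lemma circle_mean_holomorphic:
  assumes f: "f holomorphic_on ball 0 r" and r: "1 < r"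
  shows "circle_mean (\<lambda>w. w * f w) = 0"
proof -
  have "(f has_contour_integral 0) (circlepath 0 1)"
    by (rule Cauchy_theorem_disc_simple[of f 0 r]) (use f r in auto)
  then have "(f has_contour_integral 0) (part_circlepath 0 1 0 (2 * pi))"
    by (simp add: circlepath_def)
  then have "((\<lambda>t. f (0 + of_real 1 * cis t) * of_real 1 * \<i> * cis t) has_integral 0) {0..2 * pi}"
    by (subst (asm) has_contour_integral_part_circlepath_iff) auto
  then have "((\<lambda>t. - \<i> * (f (cis t) * \<i> * cis t)) has_integral - \<i> * 0) {0..2 * pi}"
    by (intro has_integral_mult_right) simp
  then have "((\<lambda>t. cis t * f (cis t)) has_integral 0) {0..2 * pi}"
    by (simp add: mult_ac)
  then show ?thesis
    by (simp add: circle_mean_def integral_unique)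
qed

section \<open>Equivariance\<close>

lemma circle_mean_kfield:
  assumes z: "z \<in> disc"
  shows "circle_mean (\<lambda>w. cnj (kfield A B w * w) / (1 - z * cnj w) ^ 4) = 0"
proof -
  \<comment> \<open>A radius above 1 with |z| r < 1, so that the pole of the integrand stays
    outside.\<close>
  define r where "r = 2 / (1 + cmod z)"
  have r: "1 < r" "cmod z * r < 1"
    using z add_pos_nonneg[OF zero_less_one norm_ge_zero[of z]] by (auto simp: r_def field_simps)
  have "circle_mean (\<lambda>w. w * (kfield A B w / (1 - cnj z * w) ^ 4)) = 0"
  proof (rule circle_mean_holomorphic[OF _ r(1)])
    have "1 - cnj z * w \<noteq> 0" if "w \<in> ball 0 r" for w
    proof -
      have "cmod (cnj z * w) \<le> cmod z * r"
        using that by (auto simp: norm_mult intro!: mult_left_mono)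
      then show ?thesis using r(2) by (metis eq_iff_diff_eq_0 norm_one not_le)
    qed
    then show "(\<lambda>w. kfield A B w / (1 - cnj z * w) ^ 4) holomorphic_on ball 0 r"
      unfolding kfield_def by (intro holomorphic_intros) auto
  qed
  then have "circle_mean (\<lambda>w. cnj (w * (kfield A B w / (1 - cnj z * w) ^ 4))) = 0"
    by (simp only: circle_mean_cnj complex_cnj_zero)
  then show ?thesis
    by (simp add: mult_ac)
qed

text \<open>With D the denominator at w, the field contributes D / \<open>cnj D\<close>^3, the
  fourth power of 1 - g z \<open>cnj (g w)\<close> contributes \<open>cnj D\<close>^4, and the
  change of variables 1 / (D \<open>cnj D\<close>). These cancel, and the fourth power of the
  denominator at z remains, the inverse square of the derivative.\<close>

lemma moment_moebius:
  assumes p: "p \<in> SU11" and z: "z \<in> disc" and Y: "continuous_on (sphere 0 1) Y"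
    and eq: "\<And>w. cmod w = 1 \<Longrightarrow> Y (mnum p w / mden p w) * (mden p w)\<^sup>2 = Y w + kfield A B w"
  shows "moment (\<lambda>w. cnj (Y w * w)) 4 (moebius p z) * (deriv (moebius p) z)\<^sup>2 = moment (\<lambda>w. cnj (Y w * w)) 4 z"
proof -
  let ?Dz = "mden p z"
  have gz: "moebius p z = mnum p z / ?Dz" "moebius p z \<in> disc" "?Dz \<noteq> 0"
    using z moebius_disc[OF p z] mden_nonzero[OF p, of z] by (auto simp: moebius_apply)
  have cY: "continuous_on (sphere 0 1) (\<lambda>w. cnj (Y w * w))" using Y by (intro continuous_intros)
  have cK: "continuous_on (sphere 0 1) (\<lambda>w. cnj (kfield A B w * w))"
    unfolding kfield_def by (intro continuous_intros)
  define F where "F w = cnj (Y w * w) / (1 - moebius p z * cnj w) ^ 4" for w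
  have F: "continuous_on (sphere 0 1) F"
    unfolding F_def by (rule continuous_moment_integrand[OF cY gz(2)])
  have "moment (\<lambda>w. cnj (Y w * w)) 4 (moebius p z) = circle_mean F"
    by (simp only: moment_def F_def[abs_def])
  also have "\<dots> = circle_mean (\<lambda>w. F (mnum p w / mden p w) / of_real ((cmod (mden p w))\<^sup>2))"
    by (rule circle_mean_moebius[OF p F, symmetric])
  also have "\<dots> = circle_mean (\<lambda>w. ?Dz ^ 4 * (cnj (Y w * w) / (1 - z * cnj w) ^ 4 + cnj (kfield A B w * w) / (1 - z * cnj w) ^ 4))"
  proof (rule circle_mean_cong)
    fix w :: complex assume w: "cmod w = 1"
    define D where "D = mden p w"
    have D: "D \<noteq> 0" "cnj D \<noteq> 0" using mden_nonzero[OF p, of w] w by (auto simp: D_def)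
    have nz: "1 - z * cnj w \<noteq> 0" using one_minus_cnj_mult_nonzero(1)[OF w z] .
    define S where "S = Y w + kfield A B w"
    have Yg: "Y (mnum p w / D) = S / D\<^sup>2"
      using eq[OF w] D by (simp add: D_def S_def field_simps)
    have gw: "mnum p w / D = w * cnj D / D"
      by (simp add: mnum_eq_circle[OF w] D_def)
    have "1 - moebius p z * cnj (mnum p w / D) = (?Dz * cnj D - mnum p z * cnj (mnum p w)) / (?Dz * cnj D)"
      using gz D by (simp add: field_simps)
    also have "\<dots> = (1 - z * cnj w) / (?Dz * cnj D)"
      unfolding D_def mden_mnum_identity[OF p] ..
    finally have den: "1 - moebius p z * cnj (mnum p w / D) = (1 - z * cnj w) / (?Dz * cnj D)" .
    have DD: "complex_of_real ((cmod D)\<^sup>2) = D * cnj D"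
      by (rule complex_norm_square)
    have "F (mnum p w / D) / of_real ((cmod D)\<^sup>2)
        = cnj (S / D\<^sup>2 * (w * cnj D / D)) / ((1 - z * cnj w) / (?Dz * cnj D)) ^ 4 / (D * cnj D)"
      unfolding F_def den Yg DD gw[symmetric] ..
    also have "\<dots> = ?Dz ^ 4 * (cnj (S * w) / (1 - z * cnj w) ^ 4)"
    proof -
      have alg: "s / E\<^sup>2 * (v * D / E) / (N / (K * E)) ^ 4 / (D * E) = K ^ 4 * (s * v / N ^ 4)"
        if "E \<noteq> 0" "N \<noteq> 0" "K \<noteq> 0" for s v E N K :: complex
        using that D(1) by (simp add: power_divide power_mult_distrib) (simp add: field_simps eval_nat_numeral)
      show ?thesis
        using alg[OF D(2) nz gz(3), of "cnj S" "cnj w"] by simp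
    qed
    also have "cnj (S * w) / (1 - z * cnj w) ^ 4 = cnj (Y w * w) / (1 - z * cnj w) ^ 4 + cnj (kfield A B w * w) / (1 - z * cnj w) ^ 4"
      unfolding S_def by (simp add: algebra_simps add_divide_distrib)
    finally show "F (mnum p w / mden p w) / of_real ((cmod (mden p w))\<^sup>2) =
        ?Dz ^ 4 * (cnj (Y w * w) / (1 - z * cnj w) ^ 4 + cnj (kfield A B w * w) / (1 - z * cnj w) ^ 4)"
      by (simp only: D_def)
  qed
  also have "\<dots> = ?Dz ^ 4 * moment (\<lambda>w. cnj (Y w * w)) 4 z"
    unfolding circle_mean_mult_left moment_def
    by (subst circle_mean_add) (simp_all add: continuous_moment_integrand[OF cY z]
        continuous_moment_integrand[OF cK z] circle_mean_kfield[OF z] del: complex_cnj_mult)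
  finally show ?thesis
    unfolding deriv_moebius[OF p z] using gz(3) by (simp add: power_divide)
qed

section \<open>Passing to the boundary in the coboundary equation\<close>

text \<open>Compare with the radial projection of the moving point: the uniform rate handles the
  radial part and continuity of Y the angular part.\<close>

lemma boundary_values_tendsto:
  assumes bv: "boundary_values \<psi> Y" and cont: "continuous_on (sphere 0 1) Y"
    and \<zeta>: "(\<zeta> \<longlongrightarrow> \<omega>) F" "cmod \<omega> = 1" "eventually (\<lambda>x. \<zeta> x \<in> disc) F"
  shows "((\<lambda>x. \<psi> (\<zeta> x)) \<longlongrightarrow> Y \<omega>) F"
proof -
  obtain C where C: "\<And>w r. cmod w = 1 \<Longrightarrow> 0 \<le> r \<Longrightarrow> r < 1 \<Longrightarrow> cmod (\<psi> (of_real r * w) - Y w) \<le> C * sqrt (1 - r)"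
    using bv unfolding boundary_values_def by blast
  have n: "((\<lambda>x. cmod (\<zeta> x)) \<longlongrightarrow> 1) F"
    using tendsto_norm[OF \<zeta>(1)] \<zeta>(2) by simp
  have ev: "eventually (\<lambda>x. \<zeta> x \<noteq> 0) F"
    using tendsto_imp_eventually_ne[OF \<zeta>(1), of 0] \<zeta>(2) by force
  have "((\<lambda>x. \<zeta> x / of_real (cmod (\<zeta> x))) \<longlongrightarrow> \<omega> / of_real 1) F"
    by (intro tendsto_intros \<zeta>(1) n) simp
  then have u: "((\<lambda>x. \<zeta> x / of_real (cmod (\<zeta> x))) \<longlongrightarrow> \<omega>) F" by simp
  have "((\<lambda>x. Y (\<zeta> x / of_real (cmod (\<zeta> x)))) \<longlongrightarrow> Y \<omega>) F"
  proof (rule continuous_on_tendsto_compose[OF cont u])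
    show "\<forall>\<^sub>F x in F. \<zeta> x / of_real (cmod (\<zeta> x)) \<in> sphere 0 1"
      using ev by eventually_elim (simp add: norm_divide)
  qed (use \<zeta>(2) in simp)
  moreover have "((\<lambda>x. \<psi> (\<zeta> x) - Y (\<zeta> x / of_real (cmod (\<zeta> x)))) \<longlongrightarrow> 0) F"
  proof (rule Lim_null_comparison)
    show "\<forall>\<^sub>F x in F. norm (\<psi> (\<zeta> x) - Y (\<zeta> x / of_real (cmod (\<zeta> x)))) \<le> C * sqrt (1 - cmod (\<zeta> x))"
      using ev \<zeta>(3)
    proof eventually_elim
      case (elim x)
      then show ?case
        using C[of "\<zeta> x / of_real (cmod (\<zeta> x))" "cmod (\<zeta> x)"] by (simp add: norm_divide)
    qed
    have "((\<lambda>x. C * sqrt (1 - cmod (\<zeta> x))) \<longlongrightarrow> C * sqrt (1 - 1)) F"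
      by (intro tendsto_intros n)
    then show "((\<lambda>x. C * sqrt (1 - cmod (\<zeta> x))) \<longlongrightarrow> 0) F" by simp
  qed
  ultimately have "((\<lambda>x. (\<psi> (\<zeta> x) - Y (\<zeta> x / of_real (cmod (\<zeta> x)))) + Y (\<zeta> x / of_real (cmod (\<zeta> x)))) \<longlongrightarrow> 0 + Y \<omega>) F"
    by (intro tendsto_add)
  then show ?thesis by simp
qed

lemma radius_tendsto: "((\<lambda>r. of_real r * w) \<longlongrightarrow> w) (at_left (1::real))" for w :: complex
proof -
  have "((\<lambda>r. of_real r * w) \<longlongrightarrow> of_real 1 * w) (at_left (1::real))"
    by (intro tendsto_intros)
  then show ?thesis by simp
qed

lemma radius_in_disc:
  assumes "cmod w = 1"
  shows "eventually (\<lambda>r. of_real r * w \<in> disc) (at_left (1::real))"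
proof -
  have "eventually (\<lambda>r. r \<in> {0<..<1}) (at_left (1::real))"
    by (rule eventually_at_left_real) simp
  then show ?thesis
    by eventually_elim (use assms in \<open>simp add: norm_mult\<close>)
qed

lemma boundary_values_radial:
  assumes "boundary_values \<psi> Y" "continuous_on (sphere 0 1) Y" "cmod w = 1"
  shows "((\<lambda>r. \<psi> (of_real r * w)) \<longlongrightarrow> Y w) (at_left 1)"
  by (rule boundary_values_tendsto[OF assms(1,2) radius_tendsto assms(3) radius_in_disc[OF assms(3)]])

lemma kfield_radial: "((\<lambda>r. kfield A B (of_real r * w)) \<longlongrightarrow> kfield A B w) (at_left 1)"
  unfolding kfield_def by (intro tendsto_intros radius_tendsto)

text \<open>The equation is taken along a radius. Its Moebius image need not be a radius, which is
  why unrestricted limits are needed.\<close>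

lemma boundary_equivariance:
  assumes bv: "boundary_values \<psi> Y" and cont: "continuous_on (sphere 0 1) Y" and p: "p \<in> SU11"
    and eq: "\<And>z. z \<in> disc \<Longrightarrow> pull (moebius p) \<psi> z = \<psi> z + kfield A B z" and w: "cmod w = 1"
  shows "Y (mnum p w / mden p w) * (mden p w)\<^sup>2 = Y w + kfield A B w"
proof -
  let ?F = "at_left (1::real)"
  have num: "((\<lambda>r. mnum p (of_real r * w)) \<longlongrightarrow> mnum p w) ?F"
    and den: "((\<lambda>r. mden p (of_real r * w)) \<longlongrightarrow> mden p w) ?F"
    unfolding mnum_def mden_def by (intro tendsto_intros radius_tendsto)+
  have d0: "mden p w \<noteq> 0" using mden_nonzero[OF p, of w] w by simp
  have "((\<lambda>r. \<psi> (mnum p (of_real r * w) / mden p (of_real r * w))) \<longlongrightarrow> Y (mnum p w / mden p w)) ?F"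
  proof (rule boundary_values_tendsto[OF bv cont tendsto_divide[OF num den d0] moebius_circle_norm[OF p w]])
    show "\<forall>\<^sub>F r in ?F. mnum p (of_real r * w) / mden p (of_real r * w) \<in> disc"
      using radius_in_disc[OF w] by eventually_elim (metis moebius_apply moebius_disc p)
  qed
  then have 1: "((\<lambda>r. \<psi> (mnum p (of_real r * w) / mden p (of_real r * w)) * (mden p (of_real r * w))\<^sup>2)
      \<longlongrightarrow> Y (mnum p w / mden p w) * (mden p w)\<^sup>2) ?F"
    by (intro tendsto_intros den)
  have 2: "((\<lambda>r. \<psi> (of_real r * w) + kfield A B (of_real r * w)) \<longlongrightarrow> Y w + kfield A B w) ?F"
    by (intro tendsto_add boundary_values_radial[OF bv cont w] kfield_radial)
  have "\<forall>\<^sub>F r in ?F. \<psi> (of_real r * w) + kfield A B (of_real r * w)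
      = \<psi> (mnum p (of_real r * w) / mden p (of_real r * w)) * (mden p (of_real r * w))\<^sup>2"
    using radius_in_disc[OF w]
  proof eventually_elim
    case (elim r)
    then show ?case
      using eq[OF elim] by (simp only: pull_moebius[OF p elim] moebius_apply)
  qed
  from Lim_transform_eventually[OF 2 this] show ?thesis
    using tendsto_unique[OF _ 1] by simp
qed

section \<open>The homomorphism from cohomology to quadratic differentials\<close>

lemma Re_cnj_mult_eq_0_imp_tangent:
  assumes "cmod w = 1" "Re (cnj w * y) = 0"
  shows "y = of_real (Re (y / (\<i> * w))) * (\<i> * w)"
proof -
  have w0: "w \<noteq> 0" using assms(1) by auto
  have ww: "cnj w * w = 1" using cnj_eq_inverse[OF assms(1)] w0 by simp
  have "y / (\<i> * w) = - \<i> * (cnj w * y)"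
    using cnj_eq_inverse[OF assms(1)] w0 by (simp add: divide_inverse mult.commute)
  then have "of_real (Re (y / (\<i> * w))) = - \<i> * (cnj w * y)"
    using assms(2) by (simp add: complex_eq_iff)
  then have "of_real (Re (y / (\<i> * w))) * (\<i> * w) = (cnj w * w) * y" by (simp add: mult_ac)
  then show ?thesis using ww by simp
qed

context disc_group
begin

definition boundary_field :: "((complex \<Rightarrow> complex) \<Rightarrow> complex \<Rightarrow> complex) \<Rightarrow> complex \<Rightarrow> complex" where
  "boundary_field c = (SOME Y. (\<forall>w. cmod w = 1 \<longrightarrow> Re (cnj w * Y w) = 0) \<and>
     (\<forall>\<psi>. continuous_on disc \<psi> \<and> c = coboundary \<Gamma> \<psi> \<longrightarrow> boundary_values \<psi> Y))"

lemma boundary_field: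
  assumes c: "c \<in> carrier (cocycles \<Gamma>)"
  shows "tangent_field (boundary_field c)"
    and "\<And>\<psi>. continuous_on disc \<psi> \<Longrightarrow> c = coboundary \<Gamma> \<psi> \<Longrightarrow> boundary_values \<psi> (boundary_field c)"
proof -
  define good where "good Y \<longleftrightarrow> (\<forall>w. cmod w = 1 \<longrightarrow> Re (cnj w * Y w) = 0) \<and>
     (\<forall>\<psi>. continuous_on disc \<psi> \<and> c = coboundary \<Gamma> \<psi> \<longrightarrow> boundary_values \<psi> Y)" for Y
  have "\<exists>Y. good Y"
  proof (rule boundary_field_exists[OF c])
    fix Y assume "\<And>w. cmod w = 1 \<Longrightarrow> Re (cnj w * Y w) = 0"
      "\<And>\<psi>. continuous_on disc \<psi> \<Longrightarrow> c = coboundary \<Gamma> \<psi> \<Longrightarrow>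
       \<exists>C. \<forall>w r. cmod w = 1 \<and> 0 \<le> r \<and> r < 1 \<longrightarrow> cmod (\<psi> (of_real r * w) - Y w) \<le> C * sqrt (1 - r)"
    then have "good Y" unfolding good_def boundary_values_def by simp
    then show "\<exists>Y. good Y" by blast
  qed
  then have g: "good (boundary_field c)"
    unfolding boundary_field_def good_def[symmetric] by (rule someI_ex)
  then show bv: "\<And>\<psi>. continuous_on disc \<psi> \<Longrightarrow> c = coboundary \<Gamma> \<psi> \<Longrightarrow> boundary_values \<psi> (boundary_field c)"
    unfolding good_def by blast
  have "continuous_on disc (averaged c)"
    by (rule smooth_on_disc_continuous[OF smooth_averaged[OF c]])
  then have "continuous_on (sphere 0 1) (boundary_field c)"
    using bv coboundary_averaged[OF c] boundary_values_continuous by blast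
  then show "tangent_field (boundary_field c)"
    using g unfolding good_def tangent_field_def by blast
qed

lemma boundary_field_continuous: "c \<in> carrier (cocycles \<Gamma>) \<Longrightarrow> continuous_on (sphere 0 1) (boundary_field c)"
  using boundary_field(1) by (simp add: tangent_field_def)

lemma boundary_field_radial:
  assumes "c \<in> carrier (cocycles \<Gamma>)" "continuous_on disc \<psi>" "c = coboundary \<Gamma> \<psi>" "cmod w = 1"
  shows "((\<lambda>r. \<psi> (of_real r * w)) \<longlongrightarrow> boundary_field c w) (at_left 1)"
  using boundary_values_radial[OF boundary_field(2)[OF assms(1-3)] boundary_field_continuous[OF assms(1)] assms(4)] .

text \<open>The chosen field is determined on the circle by the radial limits of any one continuous
  primitive. Additivity, scaling and the value on coboundaries follow by exhibiting suitable
  primitives.\<close>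

lemma boundary_field_eqI:
  assumes "c \<in> carrier (cocycles \<Gamma>)" "continuous_on disc \<psi>" "c = coboundary \<Gamma> \<psi>" "cmod w = 1"
    and "((\<lambda>r. \<psi> (of_real r * w)) \<longlongrightarrow> y) (at_left 1)"
  shows "boundary_field c w = y"
  using tendsto_unique[OF _ boundary_field_radial[OF assms(1-4)] assms(5)] by simp

definition quad_diff :: "((complex \<Rightarrow> complex) \<Rightarrow> complex \<Rightarrow> complex) \<Rightarrow> complex \<Rightarrow> complex" where
  "quad_diff c z = (if z \<in> disc then 24 * moment (\<lambda>w. cnj (boundary_field c w * w)) 4 z else 0)"

text \<open>All conclusions are transferred from the continuous field
  \<open>boundary_field c\<close>, with which the extension agrees almost everywhere. In particular
  they do not depend on the primitive.\<close>

lemma poisson_extension_boundary: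
  assumes c: "c \<in> carrier (cocycles \<Gamma>)" and \<psi>: "smooth_on disc \<psi>" "c = coboundary \<Gamma> \<psi>"
    and ext: "has_L2_extension \<psi> \<psi>'"
  shows "tangential \<psi>'" "harmonic_vector_field disc (poisson_extension \<psi>')"
    "lie_gD_20 (poisson_extension \<psi>') = quad_diff c"
proof -
  note cont = smooth_on_disc_continuous[OF \<psi>(1)]
  let ?Y = "boundary_field c"
  have tan: "tangent_field ?Y" by (rule boundary_field(1)[OF c])
  have cY: "continuous_on (sphere 0 1) ?Y" by (rule boundary_field_continuous[OF c])
  have ae: "AE w in circle_measure. \<psi>' w = ?Y w"
    by (rule L2_extension_AE_unique[OF boundary_field(2)[OF c cont \<psi>(2)] ext])
  have "AE w in circle_measure. \<psi>' w = of_real (Re (?Y w / (\<i> * w))) * (\<i> * w)"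
    using ae AE_space
  proof eventually_elim
    case (elim w)
    then show ?case
      using Re_cnj_mult_eq_0_imp_tangent[of w "?Y w"] tan
      by (simp only: tangent_field_def space_circle_measure mem_sphere_0)
  qed
  then show "tangential \<psi>'"
    unfolding tangential_def by (intro exI[of _ "\<lambda>w. Re (?Y w / (\<i> * w))"])
  have eq: "poisson_extension \<psi>' z = pext ?Y z" if "z \<in> disc" for z
    using ext by (intro poisson_extension_pext[OF tan that _ ae]) (simp add: has_L2_extension_def L2_circle_def)
  show "harmonic_vector_field disc (poisson_extension \<psi>')"
    by (rule harmonic_vector_field_cong[OF _ harmonic_pext[OF cY]]) (simp add: eq)
  have "lie_gD_20 (poisson_extension \<psi>') = lie_gD_20 (pext ?Y)"
    by (rule lie_gD_20_cong) (rule eq)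
  also have "\<dots> = quad_diff c"
  proof
    show "lie_gD_20 (pext ?Y) z = quad_diff c z" for z
      using lie_gD_20_pext[OF cY, of z] unfolding quad_diff_def by (simp add: lie_gD_20_def)
  qed
  finally show "lie_gD_20 (poisson_extension \<psi>') = quad_diff c" .
qed

section \<open>The groups of cocycles and coboundaries\<close>

lemma cocycle_mult: "c \<otimes>\<^bsub>cocycles \<Gamma>\<^esub> d = (\<lambda>\<gamma> z. c \<gamma> z + d \<gamma> z)"
  by (simp add: cocycles_def)

lemma cocycle_add_mem:
  assumes "c \<in> carrier (cocycles \<Gamma>)" "d \<in> carrier (cocycles \<Gamma>)"
  shows "(\<lambda>\<gamma> z. c \<gamma> z + d \<gamma> z) \<in> carrier (cocycles \<Gamma>)"
  using assms unfolding cocycles_def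
  by (auto simp: killing_add pull_def fun_eq_iff add_divide_distrib)

lemma cocycle_scale_mem:
  assumes "c \<in> carrier (cocycles \<Gamma>)"
  shows "(\<lambda>\<gamma> z. of_real r * c \<gamma> z) \<in> carrier (cocycles \<Gamma>)"
  using assms unfolding cocycles_def
  by (auto simp: killing_scale pull_def fun_eq_iff distrib_left)

lemma comm_group_cocycles: "comm_group (cocycles \<Gamma>)"
proof (rule comm_groupI)
  fix x y z assume "x \<in> carrier (cocycles \<Gamma>)" "y \<in> carrier (cocycles \<Gamma>)" "z \<in> carrier (cocycles \<Gamma>)"
  then show "x \<otimes>\<^bsub>cocycles \<Gamma>\<^esub> y \<in> carrier (cocycles \<Gamma>)"
    unfolding cocycle_mult by (intro cocycle_add_mem)
  show "x \<otimes>\<^bsub>cocycles \<Gamma>\<^esub> y \<otimes>\<^bsub>cocycles \<Gamma>\<^esub> z = x \<otimes>\<^bsub>cocycles \<Gamma>\<^esub> (y \<otimes>\<^bsub>cocycles \<Gamma>\<^esub> z)"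
    unfolding cocycle_mult by (simp add: add.assoc)
next
  show "\<one>\<^bsub>cocycles \<Gamma>\<^esub> \<in> carrier (cocycles \<Gamma>)"
    unfolding cocycles_def by (simp add: killing_zero pull_def fun_eq_iff)
next
  fix x y show "x \<otimes>\<^bsub>cocycles \<Gamma>\<^esub> y = y \<otimes>\<^bsub>cocycles \<Gamma>\<^esub> x"
    unfolding cocycle_mult by (simp add: add.commute)
next
  fix x show "\<one>\<^bsub>cocycles \<Gamma>\<^esub> \<otimes>\<^bsub>cocycles \<Gamma>\<^esub> x = x"
    unfolding cocycle_mult by (simp add: cocycles_def)
next
  fix x assume "x \<in> carrier (cocycles \<Gamma>)"
  then have "(\<lambda>\<gamma> z. of_real (- 1) * x \<gamma> z) \<in> carrier (cocycles \<Gamma>)"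
    by (rule cocycle_scale_mem)
  moreover have "(\<lambda>\<gamma> z. of_real (- 1) * x \<gamma> z) \<otimes>\<^bsub>cocycles \<Gamma>\<^esub> x = \<one>\<^bsub>cocycles \<Gamma>\<^esub>"
    unfolding cocycle_mult by (simp add: cocycles_def)
  ultimately show "\<exists>y\<in>carrier (cocycles \<Gamma>). y \<otimes>\<^bsub>cocycles \<Gamma>\<^esub> x = \<one>\<^bsub>cocycles \<Gamma>\<^esub>"
    by blast
qed

lemma coboundary_killing_mem:
  assumes X: "X \<in> killing"
  shows "coboundary \<Gamma> X \<in> carrier (cocycles \<Gamma>)"
proof -
  have out: "X z = 0" if "z \<notin> disc" for z
    using X that unfolding killing_def by blast
  \<comment> \<open>Valid outside the disc too, where both sides vanish. The scalar form of the
    minus sign fits \<open>killing_scale\<close>.\<close>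
  have eq: "coboundary \<Gamma> X \<gamma> = (\<lambda>z. pull \<gamma> X z + of_real (- 1) * X z)" if "\<gamma> \<in> \<Gamma>" for \<gamma>
    using that out by (auto simp: coboundary_def pull_def fun_eq_iff)
  have "coboundary \<Gamma> X \<gamma> \<in> killing" if "\<gamma> \<in> \<Gamma>" for \<gamma>
    unfolding eq[OF that] using elem[OF that] X by (auto intro!: killing_add killing_scale pull_killing simp del: of_real_minus of_real_1)
  moreover have "coboundary \<Gamma> X \<gamma> = (\<lambda>z. 0)" if "\<gamma> \<notin> \<Gamma>" for \<gamma>
    using that by (simp add: coboundary_def fun_eq_iff)
  moreover have "coboundary \<Gamma> X (g \<otimes>\<^bsub>PSU11\<^esub> h) = (\<lambda>z. pull h (coboundary \<Gamma> X g) z + coboundary \<Gamma> X h z)"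
    if gh: "g \<in> \<Gamma>" "h \<in> \<Gamma>" for g h
  proof -
    obtain p q where pq: "p \<in> SU11" "g = moebius p" "q \<in> SU11" "h = moebius q"
      using elem gh by metis
    have m: "g \<otimes>\<^bsub>PSU11\<^esub> h = moebius (su_mult p q)"
      using pq by (simp add: mult_PSU11)
    then have mG: "g \<otimes>\<^bsub>PSU11\<^esub> h \<in> \<Gamma>"
      using mult_mem pq gh by metis
    have "pull (g \<otimes>\<^bsub>PSU11\<^esub> h) X z = pull h (pull g X) z" for z
      unfolding m unfolding pq(2,4) by (rule pull_su_mult[OF pq(1,3)])
    then show ?thesis
      unfolding eq[OF mG] eq[OF gh(1)] eq[OF gh(2)]
      by (auto simp: fun_eq_iff pull_def diff_divide_distrib)
  qed
  ultimately show ?thesis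
    unfolding cocycles_def by simp
qed

lemma subgroup_coboundaries: "subgroup (coboundaries \<Gamma>) (cocycles \<Gamma>)"
proof -
  interpret comm_group "cocycles \<Gamma>" by (rule comm_group_cocycles)
  show ?thesis
  proof (rule subgroupI)
    show "coboundaries \<Gamma> \<subseteq> carrier (cocycles \<Gamma>)"
      unfolding coboundaries_def using coboundary_killing_mem by blast
    show "coboundaries \<Gamma> \<noteq> {}"
      unfolding coboundaries_def using killing_zero by blast
    fix a b assume a: "a \<in> coboundaries \<Gamma>" and b: "b \<in> coboundaries \<Gamma>"
    obtain X Y where X: "X \<in> killing" "a = coboundary \<Gamma> X" and Y: "Y \<in> killing" "b = coboundary \<Gamma> Y"
      using a b unfolding coboundaries_def by blast
    have "a \<otimes>\<^bsub>cocycles \<Gamma>\<^esub> b = coboundary \<Gamma> (\<lambda>z. X z + Y z)"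
      unfolding cocycle_mult X(2) Y(2) by (auto simp: fun_eq_iff coboundary_def pull_def add_divide_distrib)
    then show "a \<otimes>\<^bsub>cocycles \<Gamma>\<^esub> b \<in> coboundaries \<Gamma>"
      unfolding coboundaries_def using killing_add[OF X(1) Y(1)] by blast
    have "coboundary \<Gamma> (\<lambda>z. of_real (- 1) * X z) \<otimes>\<^bsub>cocycles \<Gamma>\<^esub> a = \<one>\<^bsub>cocycles \<Gamma>\<^esub>"
      unfolding cocycle_mult X(2) by (auto simp: fun_eq_iff coboundary_def pull_def cocycles_def)
    then have "inv\<^bsub>cocycles \<Gamma>\<^esub> a = coboundary \<Gamma> (\<lambda>z. of_real (- 1) * X z)"
      using coboundary_killing_mem[OF X(1)] coboundary_killing_mem[OF killing_scale[OF X(1), of "- 1"]] X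
      by (intro inv_equality) auto
    then show "inv\<^bsub>cocycles \<Gamma>\<^esub> a \<in> coboundaries \<Gamma>"
      unfolding coboundaries_def using killing_scale[OF X(1)] by blast
  qed
qed

section \<open>Linearity and invariance of the quadratic differential\<close>

lemma quad_diff_eqI:
  assumes "\<And>w. cmod w = 1 \<Longrightarrow> boundary_field c w = Y w"
  shows "quad_diff c z = (if z \<in> disc then 24 * moment (\<lambda>w. cnj (Y w * w)) 4 z else 0)"
proof -
  have "moment (\<lambda>w. cnj (boundary_field c w * w)) 4 z = moment (\<lambda>w. cnj (Y w * w)) 4 z"
    unfolding moment_def by (rule circle_mean_cong) (simp only: assms)
  then show ?thesis by (simp only: quad_diff_def)
qed

lemma continuous_averaged:
  "c \<in> carrier (cocycles \<Gamma>) \<Longrightarrow> continuous_on disc (averaged c)"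
  by (rule smooth_on_disc_continuous[OF smooth_averaged])

lemma quad_diff_add:
  assumes c: "c \<in> carrier (cocycles \<Gamma>)" and d: "d \<in> carrier (cocycles \<Gamma>)"
  shows "quad_diff (\<lambda>\<gamma> z. c \<gamma> z + d \<gamma> z) = (\<lambda>z. quad_diff c z + quad_diff d z)"
proof -
  let ?s = "\<lambda>\<gamma> z. c \<gamma> z + d \<gamma> z" and ?\<psi> = "\<lambda>z. averaged c z + averaged d z"
  have s: "?s \<in> carrier (cocycles \<Gamma>)" by (rule cocycle_add_mem[OF c d])
  have cob: "?s = coboundary \<Gamma> ?\<psi>"
    unfolding coboundary_iff[OF s]
  proof (intro ballI)
    fix g z assume g: "g \<in> \<Gamma>" and z: "z \<in> disc"
    have "pull g (averaged c) z = averaged c z + c g z" "pull g (averaged d) z = averaged d z + d g z"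
      using coboundary_averaged[OF c] coboundary_averaged[OF d] g z
      unfolding coboundary_iff[OF c] coboundary_iff[OF d] by auto
    then show "pull g ?\<psi> z = ?\<psi> z + ?s g z"
      using z by (simp add: pull_def add_divide_distrib)
  qed
  have Y: "boundary_field ?s w = boundary_field c w + boundary_field d w" if w: "cmod w = 1" for w
    by (rule boundary_field_eqI[OF s _ cob w]) (intro continuous_on_add tendsto_add continuous_averaged c d
        boundary_field_radial coboundary_averaged w)+
  have cc: "continuous_on (sphere 0 1) (\<lambda>w. cnj (boundary_field c w * w))"
    "continuous_on (sphere 0 1) (\<lambda>w. cnj (boundary_field d w * w))"
    by (intro continuous_intros boundary_field_continuous c d)+
  have mom: "moment (\<lambda>w. cnj ((boundary_field c w + boundary_field d w) * w)) 4 z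
      = moment (\<lambda>w. cnj (boundary_field c w * w)) 4 z + moment (\<lambda>w. cnj (boundary_field d w * w)) 4 z" if z: "z \<in> disc" for z
    unfolding moment_def circle_mean_add[OF continuous_moment_integrand[OF cc(1) z] continuous_moment_integrand[OF cc(2) z], symmetric]
    by (rule circle_mean_cong) (simp add: algebra_simps add_divide_distrib)
  show ?thesis
  proof
    fix z
    have "quad_diff ?s z = (if z \<in> disc then 24 * moment (\<lambda>w. cnj ((boundary_field c w + boundary_field d w) * w)) 4 z else 0)"
      by (rule quad_diff_eqI) (rule Y)
    then show "quad_diff ?s z = quad_diff c z + quad_diff d z"
      using mom[of z] by (simp add: quad_diff_def distrib_left del: complex_cnj_mult)
  qed
qed

lemma quad_diff_scale:
  assumes c: "c \<in> carrier (cocycles \<Gamma>)"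
  shows "quad_diff (\<lambda>\<gamma> z. of_real r * c \<gamma> z) = (\<lambda>z. of_real r * quad_diff c z)"
proof -
  let ?s = "\<lambda>\<gamma> z. of_real r * c \<gamma> z" and ?\<psi> = "\<lambda>z. of_real r * averaged c z"
  have s: "?s \<in> carrier (cocycles \<Gamma>)" by (rule cocycle_scale_mem[OF c])
  have cob: "?s = coboundary \<Gamma> ?\<psi>"
    unfolding coboundary_iff[OF s]
  proof (intro ballI)
    fix g z assume g: "g \<in> \<Gamma>" and z: "z \<in> disc"
    have "pull g (averaged c) z = averaged c z + c g z"
      using coboundary_averaged[OF c] g z unfolding coboundary_iff[OF c] by auto
    then have "of_real r * pull g (averaged c) z = of_real r * averaged c z + of_real r * c g z"
      by (simp add: distrib_left)
    then show "pull g ?\<psi> z = ?\<psi> z + ?s g z"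
      using z by (simp add: pull_def)
  qed
  have Y: "boundary_field ?s w = of_real r * boundary_field c w" if w: "cmod w = 1" for w
    by (rule boundary_field_eqI[OF s _ cob w]) (intro continuous_on_mult_left tendsto_mult_left continuous_averaged c
        boundary_field_radial coboundary_averaged w)+
  have mom: "moment (\<lambda>w. cnj (of_real r * boundary_field c w * w)) 4 z
      = of_real r * moment (\<lambda>w. cnj (boundary_field c w * w)) 4 z" for z
    unfolding moment_def circle_mean_mult_left[symmetric]
    by (rule circle_mean_cong) simp
  show ?thesis
  proof
    fix z
    have "quad_diff ?s z = (if z \<in> disc then 24 * moment (\<lambda>w. cnj (of_real r * boundary_field c w * w)) 4 z else 0)"
      by (rule quad_diff_eqI) (rule Y)
    then show "quad_diff ?s z = of_real r * quad_diff c z"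
      using mom[of z] by (simp add: quad_diff_def del: complex_cnj_mult)
  qed
qed

text \<open>The Killing field is its own primitive, and its boundary values are a quadratic
  polynomial whose fourth moment vanishes by Cauchy's theorem.\<close>

lemma quad_diff_coboundary:
  assumes X: "X \<in> killing"
  shows "quad_diff (coboundary \<Gamma> X) = (\<lambda>z. 0)"
proof -
  obtain A B where AB: "X = kfield_disc A B"
    using X unfolding killing_iff by blast
  have cX: "continuous_on disc X"
    using X by (intro smooth_on_disc_continuous) (simp add: killing_def)
  have Y: "boundary_field (coboundary \<Gamma> X) w = kfield A B w" if w: "cmod w = 1" for w
  proof (rule boundary_field_eqI[OF coboundary_killing_mem[OF X] cX refl w])
    show "((\<lambda>r. X (of_real r * w)) \<longlongrightarrow> kfield A B w) (at_left 1)"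
    proof (rule Lim_transform_eventually[OF kfield_radial])
      show "\<forall>\<^sub>F r in at_left 1. kfield A B (of_real r * w) = X (of_real r * w)"
        using radius_in_disc[OF w] by eventually_elim (simp add: AB kfield_disc_def)
    qed
  qed
  show ?thesis
  proof
    fix z
    have "quad_diff (coboundary \<Gamma> X) z = (if z \<in> disc then 24 * moment (\<lambda>w. cnj (kfield A B w * w)) 4 z else 0)"
      by (rule quad_diff_eqI) (rule Y)
    then show "quad_diff (coboundary \<Gamma> X) z = 0"
      using circle_mean_kfield[of z A B] by (simp add: moment_def del: complex_cnj_mult)
  qed
qed

lemma quad_diff_HQD:
  assumes c: "c \<in> carrier (cocycles \<Gamma>)"
  shows "quad_diff c \<in> carrier (HQD \<Gamma>)"
proof -
  let ?Y = "boundary_field c"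
  have cY: "continuous_on (sphere 0 1) ?Y" by (rule boundary_field_continuous[OF c])
  have "continuous_on (sphere 0 1) (\<lambda>w. cnj (?Y w * w))" by (intro continuous_intros cY)
  then have "(\<lambda>z. 24 * moment (\<lambda>w. cnj (?Y w * w)) 4 z) holomorphic_on disc"
    by (intro holomorphic_intros moment_holomorphic)
  then have "quad_diff c holomorphic_on disc"
    by (rule holomorphic_transform) (simp only: quad_diff_def if_True)
  moreover have "quad_diff c z = 0" if "z \<notin> disc" for z
    using that by (simp only: quad_diff_def if_False)
  moreover have "quad_diff c (\<gamma> z) * (deriv \<gamma> z)\<^sup>2 = quad_diff c z" if \<gamma>: "\<gamma> \<in> \<Gamma>" and z: "z \<in> disc" for \<gamma> z
  proof -
    obtain p where p: "p \<in> SU11" "\<gamma> = moebius p" using elem[OF \<gamma>] by blast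
    obtain A B where AB: "c \<gamma> = kfield_disc A B"
      using cocycle_killing[OF c \<gamma>] unfolding killing_iff by blast
    have e: "pull (moebius p) (averaged c) z = averaged c z + kfield A B z" if "z \<in> disc" for z
      using coboundary_averaged[OF c] \<gamma> that AB unfolding coboundary_iff[OF c] p(2) by (auto simp: kfield_disc_def)
    have "moment (\<lambda>w. cnj (?Y w * w)) 4 (moebius p z) * (deriv (moebius p) z)\<^sup>2 = moment (\<lambda>w. cnj (?Y w * w)) 4 z"
    proof (rule moment_moebius[OF p(1) z cY])
      show "?Y (mnum p w / mden p w) * (mden p w)\<^sup>2 = ?Y w + kfield A B w" if "cmod w = 1" for w
        by (rule boundary_equivariance[OF boundary_field(2)[OF c continuous_averaged[OF c] coboundary_averaged[OF c]] cY p(1) e that])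
    qed
    then show ?thesis
      using z moebius_disc[OF p(1) z] unfolding quad_diff_def p(2) by (simp only: if_True mult.assoc)
  qed
  ultimately show ?thesis
    unfolding HQD_def by simp
qed

section \<open>Descent to cohomology classes\<close>

definition class_map :: "((complex \<Rightarrow> complex) \<Rightarrow> complex \<Rightarrow> complex) set \<Rightarrow> complex \<Rightarrow> complex" where
  "class_map C = quad_diff (SOME c. c \<in> C)"

text \<open>Two representatives differ by the coboundary of a Killing field, to which
  \<open>quad_diff\<close> assigns 0, so the arbitrary choice in \<open>class_map\<close> is
  harmless.\<close>

lemma class_map_H1_class:
  assumes c: "c \<in> carrier (cocycles \<Gamma>)"
  shows "class_map (H1_class \<Gamma> c) = quad_diff c"
proof -
  have "quad_diff d = quad_diff c" if d: "d \<in> H1_class \<Gamma> c" for d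
  proof -
    obtain X where X: "X \<in> killing" "d = (\<lambda>\<gamma> z. coboundary \<Gamma> X \<gamma> z + c \<gamma> z)"
      using d unfolding H1_class_def r_coset_def coboundaries_def cocycle_mult by blast
    show ?thesis
      unfolding X(2) quad_diff_add[OF coboundary_killing_mem[OF X(1)] c] quad_diff_coboundary[OF X(1)] by simp
  qed
  moreover have "c \<in> H1_class \<Gamma> c"
    unfolding H1_class_def
    by (rule group.rcos_self[OF comm_group.axioms(2)[OF comm_group_cocycles] c subgroup_coboundaries])
  ultimately show ?thesis
    unfolding class_map_def by (metis someI)
qed

lemma class_map_hom: "class_map \<in> H1_HQD_homs \<Gamma>"
proof -
  interpret comm_group "cocycles \<Gamma>" by (rule comm_group_cocycles)
  interpret normal "coboundaries \<Gamma>" "cocycles \<Gamma>"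
    by (rule subgroup_imp_normal[OF subgroup_coboundaries])
  have cls: "\<exists>c\<in>carrier (cocycles \<Gamma>). C = H1_class \<Gamma> c" if "C \<in> carrier (H1 \<Gamma>)" for C
    using that unfolding H1_def FactGroup_def RCOSETS_def H1_class_def by auto
  have "class_map \<in> hom (H1 \<Gamma>) (HQD \<Gamma>)"
  proof (rule homI)
    fix C assume "C \<in> carrier (H1 \<Gamma>)"
    then obtain c where c: "c \<in> carrier (cocycles \<Gamma>)" "C = H1_class \<Gamma> c" using cls by blast
    then show "class_map C \<in> carrier (HQD \<Gamma>)"
      by (simp only: class_map_H1_class quad_diff_HQD)
    fix D assume "D \<in> carrier (H1 \<Gamma>)"
    then obtain d where d: "d \<in> carrier (cocycles \<Gamma>)" "D = H1_class \<Gamma> d" using cls by blast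
    have "C \<otimes>\<^bsub>H1 \<Gamma>\<^esub> D = H1_class \<Gamma> (\<lambda>\<gamma> z. c \<gamma> z + d \<gamma> z)"
      using rcos_sum[OF c(1) d(1)] unfolding H1_def FactGroup_def c(2) d(2) H1_class_def cocycle_mult by simp
    then show "class_map (C \<otimes>\<^bsub>H1 \<Gamma>\<^esub> D) = class_map C \<otimes>\<^bsub>HQD \<Gamma>\<^esub> class_map D"
      by (simp only: class_map_H1_class c d cocycle_add_mem quad_diff_add) (simp add: HQD_def)
  qed
  moreover have "class_map (H1_class \<Gamma> (\<lambda>\<gamma> z. of_real r * c \<gamma> z)) = (\<lambda>z. of_real r * class_map (H1_class \<Gamma> c) z)"
    if c: "c \<in> carrier (cocycles \<Gamma>)" for r c
    by (simp only: class_map_H1_class[OF c] class_map_H1_class[OF cocycle_scale_mem[OF c]] quad_diff_scale[OF c])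
  ultimately show ?thesis
    unfolding H1_HQD_homs_def by blast
qed

end

theorem theorem5:
  fixes \<Gamma> :: "(complex \<Rightarrow> complex) set"
  assumes "subgroup \<Gamma> PSU11"
    and "discrete_in_PSU11 \<Gamma>"
    and "cocompact_in_PSU11 \<Gamma>"
  shows "(\<forall>c\<in>carrier (cocycles \<Gamma>). \<exists>\<psi>. smooth_on disc \<psi> \<and> c = coboundary \<Gamma> \<psi>) \<and>
    (\<forall>c\<in>carrier (cocycles \<Gamma>). \<forall>\<psi>. smooth_on disc \<psi> \<and> c = coboundary \<Gamma> \<psi> \<longrightarrow>
       (\<exists>\<psi>'. has_L2_extension \<psi> \<psi>') \<and>
       (\<forall>\<psi>'. has_L2_extension \<psi> \<psi>' \<longrightarrow> tangential \<psi>')) \<and>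
    (\<exists>\<Psi>\<in>H1_HQD_homs \<Gamma>.
       \<forall>c\<in>carrier (cocycles \<Gamma>). \<forall>\<psi> \<psi>'.
         smooth_on disc \<psi> \<and> c = coboundary \<Gamma> \<psi> \<and> has_L2_extension \<psi> \<psi>' \<longrightarrow>
           harmonic_vector_field disc (poisson_extension \<psi>') \<and>
           \<Psi> (H1_class \<Gamma> c) = lie_gD_20 (poisson_extension \<psi>'))"
proof -
  obtain R where "disc_group \<Gamma> R"
    using disc_groupI[OF assms] by blast
  then interpret disc_group \<Gamma> R .
  show ?thesis
  proof (intro conjI ballI allI impI bexI[of _ class_map] class_map_hom)
    fix c assume c: "c \<in> carrier (cocycles \<Gamma>)"
    show "\<exists>\<psi>. smooth_on disc \<psi> \<and> c = coboundary \<Gamma> \<psi>"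
      using smooth_averaged[OF c] coboundary_averaged[OF c] by blast
  next
    fix c \<psi> assume c: "c \<in> carrier (cocycles \<Gamma>)" and \<psi>: "smooth_on disc \<psi> \<and> c = coboundary \<Gamma> \<psi>"
    then have "continuous_on disc \<psi>"
      by (intro smooth_on_disc_continuous) blast
    then show "\<exists>\<psi>'. has_L2_extension \<psi> \<psi>'"
      using boundary_values_L2_extension boundary_field(2)[OF c] \<psi> by blast
  next
    fix c \<psi> \<psi>' assume "c \<in> carrier (cocycles \<Gamma>)" "smooth_on disc \<psi> \<and> c = coboundary \<Gamma> \<psi>" "has_L2_extension \<psi> \<psi>'"
    then show "tangential \<psi>'"
      using poisson_extension_boundary(1) by blast
  next
    fix c \<psi> \<psi>' assume c: "c \<in> carrier (cocycles \<Gamma>)"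
      and \<psi>: "smooth_on disc \<psi> \<and> c = coboundary \<Gamma> \<psi> \<and> has_L2_extension \<psi> \<psi>'"
    show "harmonic_vector_field disc (poisson_extension \<psi>')"
      using poisson_extension_boundary(2)[OF c] \<psi> by blast
    show "class_map (H1_class \<Gamma> c) = lie_gD_20 (poisson_extension \<psi>')"
      unfolding class_map_H1_class[OF c] using poisson_extension_boundary(3)[OF c] \<psi> by metis
  qed
qed

end
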